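(* Let $n,k\ge 0$ be integers. The group $\mathrm{H}_1(\mathcal{K}^{\mathrm{IA}}_{n,k};\mathbb{Z})$ is free abelian of rank $$n(n-1)k+n\binom{k}{2}+2nk+k(k-1).$$ The abelianization map is given by the restriction of the Johnson homomorphism $\tau$ to $\mathcal{K}^{\mathrm{IA}}_{n,k}$; that is, $\tau|_{\mathcal{K}^{\mathrm{IA}}_{n,k}}$, regarded as a map onto its image, is the abelianization map of $\mathcal{K}^{\mathrm{IA}}_{n,k}$.
   Context: $F_{n,k}$ is the free group on $\{x_1,\dots,x_n,y_1,\dots,y_k\}$ and $F_n$ is the free group on $\{x_1,\dots,x_n\}$. Write $[\![z]\!]$ for the conjugacy class of $z\in F_{n,k}$. Define $$\mathcal{A}_{n,k}=\{f\in\mathrm{Aut}(F_{n,k}) \mid [\![f(y_i)]\!]=[\![y_i]\!] \text{ for } 1\le i\le k\}.$$ The map $F_{n,k}\to F_n$ whose kernel is the normal closure of $\{y_1,\dots,y_k\}$ (sending $x_i\mapsto x_i$) induces a homomorphism $\mathcal{A}_{n,k}\to\mathrm{Aut}(F_n)$, whose kernel is denoted $\mathcal{K}_{n,k}$. Let $\mathrm{IA}_{n,k}$ be the kernel of the natural map $\mathrm{Aut}(F_{n,k})\to\mathrm{GL}_{n+k}(\mathbb{Z})$ given by the action on the abelianization $\mathbb{Z}^{n+k}$ of $F_{n,k}$, and put $\mathcal{K}^{\mathrm{IA}}_{n,k}=\mathcal{K}_{n,k}\cap\mathrm{IA}_{n,k}$. Johnson homomorphism: for $z\in F_{n,k}$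 let $[z]\in\mathbb{Z}^{n+k}$ be its class in the abelianization. Let $\pi:[F_{n,k},F_{n,k}]\to\bigwedge^2\mathbb{Z}^{n+k}$ be the projection with kernel $[F_{n,k},[F_{n,k},F_{n,k}]]$, satisfying $\pi([z,z'])=[z]\wedge[z']$ for $z,z'\in F_{n,k}$. The Johnson homomorphism is the homomorphism $\tau:\mathrm{IA}_{n,k}\to\mathrm{Hom}(\mathbb{Z}^{n+k},\bigwedge^2\mathbb{Z}^{n+k})$ given by $\tau(f)([z])=\pi(f(z)z^{-1})$ for $f\in\mathrm{IA}_{n,k}$, $z\in F_{n,k}$. *)

theory Defs
  imports "HOL-Algebra.Algebra"
begin

section \<open>Free groups as groups of reduced words\<close>

text \<open>A letter \<open>(a, True)\<close> stands for the generator \<open>a\<close>, and \<open>(a, False)\<close> for its inverse.\<close>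

type_synonym 'a word = "('a \<times> bool) list"

definition reduced :: "'a word \<Rightarrow> bool" where
  "reduced w \<longleftrightarrow> successively (\<lambda>p q. \<not> (fst p = fst q \<and> snd p \<noteq> snd q)) w"

fun cons_cancel :: "'a \<times> bool \<Rightarrow> 'a word \<Rightarrow> 'a word" where
  "cons_cancel p [] = [p]"
| "cons_cancel p (q # w) = (if fst p = fst q \<and> snd p \<noteq> snd q then w else p # q # w)"

definition reduce :: "'a word \<Rightarrow> 'a word" where
  "reduce w = foldr cons_cancel w []"

definition free_group :: "'a set \<Rightarrow> 'a word monoid" where
  "free_group S =
     \<lparr>carrier = {w. fst ` set w \<subseteq> S \<and> reduced w},
      monoid.mult = (\<lambda>u v. reduce (u @ v)),
      one = []\<rparr>"

section \<open>General group theory\<close>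

definition conj_class :: "('a, 'b) monoid_scheme \<Rightarrow> 'a \<Rightarrow> 'a set" where
  "conj_class G z = {g \<otimes>\<^bsub>G\<^esub> z \<otimes>\<^bsub>G\<^esub> inv\<^bsub>G\<^esub> g | g. g \<in> carrier G}"

definition comm :: "('a, 'b) monoid_scheme \<Rightarrow> 'a \<Rightarrow> 'a \<Rightarrow> 'a" where
  "comm G a b = a \<otimes>\<^bsub>G\<^esub> b \<otimes>\<^bsub>G\<^esub> inv\<^bsub>G\<^esub> a \<otimes>\<^bsub>G\<^esub> inv\<^bsub>G\<^esub> b"

definition comm_subgroup :: "('a, 'b) monoid_scheme \<Rightarrow> 'a set \<Rightarrow> 'a set \<Rightarrow> 'a set" where
  "comm_subgroup G H K = generate G {comm G a b | a b. a \<in> H \<and> b \<in> K}"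

definition commutator :: "('a, 'b) monoid_scheme \<Rightarrow> 'a set" where
  "commutator G = comm_subgroup G (carrier G) (carrier G)"

definition abelianization :: "('a, 'b) monoid_scheme \<Rightarrow> 'a set monoid" where
  "abelianization G = G Mod commutator G"

definition ab_class :: "('a, 'b) monoid_scheme \<Rightarrow> 'a \<Rightarrow> 'a set" where
  "ab_class G z = commutator G #>\<^bsub>G\<^esub> z"

text \<open>For an abelian group \<open>B\<close>, the group \<open>Hom(A, B)\<close> under pointwise multiplication.\<close>

definition Hom_group ::
  "('a, 'c) monoid_scheme \<Rightarrow> ('b, 'd) monoid_scheme \<Rightarrow> ('a \<Rightarrow> 'b) monoid" where
  "Hom_group A B =
     \<lparr>carrier = hom A B \<inter> extensional (carrier A),
      monoid.mult = (\<lambda>s t. \<lambda>x\<in>carrier A. s x \<otimes>\<^bsub>B\<^esub> t x),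
      one = (\<lambda>x\<in>carrier A. \<one>\<^bsub>B\<^esub>)\<rparr>"

text \<open>The exterior square of an abelian group \<open>A\<close> (written multiplicatively): the free abelian group
  on pairs of elements of \<open>A\<close> modulo bilinearity and \<open>a \<and> a = 0\<close>.\<close>

definition wedge_relators :: "('a, 'b) monoid_scheme \<Rightarrow> ('a \<times> 'a \<Rightarrow>\<^sub>0 int) set" where
  "wedge_relators A =
     {frag_of (a \<otimes>\<^bsub>A\<^esub> b, c) - frag_of (a, c) - frag_of (b, c) | a b c.
        a \<in> carrier A \<and> b \<in> carrier A \<and> c \<in> carrier A}
   \<union> {frag_of (a, b \<otimes>\<^bsub>A\<^esub> c) - frag_of (a, b) - frag_of (a, c) | a b c.
        a \<in> carrier A \<and> b \<in> carrier A \<and> c \<in> carrier A}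
   \<union> {frag_of (a, a) | a. a \<in> carrier A}"

definition wedge_null :: "('a, 'b) monoid_scheme \<Rightarrow> ('a \<times> 'a \<Rightarrow>\<^sub>0 int) set" where
  "wedge_null A = generate (free_Abelian_group (carrier A \<times> carrier A)) (wedge_relators A)"

definition exterior_square :: "('a, 'b) monoid_scheme \<Rightarrow> ('a \<times> 'a \<Rightarrow>\<^sub>0 int) set monoid" where
  "exterior_square A = free_Abelian_group (carrier A \<times> carrier A) Mod wedge_null A"

definition wedge :: "('a, 'b) monoid_scheme \<Rightarrow> 'a \<Rightarrow> 'a \<Rightarrow> ('a \<times> 'a \<Rightarrow>\<^sub>0 int) set" where
  "wedge A a b = wedge_null A #>\<^bsub>free_Abelian_group (carrier A \<times> carrier A)\<^esub> frag_of (a, b)"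

text \<open>First integral group homology, computed from the (inhomogeneous) bar complex of \<open>G\<close> with
  trivial coefficients: \<open>d[g] = [] - []\<close> and \<open>d[g|h] = [h] - [gh] + [g]\<close>.\<close>

definition bar_d1 :: "('a \<Rightarrow>\<^sub>0 int) \<Rightarrow> (unit \<Rightarrow>\<^sub>0 int)" where
  "bar_d1 = frag_extend (\<lambda>g. frag_of () - frag_of ())"

definition bar_d2 :: "('a, 'b) monoid_scheme \<Rightarrow> ('a \<times> 'a \<Rightarrow>\<^sub>0 int) \<Rightarrow> ('a \<Rightarrow>\<^sub>0 int)" where
  "bar_d2 G = frag_extend (\<lambda>(g, h). frag_of h - frag_of (g \<otimes>\<^bsub>G\<^esub> h) + frag_of g)"

definition group_H1 :: "('a, 'b) monoid_scheme \<Rightarrow> ('a \<Rightarrow>\<^sub>0 int) set monoid" where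
  "group_H1 G =
     (free_Abelian_group (carrier G)
        \<lparr>carrier := kernel (free_Abelian_group (carrier G)) (free_Abelian_group {()}) bar_d1\<rparr>)
     Mod (bar_d2 G ` carrier (free_Abelian_group (carrier G \<times> carrier G)))"

section \<open>The groups \<open>F\<^sub>n\<^sub>,\<^sub>k\<close>, \<open>A\<^sub>n\<^sub>,\<^sub>k\<close>, \<open>K\<^sub>n\<^sub>,\<^sub>k\<close> and \<open>IA\<^sub>n\<^sub>,\<^sub>k\<close>\<close>

text \<open>Generators are indexed from 0.\<close>

datatype gen = GX nat | GY nat

definition gens :: "nat \<Rightarrow> nat \<Rightarrow> gen set" where
  "gens n k = GX ` {..<n} \<union> GY ` {..<k}"

abbreviation Fnk :: "nat \<Rightarrow> nat \<Rightarrow> gen word monoid" where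
  "Fnk n k \<equiv> free_group (gens n k)"

definition y_gen :: "nat \<Rightarrow> gen word" where
  "y_gen i = [(GY i, True)]"

definition A_aut :: "nat \<Rightarrow> nat \<Rightarrow> (gen word \<Rightarrow> gen word) set" where
  "A_aut n k = {f \<in> auto (Fnk n k). \<forall>i<k. conj_class (Fnk n k) (f (y_gen i)) = conj_class (Fnk n k) (y_gen i)}"

text \<open>The projection \<open>F\<^sub>n\<^sub>,\<^sub>k \<rightarrow> F\<^sub>n\<close>, where \<open>F\<^sub>n\<close> is \<open>Fnk n 0\<close>, a subset of \<open>Fnk n k\<close>.\<close>

definition kill_y :: "gen word \<Rightarrow> gen word" where
  "kill_y w = reduce (filter (\<lambda>p. \<exists>i. fst p = GX i) w)"

text \<open>The automorphism \<open>g\<close> of \<open>F\<^sub>n\<close> induced by \<open>f\<close> satisfies \<open>g (kill_y z) = kill_y (f z)\<close>;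
  since \<open>kill_y\<close> fixes \<open>F\<^sub>n\<close> pointwise, this amounts to the following formula.\<close>

definition induced_aut :: "nat \<Rightarrow> (gen word \<Rightarrow> gen word) \<Rightarrow> (gen word \<Rightarrow> gen word)" where
  "induced_aut n f = (\<lambda>w\<in>carrier (Fnk n 0). kill_y (f w))"

definition K_aut :: "nat \<Rightarrow> nat \<Rightarrow> (gen word \<Rightarrow> gen word) set" where
  "K_aut n k = kernel (AutoGroup (Fnk n k)\<lparr>carrier := A_aut n k\<rparr>) (AutoGroup (Fnk n 0)) (induced_aut n)"

text \<open>The action of \<open>f\<close> on the abelianization takes the coset of \<open>z\<close> to the coset of \<open>f z\<close>, which is
  its image under \<open>f\<close>. The group \<open>GL\<^sub>n\<^sub>+\<^sub>k(\<int>)\<close> is the automorphism group of the abelianization.\<close>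

definition ab_action ::
  "nat \<Rightarrow> nat \<Rightarrow> (gen word \<Rightarrow> gen word) \<Rightarrow> (gen word set \<Rightarrow> gen word set)" where
  "ab_action n k f = (\<lambda>C\<in>carrier (abelianization (Fnk n k)). f ` C)"

definition IA :: "nat \<Rightarrow> nat \<Rightarrow> (gen word \<Rightarrow> gen word) set" where
  "IA n k = kernel (AutoGroup (Fnk n k)) (AutoGroup (abelianization (Fnk n k))) (ab_action n k)"

definition K_IA :: "nat \<Rightarrow> nat \<Rightarrow> (gen word \<Rightarrow> gen word) monoid" where
  "K_IA n k = AutoGroup (Fnk n k)\<lparr>carrier := K_aut n k \<inter> IA n k\<rparr>"

section \<open>The Johnson homomorphism\<close>

type_synonym ext_sq = "(gen word set \<times> gen word set \<Rightarrow>\<^sub>0 int) set"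

abbreviation ext2 :: "nat \<Rightarrow> nat \<Rightarrow> ext_sq monoid" where
  "ext2 n k \<equiv> exterior_square (abelianization (Fnk n k))"

definition johnson_pi :: "nat \<Rightarrow> nat \<Rightarrow> gen word \<Rightarrow> ext_sq" where
  "johnson_pi n k =
     (let D = Fnk n k\<lparr>carrier := commutator (Fnk n k)\<rparr> in
      THE p. p \<in> epi D (ext2 n k) \<and> p \<in> extensional (carrier D)
        \<and> kernel D (ext2 n k) p = comm_subgroup (Fnk n k) (carrier (Fnk n k)) (commutator (Fnk n k))
        \<and> (\<forall>z\<in>carrier (Fnk n k). \<forall>z'\<in>carrier (Fnk n k).
             p (comm (Fnk n k) z z') =
             wedge (abelianization (Fnk n k)) (ab_class (Fnk n k) z) (ab_class (Fnk n k) z')))"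

definition johnson_hom ::
  "nat \<Rightarrow> nat \<Rightarrow> (gen word \<Rightarrow> gen word) \<Rightarrow> (gen word set \<Rightarrow> ext_sq)" where
  "johnson_hom n k f =
     (THE t. t \<in> carrier (Hom_group (abelianization (Fnk n k)) (ext2 n k))
        \<and> (\<forall>z\<in>carrier (Fnk n k).
             t (ab_class (Fnk n k) z) = johnson_pi n k (f z \<otimes>\<^bsub>Fnk n k\<^esub> inv\<^bsub>Fnk n k\<^esub> z)))"

definition johnson_image :: "nat \<Rightarrow> nat \<Rightarrow> (gen word set \<Rightarrow> ext_sq) monoid" where
  "johnson_image n k =
     Hom_group (abelianization (Fnk n k)) (ext2 n k)
       \<lparr>carrier := johnson_hom n k ` carrier (K_IA n k)\<rparr>"

end

theory Submission
  imports Defs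
begin

text \<open>
  Write \<open>F\<close> for the free group, \<open>A\<close> for the group of automorphisms preserving the conjugacy classes
  of the \<open>y\<^sub>j\<close>, \<open>K\<close> for the kernel of its action on the quotient by the \<open>y\<^sub>j\<close>, and \<open>J\<close> for the
  subgroup of \<open>K\<close> acting trivially on the abelianization of \<open>F\<close>. The theorem is a generation
  statement combined with a dual family of integer-valued homomorphisms: as many elements of \<open>J\<close> as
  the claimed rank generate \<open>J\<close> modulo commutators, and for each of them there is a coordinate of
  the Johnson homomorphism that is 1 on it and 0 on the others. Hence the abelianization of
  \<open>J\<close> is free on the classes of these elements, and the Johnson homomorphism, which factors through
  the abelianization, is injective there. Since the bar complex presents \<open>H\<^sub>1\<close> as the free abelian
  group on the elements of a group modulo \<open>[g] + [h] = [gh]\<close>, it is the abelianization.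

  Generation is proved in three stages.
  By Nielsen reduction, \<open>A\<close> is generated by the transvections \<open>x\<^sub>i \<mapsto> x\<^sub>i v\<close>, \<open>x\<^sub>i \<mapsto> v x\<^sub>i\<close>,
  \<open>y\<^sub>j \<mapsto> v y\<^sub>j v\<inverse>\<close> for letters \<open>v\<close> and the signed permutations of the \<open>x\<^sub>i\<close>
  (\<open>A_aut_generated\<close>). An automorphism is measured by the total length of the images of the
  generators, ties being broken by a lexicographic weight of their two halves; if no transvection
  lowers this measure, the images of letters cancel so little that no word gets shorter, so the
  inverse maps letters to letters. The new point compared to the classical argument is that \<open>y\<^sub>j\<close> may
  only be conjugated, which suffices because its image is a conjugate \<open>g y\<^sub>j g\<inverse>\<close>, and shortening
  this word amounts to shortening \<open>g\<close>.

  Next, the transvections involving a \<open>y\<close> letter generate \<open>K\<close> (\<open>K_aut_eq\<close>): the subgroup they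
  generate is stable under conjugation by the generators of \<open>A\<close> that involve only \<open>x\<close> letters, so
  every element of \<open>A\<close> is a product of an element of this subgroup and one that fixes all \<open>y\<^sub>j\<close> and
  preserves the free group on the \<open>x\<^sub>i\<close>; if the product lies in \<open>K\<close>, the second factor is trivial.

  Finally, \<open>K\<close> acts on the abelianization by \<open>x\<^sub>i \<mapsto> x\<^sub>i + (\<Sum>j. m\<^sub>i\<^sub>j y\<^sub>j)\<close>, and \<open>J\<close> is the kernel of the
  resulting map to \<open>\<int>\<^sup>n\<^sup>k\<close>. Let \<open>L\<close> be generated by the commutator subgroup of \<open>J\<close>
  and the automorphisms \<open>x\<^sub>i \<mapsto> y\<^sub>j\<inverse> x\<^sub>i y\<^sub>j\<close>, \<open>x\<^sub>i \<mapsto> x\<^sub>i [x\<^sub>h, y\<^sub>j]\<close>, \<open>x\<^sub>i \<mapsto> x\<^sub>i [y\<^sub>j, y\<^sub>l]\<close> and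
  \<open>y\<^sub>j \<mapsto> v y\<^sub>j v\<inverse>\<close>. It is normal in \<open>K\<close>, and modulo it the remaining generators
  \<open>x\<^sub>i \<mapsto> x\<^sub>i y\<^sub>j\<close> of \<open>K\<close> commute and are separated by the integers \<open>m\<^sub>i\<^sub>j\<close>. So an element of \<open>J\<close> lies in
  \<open>L\<close> (\<open>J_eq_L\<close>).

  The coordinates come from the second-order coefficients of the Magnus expansion. On the commutator
  subgroup of \<open>F\<close> they are homomorphisms, and every alternating bilinear map on \<open>F\<close> is the product of
  its values on pairs of generators raised to determinants of exponent sums. So an alternating bilinear map induces a
  homomorphism on the commutator subgroup, given by a formula in the Magnus coefficients. Applied to the
  wedge product, this constructs the projection \<open>\<pi>\<close>; applied to the commutator modulo the third
  term of the lower central series, it shows that the kernel of \<open>\<pi>\<close> is that third term.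
\<close>

section \<open>Words, reduction, and substitution endomorphisms\<close>

definition flip :: "'a \<times> bool \<Rightarrow> 'a \<times> bool" where
  "flip p = (fst p, \<not> snd p)"

definition winv :: "'a word \<Rightarrow> 'a word" where
  "winv w = rev (map flip w)"

lemma flip_flip [simp]: "flip (flip p) = p"
  by (simp add: flip_def)

lemma fst_flip [simp]: "fst (flip p) = fst p"
  by (simp add: flip_def)

lemma snd_flip [simp]: "snd (flip p) = (\<not> snd p)"
  by (simp add: flip_def)

lemma flip_neq [simp]: "flip p \<noteq> p" "p \<noteq> flip p"
  by (auto simp: flip_def prod_eq_iff)

lemma flip_Pair [simp]: "flip (a, b) = (a, \<not> b)"
  by (simp add: flip_def)

lemma flip_eq_iff: "flip p = q \<longleftrightarrow> p = flip q"
  by auto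

lemma cancel_iff_flip: "fst p = fst q \<and> snd p \<noteq> snd q \<longleftrightarrow> q = flip p"
  by (auto simp: flip_def prod_eq_iff)

lemma winv_Nil [simp]: "winv [] = []"
  and winv_append [simp]: "winv (u @ v) = winv v @ winv u"
  and winv_Cons: "winv (p # w) = winv w @ [flip p]"
  and winv_winv [simp]: "winv (winv w) = w"
  and length_winv [simp]: "length (winv w) = length w"
  and fst_set_winv [simp]: "fst ` set (winv w) = fst ` set w"
  by (simp_all add: winv_def rev_map comp_def image_image)

lemma winv_eq_Nil_iff [simp]: "winv w = [] \<longleftrightarrow> w = []"
  by (simp add: winv_def)

lemma winv_single [simp]: "winv [p] = [flip p]"
  by (simp add: winv_def)

lemma winv_inject [simp]: "winv u = winv v \<longleftrightarrow> u = v"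
  by (metis winv_winv)

lemma reduced_Nil [simp]: "reduced []"
  by (simp add: reduced_def)

lemma reduced_single [simp]: "reduced [p]"
  by (simp add: reduced_def)

lemma reduced_Cons: "reduced (p # w) \<longleftrightarrow> reduced w \<and> (w = [] \<or> hd w \<noteq> flip p)"
proof (cases w)
  case (Cons q v)
  then show ?thesis using cancel_iff_flip[of p q] by (auto simp: reduced_def)
qed simp

lemma reduced_append:
  "reduced (u @ v) \<longleftrightarrow> reduced u \<and> reduced v \<and> (u = [] \<or> v = [] \<or> hd v \<noteq> flip (last u))"
proof (induction u)
  case (Cons p u)
  then show ?case by (cases u) (auto simp: reduced_Cons)
qed auto

lemma reduced_winv [simp]: "reduced (winv w) \<longleftrightarrow> reduced w"
proof (induction w)
  case (Cons p w)
  have "last (winv w) = flip (hd w)" if "w \<noteq> []"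
    using that by (cases w) (auto simp: winv_Cons)
  then show ?case
    using Cons by (auto simp: winv_Cons reduced_append reduced_Cons)
qed simp

lemma cons_cancel_eq: "cons_cancel p w = (if w \<noteq> [] \<and> hd w = flip p then tl w else p # w)"
proof (cases w)
  case (Cons q v)
  then show ?thesis using cancel_iff_flip[of p q] by auto
qed simp

lemma reduced_tl: "reduced w \<Longrightarrow> reduced (tl w)"
  by (cases w) (auto simp: reduced_Cons)

lemma reduced_cons_cancel: "reduced w \<Longrightarrow> reduced (cons_cancel p w)"
  by (auto simp: cons_cancel_eq reduced_Cons reduced_tl)

lemma reduced_foldr: "reduced w \<Longrightarrow> reduced (foldr cons_cancel u w)"
  by (induction u) (auto simp: reduced_cons_cancel)

lemma reduced_reduce [simp]: "reduced (reduce w)"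
  by (simp add: reduce_def reduced_foldr)

lemma reduce_Nil [simp]: "reduce [] = []"
  by (simp add: reduce_def)

lemma reduce_Cons: "reduce (p # w) = cons_cancel p (reduce w)"
  by (simp add: reduce_def)

lemma reduce_reduced: "reduced w \<Longrightarrow> reduce w = w"
proof (induction w)
  case (Cons p w)
  then show ?case by (auto simp: reduce_Cons reduced_Cons cons_cancel_eq)
qed simp

lemma reduce_reduce [simp]: "reduce (reduce w) = reduce w"
  by (simp add: reduce_reduced)

lemma cons_cancel_flip:
  "reduced w \<Longrightarrow> cons_cancel (flip p) (cons_cancel p w) = w"
  by (cases w) (auto simp: cons_cancel_eq reduced_Cons)

lemma cons_cancel_flip':
  "reduced w \<Longrightarrow> cons_cancel p (cons_cancel (flip p) w) = w"
  using cons_cancel_flip[of w "flip p"] by simp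

lemma reduce_append: "reduce (u @ v) = foldr cons_cancel u (reduce v)"
  by (simp add: reduce_def)

lemma reduce_append_reduce [simp]: "reduce (u @ reduce v) = reduce (u @ v)"
  by (simp add: reduce_append)

text \<open>Reducing a word acts on reduced words through the action of its letters, because the letters
  \<open>p\<close> and \<open>flip p\<close> act by mutually inverse maps. This makes reduction compatible with
  concatenation without any confluence argument.\<close>

lemma foldr_cons_cancel:
  "reduced w \<Longrightarrow> foldr cons_cancel (cons_cancel p u) w = cons_cancel p (foldr cons_cancel u w)"
proof (cases u)
  case (Cons q u')
  assume w: "reduced w"
  then show ?thesis
    using cons_cancel_flip'[OF reduced_foldr[OF w, of u'], of p]
    by (auto simp: cons_cancel_eq[of p "q # u'"] Cons simp del: cons_cancel.simps)
qed simp

lemma reduce_reduce_append [simp]: "reduce (reduce u @ v) = reduce (u @ v)"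
proof (induction u)
  case (Cons p u)
  have "reduce (reduce (p # u) @ v) = foldr cons_cancel (cons_cancel p (reduce u)) (reduce v)"
    by (simp add: reduce_append reduce_Cons)
  also have "\<dots> = cons_cancel p (reduce (reduce u @ v))"
    by (simp add: foldr_cons_cancel reduce_append)
  finally show ?case using Cons by (simp add: reduce_Cons)
qed simp

lemma reduce_append_cong:
  "reduce u = reduce u' \<Longrightarrow> reduce v = reduce v' \<Longrightarrow> reduce (u @ v) = reduce (u' @ v')"
  by (metis reduce_append_reduce reduce_reduce_append)

lemma reduce_reduce_append_mid [simp]: "reduce (t @ reduce u @ v) = reduce (t @ u @ v)"
  by (metis reduce_append_reduce reduce_reduce_append)

lemma reduce_flip_pair [simp]: "reduce (p # flip p # w) = reduce w"
  by (simp add: reduce_Cons cons_cancel_flip')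

lemma reduce_winv_right [simp]: "reduce (w @ winv w) = []"
proof (induction w)
  case (Cons p w)
  have "reduce ((p # w) @ winv (p # w)) = reduce ([p] @ (w @ winv w) @ [flip p])"
    by (simp add: winv_Cons)
  also have "\<dots> = reduce ([p] @ reduce (w @ winv w) @ [flip p])"
    by (simp only: reduce_reduce_append_mid)
  also have "\<dots> = []" by (simp only: Cons) (simp add: reduce_def flip_def)
  finally show ?case .
qed simp

lemma reduce_winv_left [simp]: "reduce (winv w @ w) = []"
  using reduce_winv_right[of "winv w"] by simp

lemma reduce_winv_cancel [simp]:
  "reduce (winv w @ w @ v) = reduce v" "reduce (w @ winv w @ v) = reduce v"
  by (metis append.assoc append_Nil reduce_winv_left reduce_reduce_append)
     (metis append.assoc append_Nil reduce_winv_right reduce_reduce_append)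

lemma reduce_winv_cancel_mid:
  "reduce (t @ winv w @ w @ v) = reduce (t @ v)" "reduce (t @ w @ winv w @ v) = reduce (t @ v)"
  by (metis reduce_append_cong reduce_winv_cancel)+

lemma reduce_winv: "reduce (winv w) = winv (reduce w)"
proof -
  have "reduce (winv w) = reduce ((winv w @ w) @ winv (reduce w))"
    by (metis append.assoc append_Nil2 reduce_append_cong reduce_append_reduce reduce_reduce_append
        reduce_winv_right)
  also have "\<dots> = winv (reduce w)"
    by (simp add: reduce_reduced)
  finally show ?thesis .
qed

lemma fst_set_cons_cancel: "fst ` set (cons_cancel p w) \<subseteq> insert (fst p) (fst ` set w)"
  by (cases w) auto

lemma fst_set_reduce: "fst ` set (reduce w) \<subseteq> fst ` set w"
proof (induction w)
  case (Cons p w)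
  have "fst ` set (reduce (p # w)) \<subseteq> insert (fst p) (fst ` set (reduce w))"
    unfolding reduce_Cons by (rule fst_set_cons_cancel)
  also have "\<dots> \<subseteq> insert (fst p) (fst ` set w)" using Cons by (rule insert_mono)
  finally show ?case by simp
qed simp

lemma carrier_free_group:
  "w \<in> carrier (free_group S) \<longleftrightarrow> fst ` set w \<subseteq> S \<and> reduced w"
  by (simp add: free_group_def)

lemma mult_free_group [simp]: "u \<otimes>\<^bsub>free_group S\<^esub> v = reduce (u @ v)"
  by (simp add: free_group_def)

lemma one_free_group [simp]: "\<one>\<^bsub>free_group S\<^esub> = []"
  by (simp add: free_group_def)

lemma reduce_in_free_group: "fst ` set w \<subseteq> S \<Longrightarrow> reduce w \<in> carrier (free_group S)"
  using fst_set_reduce[of w] by (auto simp: carrier_free_group)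

lemma group_free_group: "group (free_group S)"
proof (rule groupI)
  fix x y z assume "x \<in> carrier (free_group S)" "y \<in> carrier (free_group S)"
    "z \<in> carrier (free_group S)"
  show "x \<otimes>\<^bsub>free_group S\<^esub> y \<otimes>\<^bsub>free_group S\<^esub> z = x \<otimes>\<^bsub>free_group S\<^esub> (y \<otimes>\<^bsub>free_group S\<^esub> z)"
    by simp
next
  fix x assume "x \<in> carrier (free_group S)"
  then show "\<exists>y\<in>carrier (free_group S). y \<otimes>\<^bsub>free_group S\<^esub> x = \<one>\<^bsub>free_group S\<^esub>"
    by (intro bexI[of _ "winv x"]) (auto simp: carrier_free_group)
next
  fix x y assume "x \<in> carrier (free_group S)" "y \<in> carrier (free_group S)"
  then show "x \<otimes>\<^bsub>free_group S\<^esub> y \<in> carrier (free_group S)"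
    unfolding mult_free_group by (intro reduce_in_free_group) (simp add: carrier_free_group image_Un)
qed (auto simp: carrier_free_group reduce_reduced)

lemma inv_free_group: "x \<in> carrier (free_group S) \<Longrightarrow> inv\<^bsub>free_group S\<^esub> x = winv x"
  by (rule group.inv_equality[OF group_free_group]) (auto simp: carrier_free_group)

definition gen_word :: "'a \<Rightarrow> 'a word" where
  "gen_word a = [(a, True)]"

lemma letter_in_free_group [simp]: "[p] \<in> carrier (free_group S) \<longleftrightarrow> fst p \<in> S"
  by (simp add: carrier_free_group)

lemma free_group_induct [consumes 1, case_names Nil Cons]:
  assumes "w \<in> carrier (free_group S)" "P []"
    "\<And>p w. fst p \<in> S \<Longrightarrow> w \<in> carrier (free_group S) \<Longrightarrow> P w \<Longrightarrow> P ([p] \<otimes>\<^bsub>free_group S\<^esub> w)"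
  shows "P w"
  using assms(1)
proof (induction w)
  case (Cons p w)
  then have w: "w \<in> carrier (free_group S)" "fst p \<in> S" "reduced (p # w)"
    by (auto simp: carrier_free_group reduced_Cons)
  then have "P ([p] \<otimes>\<^bsub>free_group S\<^esub> w)" using Cons.IH assms(3) by blast
  then show ?case using w(3) by (simp add: reduce_reduced)
qed (rule assms(2))

text \<open>The uniqueness half of the universal property. It is the only way in which maps out of a free group
  are compared below.\<close>

lemma free_group_hom_eqI:
  assumes "group H" "f \<in> hom (free_group S) H" "g \<in> hom (free_group S) H"
    and eq: "\<And>a. a \<in> S \<Longrightarrow> f [(a, True)] = g [(a, True)]"
    and w: "w \<in> carrier (free_group S)"
  shows "f w = g w"
proof -
  interpret F: group "free_group S" by (rule group_free_group)
  interpret f: group_hom "free_group S" H f by (intro group_hom.intro group_hom_axioms.intro assms F.group_axioms)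
  interpret g: group_hom "free_group S" H g by (intro group_hom.intro group_hom_axioms.intro assms F.group_axioms)
  have letter: "f [p] = g [p]" if "fst p \<in> S" for p
  proof (cases p)
    case (Pair a b)
    have a: "f [(a, True)] = g [(a, True)]" "[(a, True)] \<in> carrier (free_group S)"
      using that Pair eq by auto
    have "f (inv\<^bsub>free_group S\<^esub> [(a, True)]) = g (inv\<^bsub>free_group S\<^esub> [(a, True)])"
      using a by simp
    then show ?thesis
      using a Pair by (cases b) (simp_all add: inv_free_group)
  qed
  show ?thesis using w
  proof (induction w rule: free_group_induct)
    case Nil
    then show ?case using f.hom_one g.hom_one by simp
  next
    case (Cons p w)
    then show ?case
      using letter[of p] f.hom_mult[of "[p]" w] g.hom_mult[of "[p]" w] by simp
  qed
qed

text \<open>The existence half: the homomorphism determined by images of the generators, defined on all words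
  and with reduced values.\<close>

definition subst :: "('a \<Rightarrow> 'b word) \<Rightarrow> 'a word \<Rightarrow> 'b word" where
  "subst \<phi> w = reduce (concat (map (\<lambda>p. if snd p then \<phi> (fst p) else winv (\<phi> (fst p))) w))"

lemma subst_Nil [simp]: "subst \<phi> [] = []"
  by (simp add: subst_def)

lemma reduced_subst [simp]: "reduced (subst \<phi> w)"
  by (simp add: subst_def)

lemma subst_append: "subst \<phi> (u @ v) = reduce (subst \<phi> u @ subst \<phi> v)"
  by (simp add: subst_def)

lemma subst_Cons:
  "subst \<phi> (p # w) = reduce ((if snd p then \<phi> (fst p) else winv (\<phi> (fst p))) @ subst \<phi> w)"
  by (simp add: subst_def)

lemma subst_winv: "subst \<phi> (winv w) = winv (subst \<phi> w)"
proof (induction w)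
  case (Cons p w)
  have "subst \<phi> [flip p] = winv (subst \<phi> [p])"
    by (simp add: subst_Cons reduce_winv)
  then have "subst \<phi> (winv (p # w)) = reduce (winv (subst \<phi> ([p] @ w)))"
    unfolding winv_Cons subst_append Cons by (simp add: reduce_winv flip: winv_append)
  then show ?case by (simp add: reduce_reduced)
qed simp

lemma subst_reduce [simp]: "subst \<phi> (reduce w) = subst \<phi> w"
proof (induction w)
  case (Cons p w)
  have "subst \<phi> (cons_cancel p v) = subst \<phi> (p # v)" for v
  proof (cases "v \<noteq> [] \<and> hd v = flip p")
    case True
    then obtain v' where v: "v = flip p # v'" by (cases v) auto
    have "subst \<phi> (p # flip p # v') = subst \<phi> v'"
      by (simp add: subst_def)
    then show ?thesis by (simp add: v cons_cancel_eq)
  qed (simp only: cons_cancel_eq if_False)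
  then have "subst \<phi> (reduce (p # w)) = subst \<phi> (p # reduce w)"
    by (simp add: reduce_Cons)
  then show ?case using Cons by (simp add: subst_Cons)
qed simp

lemma subst_cong:
  assumes "\<And>a. a \<in> fst ` set w \<Longrightarrow> reduce (\<phi> a) = reduce (\<psi> a)"
  shows "subst \<phi> w = subst \<psi> w"
  using assms
proof (induction w)
  case (Cons p w)
  then have "reduce (\<phi> (fst p)) = reduce (\<psi> (fst p))" "subst \<phi> w = subst \<psi> w" by auto
  then show ?case
    unfolding subst_Cons by (intro reduce_append_cong) (auto simp: reduce_winv)
qed simp

lemma subst_subst: "subst \<phi> (subst \<psi> w) = subst (\<lambda>a. subst \<phi> (\<psi> a)) w"
proof (induction w)
  case (Cons p w)
  then show ?case
    by (simp add: subst_Cons[of "\<lambda>a. subst \<phi> (\<psi> a)"] subst_Cons[of \<psi>] subst_append subst_winv)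
qed simp

lemma subst_gen_word: "subst gen_word w = reduce w"
proof (induction w)
  case (Cons p w)
  then show ?case
    by (cases p) (auto simp: subst_Cons gen_word_def reduce_Cons)
qed simp

lemma subst_single [simp]: "subst \<phi> [(a, True)] = reduce (\<phi> a)"
  "subst \<phi> [(a, False)] = winv (reduce (\<phi> a))"
  by (simp_all add: subst_def reduce_winv)

lemma fst_set_subst: "fst ` set (subst \<phi> w) \<subseteq> (\<Union>a\<in>fst ` set w. fst ` set (\<phi> a))"
proof -
  have "fst ` set (if snd p then \<phi> (fst p) else winv (\<phi> (fst p))) = fst ` set (\<phi> (fst p))" for p
    by simp
  from this have "fst ` set (concat (map (\<lambda>p. if snd p then \<phi> (fst p) else winv (\<phi> (fst p))) w))
    = (\<Union>p\<in>set w. fst ` set (\<phi> (fst p)))"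
    by (simp only: set_concat set_map image_Union image_image UN_simps)
  also have "\<dots> = (\<Union>a\<in>fst ` set w. fst ` set (\<phi> a))"
    by simp
  finally show ?thesis
    unfolding subst_def by (rule order_trans[OF fst_set_reduce equalityD1])
qed

lemma subst_in_free_group:
  assumes "\<And>a. a \<in> S \<Longrightarrow> fst ` set (\<phi> a) \<subseteq> T" "fst ` set w \<subseteq> S"
  shows "subst \<phi> w \<in> carrier (free_group T)"
  using fst_set_subst[of \<phi> w] assms by (fastforce simp: carrier_free_group)

lemma subst_hom:
  assumes "\<And>a. a \<in> S \<Longrightarrow> fst ` set (\<phi> a) \<subseteq> T"
  shows "subst \<phi> \<in> hom (free_group S) (free_group T)"
proof (rule homI)
  show "subst \<phi> x \<in> carrier (free_group T)" if "x \<in> carrier (free_group S)" for x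
    using that assms by (intro subst_in_free_group[of S]) (auto simp: carrier_free_group)
qed (simp add: subst_append)

text \<open>Every homomorphism is a substitution, so its values are controlled by the letters
  occurring in the images of the generators.\<close>

lemma hom_eq_subst:
  assumes "f \<in> hom (free_group S) (free_group T)" "w \<in> carrier (free_group S)"
  shows "f w = subst (\<lambda>a. f [(a, True)]) w"
proof (rule free_group_hom_eqI[OF group_free_group assms(1) _ _ assms(2)])
  have *: "f [(a, True)] \<in> carrier (free_group T)" if "a \<in> S" for a
    using that assms(1) by (auto simp: hom_def Pi_iff)
  then show "subst (\<lambda>a. f [(a, True)]) \<in> hom (free_group S) (free_group T)"
    by (intro subst_hom) (auto simp: carrier_free_group)
  show "f [(a, True)] = subst (\<lambda>a. f [(a, True)]) [(a, True)]" if "a \<in> S" for a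
    using *[OF that] by (simp add: carrier_free_group reduce_reduced)
qed

section \<open>Automorphisms given by substitutions\<close>

text \<open>Automorphisms in the sense of \<^const>\<open>auto\<close> are undefined outside the carrier, whence the
  restriction.\<close>

definition subst_map :: "'a set \<Rightarrow> ('a \<Rightarrow> 'a word) \<Rightarrow> 'a word \<Rightarrow> 'a word" where
  "subst_map S \<phi> = restrict (subst \<phi>) (carrier (free_group S))"

abbreviation "\<AA> S \<equiv> AutoGroup (free_group S)"

lemma group_AutoGroup: "group (\<AA> S)"
  by (rule group.AutoGroup[OF group_free_group])

lemma carrier_AutoGroup: "carrier (AutoGroup G) = auto G"
  by (simp add: AutoGroup_def)

lemma auto_hom: "f \<in> auto G \<Longrightarrow> f \<in> hom G G"
  by (simp add: auto_def)

lemma one_AutoGroup: "\<one>\<^bsub>AutoGroup G\<^esub> = (\<lambda>x\<in>carrier G. x)"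
  by (simp add: AutoGroup_def BijGroup_def)

lemma mult_AutoGroup: "f \<in> auto G \<Longrightarrow> g \<in> auto G \<Longrightarrow> f \<otimes>\<^bsub>AutoGroup G\<^esub> g = compose (carrier G) f g"
  by (simp add: AutoGroup_def BijGroup_def auto_def)

lemma mult_AutoGroup_apply:
  "f \<in> auto G \<Longrightarrow> g \<in> auto G \<Longrightarrow> x \<in> carrier G \<Longrightarrow> (f \<otimes>\<^bsub>AutoGroup G\<^esub> g) x = f (g x)"
  by (simp add: mult_AutoGroup compose_def)

lemma auto_closed: "f \<in> auto G \<Longrightarrow> x \<in> carrier G \<Longrightarrow> f x \<in> carrier G"
  by (auto simp: auto_def hom_def)

lemma carrier_AA: "carrier (\<AA> S) = auto (free_group S)"
  by (rule carrier_AutoGroup)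

lemma
  assumes f: "f \<in> auto (free_group S)"
  shows auto_inv_closed: "inv\<^bsub>\<AA> S\<^esub> f \<in> auto (free_group S)"
    and auto_inv_left: "x \<in> carrier (free_group S) \<Longrightarrow> (inv\<^bsub>\<AA> S\<^esub> f) (f x) = x"
    and auto_inv_right: "x \<in> carrier (free_group S) \<Longrightarrow> f ((inv\<^bsub>\<AA> S\<^esub> f) x) = x"
proof -
  interpret A: group "\<AA> S" by (rule group_AutoGroup)
  show c: "inv\<^bsub>\<AA> S\<^esub> f \<in> auto (free_group S)"
    using A.inv_closed[of f] f by (simp add: carrier_AA)
  show "(inv\<^bsub>\<AA> S\<^esub> f) (f x) = x" if "x \<in> carrier (free_group S)"
    using mult_AutoGroup_apply[OF c f that] A.l_inv[of f] f that by (simp add: carrier_AA one_AutoGroup)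
  show "f ((inv\<^bsub>\<AA> S\<^esub> f) x) = x" if "x \<in> carrier (free_group S)"
    using mult_AutoGroup_apply[OF f c that] A.r_inv[of f] f that by (simp add: carrier_AA one_AutoGroup)
qed

lemma subst_map_apply: "fst ` set w \<subseteq> S \<Longrightarrow> reduced w \<Longrightarrow> subst_map S \<phi> w = subst \<phi> w"
  by (simp add: subst_map_def carrier_free_group)

lemma auto_eqI:
  assumes "f \<in> auto (free_group S)" "g \<in> auto (free_group S)"
    "\<And>a. a \<in> S \<Longrightarrow> f [(a, True)] = g [(a, True)]"
  shows "f = g"
proof (rule extensionalityI)
  show "f \<in> extensional (carrier (free_group S))" "g \<in> extensional (carrier (free_group S))"
    using assms(1,2) by (auto simp: auto_def Bij_def)
  show "f x = g x" if "x \<in> carrier (free_group S)" for x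
    by (rule free_group_hom_eqI[OF group_free_group auto_hom auto_hom])
       (use assms that in simp_all)
qed

lemma auto_eq_subst_map:
  assumes "f \<in> auto (free_group S)"
  shows "f = subst_map S (\<lambda>a. f [(a, True)])"
proof (rule extensionalityI)
  show "f \<in> extensional (carrier (free_group S))"
    using assms by (auto simp: auto_def Bij_def)
  show "subst_map S (\<lambda>a. f [(a, True)]) \<in> extensional (carrier (free_group S))"
    by (simp add: subst_map_def)
  show "f x = subst_map S (\<lambda>a. f [(a, True)]) x" if "x \<in> carrier (free_group S)" for x
    using hom_eq_subst[OF auto_hom[OF assms] that] that by (simp add: subst_map_def)
qed

text \<open>A substitution is invertible as soon as another one undoes it on the generators.\<close>

lemma subst_map_auto:
  assumes \<phi>: "\<And>a. a \<in> S \<Longrightarrow> fst ` set (\<phi> a) \<subseteq> S" and \<psi>: "\<And>a. a \<in> S \<Longrightarrow> fst ` set (\<psi> a) \<subseteq> S"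
    and "\<And>a. a \<in> S \<Longrightarrow> subst \<phi> (\<psi> a) = [(a, True)]"
    and "\<And>a. a \<in> S \<Longrightarrow> subst \<psi> (\<phi> a) = [(a, True)]"
  shows "subst_map S \<phi> \<in> auto (free_group S)"
proof -
  let ?F = "carrier (free_group S)"
  have 1: "subst \<phi> (subst \<psi> w) = w" if "w \<in> ?F" for w
  proof -
    have "subst \<phi> (subst \<psi> w) = subst gen_word w"
      unfolding subst_subst using that assms(3)
      by (intro subst_cong) (auto simp: carrier_free_group gen_word_def)
    then show ?thesis using that by (simp add: subst_gen_word reduce_reduced carrier_free_group)
  qed
  have 2: "subst \<psi> (subst \<phi> w) = w" if "w \<in> ?F" for w
  proof -
    have "subst \<psi> (subst \<phi> w) = subst gen_word w"
      unfolding subst_subst using that assms(4)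
      by (intro subst_cong) (auto simp: carrier_free_group gen_word_def)
    then show ?thesis using that by (simp add: subst_gen_word reduce_reduced carrier_free_group)
  qed
  have cl: "subst \<phi> w \<in> ?F" "subst \<psi> w \<in> ?F" if "w \<in> ?F" for w
    using that \<phi> \<psi> subst_in_free_group[of S _ S w] by (simp_all add: carrier_free_group)
  have "bij_betw (subst \<phi>) ?F ?F"
    by (rule bij_betwI[of _ _ _ "subst \<psi>"]) (use 1 2 cl in auto)
  moreover have "subst_map S \<phi> \<in> hom (free_group S) (free_group S)"
    using subst_hom[of S \<phi> S] \<phi> group.is_monoid[OF group_free_group, of S]
    by (auto simp: subst_map_def hom_def Pi_iff monoid.m_closed simp del: mult_free_group)
  ultimately show ?thesis
    by (simp add: auto_def Bij_def subst_map_def bij_betw_restrict_eq)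
qed

lemma subst_map_mult:
  assumes "subst_map S \<phi> \<in> auto (free_group S)" "subst_map S \<psi> \<in> auto (free_group S)"
  shows "subst_map S \<phi> \<otimes>\<^bsub>\<AA> S\<^esub> subst_map S \<psi> = subst_map S (\<lambda>a. subst \<phi> (\<psi> a))"
proof -
  show ?thesis
    unfolding mult_AutoGroup[OF assms]
  proof (rule ext)
    fix w
    show "compose (carrier (free_group S)) (subst_map S \<phi>) (subst_map S \<psi>) w
      = subst_map S (\<lambda>a. subst \<phi> (\<psi> a)) w"
    using auto_closed[OF assms(2), of w]
    by (cases "w \<in> carrier (free_group S)") (simp_all add: compose_def subst_map_def subst_subst)
  qed
qed

lemma subst_map_eqI:
  assumes "\<And>a. a \<in> S \<Longrightarrow> reduce (\<phi> a) = reduce (\<psi> a)"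
  shows "subst_map S \<phi> = subst_map S \<psi>"
  unfolding subst_map_def
proof (rule restrict_ext)
  fix w assume w: "w \<in> carrier (free_group S)"
  have "reduce (\<phi> a) = reduce (\<psi> a)" if "a \<in> fst ` set w" for a
  proof -
    have "a \<in> S" using w that by (simp add: carrier_free_group subset_iff)
    then show ?thesis by (rule assms)
  qed
  then show "subst \<phi> w = subst \<psi> w" by (rule subst_cong)
qed

section \<open>Cancellation in products of reduced words\<close>

lemma length_reduce_le: "length (reduce w) \<le> length w"
proof (induction w)
  case (Cons p w)
  then show ?case by (auto simp: reduce_Cons cons_cancel_eq)
qed simp

lemma reduce_length_eq: "length (reduce w) = length w \<Longrightarrow> reduce w = w"
proof (induction w)
  case (Cons p w)
  have "length (reduce w) \<le> length w" by (rule length_reduce_le)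
  with Cons.prems have "reduce (p # w) = p # reduce w" "length (reduce w) = length w"
    by (auto simp: reduce_Cons cons_cancel_eq split: if_splits)
  with Cons.IH show ?case by simp
qed simp

text \<open>The product of two reduced words cancels a maximal suffix of the first against a prefix of the second
  and nothing more, since the remaining words do not cancel where they meet.\<close>

lemma cancellation:
  assumes "reduced u" "reduced v"
  obtains u' c v' where "u = u' @ c" "v = winv c @ v'" "reduced (u' @ v')"
proof -
  have "\<exists>u' c v'. u = u' @ c \<and> v = winv c @ v' \<and> reduced (u' @ v')"
    using assms
  proof (induction u arbitrary: v rule: rev_induct)
    case Nil
    then show ?case by simp
  next
    case (snoc p u)
    show ?case
    proof (cases "v \<noteq> [] \<and> hd v = flip p")
      case True
      then obtain v1 where v: "v = flip p # v1" by (cases v) auto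
      have "reduced u" "reduced v1"
        using snoc.prems v by (auto simp: reduced_append reduced_Cons)
      from snoc.IH[OF this] obtain u' c v' where
        "u = u' @ c" "v1 = winv c @ v'" "reduced (u' @ v')" by blast
      then show ?thesis
        using v by (intro exI[of _ u'] exI[of _ "c @ [p]"] exI[of _ v']) simp
    next
      case False
      then have "reduced ((u @ [p]) @ v)"
        unfolding reduced_append[of "u @ [p]"] using snoc.prems by auto
      then show ?thesis by (intro exI[of _ "u @ [p]"] exI[of _ "[]"] exI[of _ v]) simp
    qed
  qed
  then show thesis using that by blast
qed

text \<open>The number of letters of \<open>u\<close> that cancel against \<open>v\<close> in the product of reduced words.\<close>

definition overlap :: "'a word \<Rightarrow> 'a word \<Rightarrow> nat" where
  "overlap u v = (length u + length v - length (reduce (u @ v))) div 2"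

lemma overlap_eq:
  assumes "reduced (u' @ v')"
  shows "overlap (u' @ c) (winv c @ v') = length c"
proof -
  have "reduce ((u' @ c) @ winv c @ v') = u' @ v'"
    using assms by (simp add: reduce_winv_cancel_mid reduce_reduced)
  then show ?thesis unfolding overlap_def by simp
qed

lemma overlapE:
  assumes "reduced u" "reduced v"
  obtains u' c v' where "u = u' @ c" "v = winv c @ v'" "reduced (u' @ v')" "length c = overlap u v"
  using cancellation[OF assms] overlap_eq by metis

lemma overlap_winv: "overlap (winv v) (winv u) = overlap u v"
  unfolding overlap_def
  by (metis length_winv reduce_winv winv_append add.commute)

text \<open>Free groups have no elements of order two: comparing \<open>w\<close> with its inverse at the middle gives either
  a letter that is its own inverse or two adjacent inverse letters.\<close>

lemma eq_winv_imp_Nil: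
  assumes "reduced w" "w = winv w" shows "w = []"
proof (rule ccontr)
  assume ne: "w \<noteq> []"
  define i where "i = length w div 2"
  have len: "length w > 0" using ne by simp
  have nth: "w ! j = flip (w ! (length w - 1 - j))" if "j < length w" for j
  proof -
    have "w ! j = winv w ! j" using assms(2) by simp
    also have "\<dots> = flip (w ! (length w - 1 - j))"
      using that by (simp add: winv_def rev_nth)
    finally show ?thesis .
  qed
  show False
  proof (cases "even (length w)")
    case False
    then have "length w - 1 - i = i" "i < length w" unfolding i_def by presburger+
    with nth[of i] show False by simp
  next
    case True
    with len have i: "length w - 1 - i = i - 1" "i < length w" "i > 0" unfolding i_def by presburger+
    have w: "w = take i w @ drop i w" by simp
    have "reduced (take i w @ drop i w)" using assms(1) by simp
    moreover have "take i w \<noteq> []" "drop i w \<noteq> []" using i by auto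
    ultimately have "hd (drop i w) \<noteq> flip (last (take i w))"
      by (simp only: reduced_append) blast
    moreover have "hd (drop i w) = w ! i" "last (take i w) = w ! (i - 1)"
      using i \<open>take i w \<noteq> []\<close> by (simp_all add: hd_drop_conv_nth last_conv_nth)
    ultimately show False using nth[of i] i by simp
  qed
qed

text \<open>If half of \<open>w\<close> cancelled in \<open>w w\<close>, the cancelled part would contain a word equal to its own inverse;
  as that is empty, \<open>w\<close> would be of the form \<open>u winv u\<close>.\<close>

lemma overlap_self:
  assumes w: "reduced w" "w \<noteq> []" shows "2 * overlap w w < length w"
proof (rule ccontr)
  assume neg: "\<not> ?thesis"
  obtain u' c v' where *: "w = u' @ c" "w = winv c @ v'" "length c = overlap w w"
    by (rule overlapE[OF w(1) w(1)])
  have "length w = length u' + length c" by (subst *(1)) simp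
  then have le: "length u' \<le> length c" using neg *(3) by linarith
  have e: "u' @ c = winv c @ v'" by (rule trans[OF *(1)[symmetric] *(2)])
  then obtain y where "u' = winv c @ y \<and> y @ c = v' \<or> u' @ y = winv c \<and> c = y @ v'"
    unfolding append_eq_append_conv2 by blast
  then obtain x where x: "winv c = u' @ x"
    using le by (metis append_Nil2 append_eq_conv_conj length_winv take_all)
  then have c: "c = winv x @ winv u'" by (metis winv_append winv_winv)
  have "u' @ winv x @ winv u' = u' @ x @ v'" using e unfolding x by (simp add: c)
  then have "winv x @ winv u' = x @ v'" by simp
  then have xx: "winv x = x" by (simp add: append_eq_append_conv)
  have "reduced (winv c @ v')" using w(1) by (subst (asm) *(2))
  then have "reduced x" unfolding x by (simp add: reduced_append)
  then have "x = []" using xx by (intro eq_winv_imp_Nil) simp_all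
  then have "u' @ c = u' @ winv u'" by (simp add: c)
  then have "w = u' @ winv u'" by (rule trans[OF *(1)])
  then have "reduce w = []" by simp
  then show False using w by (simp add: reduce_reduced)
qed

section \<open>Conjugates of a letter\<close>

text \<open>A letter at the end of the conjugator that equals \<open>l\<close> or its inverse commutes with \<open>l\<close> and may be
  dropped; once there is none, nothing cancels. So the conjugates of a letter have odd length, with a
  conjugator as their first half.\<close>

lemma conj_letter_normal_form:
  "reduced g \<Longrightarrow> \<exists>g'. reduce (g @ [l] @ winv g) = g' @ [l] @ winv g' \<and> fst ` set g' \<subseteq> fst ` set g"
proof (induction g rule: rev_induct)
  case Nil
  then show ?case by (intro exI[of _ "[]"]) (simp add: reduce_reduced)
next
  case (snoc m g)
  have g: "reduced g" using snoc.prems by (simp add: reduced_append)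
  show ?case
  proof (cases "m = l \<or> m = flip l")
    case True
    have "reduce ((g @ [m]) @ [l] @ winv (g @ [m])) = reduce (g @ reduce ([m, l, flip m]) @ winv g)"
      by simp
    also have "reduce [m, l, flip m] = [l]"
      using True by (auto simp: reduce_Cons cons_cancel_eq)
    finally have "reduce ((g @ [m]) @ [l] @ winv (g @ [m])) = reduce (g @ [l] @ winv g)" .
    moreover obtain g' where "reduce (g @ [l] @ winv g) = g' @ [l] @ winv g'" "fst ` set g' \<subseteq> fst ` set g"
      using snoc.IH[OF g] by blast
    ultimately show ?thesis by (intro exI[of _ g']) auto
  next
    case False
    have "reduced ([l, flip m] @ winv g)"
    proof -
      have "reduced (winv (g @ [m]))" using snoc.prems by (simp only: reduced_winv)
      then show ?thesis using False by (auto simp: reduced_Cons flip_eq_iff)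
    qed
    then have "reduced ((g @ [m]) @ [l, flip m] @ winv g)"
      using snoc.prems False by (subst reduced_append) (auto simp: flip_eq_iff)
    then have "reduce ((g @ [m]) @ [l] @ winv (g @ [m])) = (g @ [m]) @ [l] @ winv (g @ [m])"
      by (simp add: reduce_reduced)
    then show ?thesis by blast
  qed
qed

section \<open>The group of automorphisms preserving the classes of the \<open>y\<close>-generators\<close>

lemma finite_gens [simp]: "finite (gens n k)"
  by (simp add: gens_def)

lemma gens_iff [simp]: "GX i \<in> gens n k \<longleftrightarrow> i < n" "GY j \<in> gens n k \<longleftrightarrow> j < k"
  by (auto simp: gens_def)

lemma carrier_conj_mult:
  assumes "g \<in> carrier (free_group S)" "z \<in> carrier (free_group S)"
  shows "g \<otimes>\<^bsub>free_group S\<^esub> z \<otimes>\<^bsub>free_group S\<^esub> inv\<^bsub>free_group S\<^esub> g = reduce (g @ z @ winv g)"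
  using assms by (simp add: inv_free_group)

lemma (in group) conj_class_eq_iff:
  assumes x: "x \<in> carrier G" and z: "z \<in> carrier G"
  shows "conj_class G x = conj_class G z \<longleftrightarrow> (\<exists>g\<in>carrier G. x = g \<otimes> z \<otimes> inv g)"
proof
  assume eq: "conj_class G x = conj_class G z"
  have "x \<in> conj_class G x"
    unfolding conj_class_def using x by (auto intro!: exI[of _ "\<one>"])
  then show "\<exists>g\<in>carrier G. x = g \<otimes> z \<otimes> inv g"
    unfolding eq by (auto simp: conj_class_def)
next
  have conj: "h \<otimes> (g \<otimes> z \<otimes> inv g) \<otimes> inv h = (h \<otimes> g) \<otimes> z \<otimes> inv (h \<otimes> g)"
    if "g \<in> carrier G" "h \<in> carrier G" for g h
    using that z by (simp add: inv_mult_group m_assoc)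
  assume "\<exists>g\<in>carrier G. x = g \<otimes> z \<otimes> inv g"
  then obtain g where g: "g \<in> carrier G" "x = g \<otimes> z \<otimes> inv g" by blast
  show "conj_class G x = conj_class G z"
  proof (intro equalityI subsetI)
    fix t assume "t \<in> conj_class G x"
    then obtain h where "h \<in> carrier G" "t = h \<otimes> x \<otimes> inv h" by (auto simp: conj_class_def)
    then show "t \<in> conj_class G z"
      unfolding conj_class_def using conj[OF g(1)] g by (intro CollectI exI[of _ "h \<otimes> g"]) simp
  next
    fix t assume "t \<in> conj_class G z"
    then obtain h where h: "h \<in> carrier G" "t = h \<otimes> z \<otimes> inv h" by (auto simp: conj_class_def)
    have "(h \<otimes> inv g) \<otimes> x \<otimes> inv (h \<otimes> inv g) = t"
      unfolding g(2) using conj[of g "h \<otimes> inv g"] g(1) h by (simp add: m_assoc)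
    then show "t \<in> conj_class G x"
      unfolding conj_class_def using g(1) h(1) by (intro CollectI exI[of _ "h \<otimes> inv g"]) simp
  qed
qed

lemma A_aut_iff:
  "f \<in> A_aut n k \<longleftrightarrow> f \<in> auto (Fnk n k) \<and>
     (\<forall>j<k. \<exists>g\<in>carrier (Fnk n k). f [(GY j, True)] = reduce (g @ [(GY j, True)] @ winv g))"
proof -
  have "conj_class (Fnk n k) (f (y_gen j)) = conj_class (Fnk n k) (y_gen j) \<longleftrightarrow>
    (\<exists>g\<in>carrier (Fnk n k). f [(GY j, True)] = reduce (g @ [(GY j, True)] @ winv g))"
    if "f \<in> auto (Fnk n k)" "j < k" for j
  proof -
    have "y_gen j \<in> carrier (Fnk n k)" using that by (simp add: y_gen_def)
    with that show ?thesis
      by (subst group.conj_class_eq_iff[OF group_free_group])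
         (auto simp: auto_closed y_gen_def carrier_conj_mult simp del: mult_free_group intro!: bex_cong)
  qed
  then show ?thesis unfolding A_aut_def by blast
qed

lemma auto_mult: "f \<in> auto (free_group S) \<Longrightarrow> u \<in> carrier (free_group S) \<Longrightarrow> v \<in> carrier (free_group S)
  \<Longrightarrow> f (reduce (u @ v)) = reduce (f u @ f v)"
  using hom_mult[OF auto_hom, of f "free_group S" u v] by simp

lemma auto_winv: "f \<in> auto (free_group S) \<Longrightarrow> u \<in> carrier (free_group S) \<Longrightarrow> f (winv u) = winv (f u)"
proof -
  assume f: "f \<in> auto (free_group S)" and u: "u \<in> carrier (free_group S)"
  interpret group_hom "free_group S" "free_group S" f
    using f by (intro group_hom.intro group_hom_axioms.intro group_free_group auto_hom)
  show ?thesis using hom_inv[OF u] u f by (simp add: inv_free_group auto_closed)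
qed

lemma auto_Nil: "f \<in> auto (free_group S) \<Longrightarrow> f [] = []"
  using hom_one[OF auto_hom group_free_group group_free_group] by simp

lemma auto_inj: "f \<in> auto G \<Longrightarrow> u \<in> carrier G \<Longrightarrow> v \<in> carrier G \<Longrightarrow> f u = f v \<longleftrightarrow> u = v"
  by (auto simp: auto_def Bij_def bij_betw_def inj_on_def)

lemma auto_surj: "f \<in> auto G \<Longrightarrow> v \<in> carrier G \<Longrightarrow> \<exists>u\<in>carrier G. f u = v"
  by (auto simp: auto_def Bij_def bij_betw_def) (metis imageE)

lemma winv_closed [simp]: "winv u \<in> carrier (free_group S) \<longleftrightarrow> u \<in> carrier (free_group S)"
  by (simp add: carrier_free_group)

lemma reduce_append_closed:
  "u \<in> carrier (free_group S) \<Longrightarrow> v \<in> carrier (free_group S) \<Longrightarrow> reduce (u @ v) \<in> carrier (free_group S)"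
  using group.is_monoid[OF group_free_group, THEN monoid.m_closed] by fastforce

lemma auto_conj:
  assumes f: "f \<in> auto (free_group S)" and "g \<in> carrier (free_group S)" "z \<in> carrier (free_group S)"
  shows "f (reduce (g @ z @ winv g)) = reduce (f g @ f z @ winv (f g))"
proof -
  have "f (reduce (g @ reduce (z @ winv g))) = reduce (f g @ reduce (f z @ f (winv g)))"
    using assms by (simp only: auto_mult reduce_append_closed winv_closed)
  then show ?thesis using assms by (simp add: auto_winv)
qed

lemma reduce_conj_reduce:
  "reduce (reduce g @ z @ winv (reduce g)) = reduce (g @ z @ winv g)"
proof -
  have "reduce (reduce g @ z @ winv (reduce g)) = reduce (g @ z @ winv (reduce g))"
    by (rule reduce_reduce_append)
  also have "\<dots> = reduce ((g @ z) @ reduce (winv g))"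
    by (simp only: reduce_winv append_assoc)
  also have "\<dots> = reduce ((g @ z) @ winv g)"
    by (rule reduce_append_reduce)
  finally show ?thesis by simp
qed

lemma subgroup_A_aut: "subgroup (A_aut n k) (\<AA> (gens n k))"
proof -
  let ?F = "Fnk n k"
  interpret A: group "\<AA> (gens n k)" by (rule group_AutoGroup)
  show ?thesis
  proof (rule A.subgroupI)
    show "A_aut n k \<subseteq> carrier (\<AA> (gens n k))"
      by (auto simp: carrier_AA A_aut_def)
    have "(\<lambda>x\<in>carrier ?F. x) \<in> A_aut n k"
      unfolding A_aut_iff using group.id_in_auto[OF group_free_group, of "gens n k"]
      by (auto intro!: bexI[of _ "[]"] simp: carrier_free_group reduce_reduced)
    then show "A_aut n k \<noteq> {}" by blast
  next
    fix f assume fA: "f \<in> A_aut n k"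
    then have f: "f \<in> auto ?F" by (simp add: A_aut_def)
    define h where "h = inv\<^bsub>\<AA> (gens n k)\<^esub> f"
    have h: "h \<in> auto ?F" and hf: "\<And>x. x \<in> carrier ?F \<Longrightarrow> h (f x) = x"
      unfolding h_def using auto_inv_closed[OF f] auto_inv_left[OF f] by auto
    have "\<exists>g\<in>carrier ?F. h [(GY j, True)] = reduce (g @ [(GY j, True)] @ winv g)" if j: "j < k" for j
    proof -
      obtain g where g: "g \<in> carrier ?F" "f [(GY j, True)] = reduce (g @ [(GY j, True)] @ winv g)"
        using fA j unfolding A_aut_iff by blast
      have y: "[(GY j, True)] \<in> carrier ?F" using that by simp
      have "[(GY j, True)] = h (f [(GY j, True)])" using hf y by simp
      also have "\<dots> = reduce (h g @ h [(GY j, True)] @ winv (h g))"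
        unfolding g(2) using h g(1) y by (rule auto_conj)
      finally have "reduce (winv (h g) @ [(GY j, True)] @ h g)
          = reduce (winv (h g) @ reduce (h g @ h [(GY j, True)] @ winv (h g)) @ h g)"
        by simp
      also have "\<dots> = reduce (h [(GY j, True)])"
        by (simp add: reduce_winv_cancel_mid(1)[of _ "h g" "[]", simplified])
      also have "\<dots> = h [(GY j, True)]"
        using auto_closed[OF h y] by (simp add: carrier_free_group reduce_reduced)
      finally show ?thesis using auto_closed[OF h g(1)]
        by (intro bexI[of _ "winv (h g)"]) simp_all
    qed
    then show "inv\<^bsub>\<AA> (gens n k)\<^esub> f \<in> A_aut n k"
      using h unfolding A_aut_iff h_def by blast
  next
    fix f h assume fA: "f \<in> A_aut n k" and hA: "h \<in> A_aut n k"
    then have f: "f \<in> auto ?F" and h: "h \<in> auto ?F" by (auto simp: A_aut_def)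
    have "\<exists>g\<in>carrier ?F. (f \<otimes>\<^bsub>\<AA> (gens n k)\<^esub> h) [(GY j, True)] = reduce (g @ [(GY j, True)] @ winv g)"
      if j: "j < k" for j
    proof -
      have y: "[(GY j, True)] \<in> carrier ?F" using that by simp
      obtain g where g: "g \<in> carrier ?F" "f [(GY j, True)] = reduce (g @ [(GY j, True)] @ winv g)"
        using fA j unfolding A_aut_iff by blast
      obtain g' where g': "g' \<in> carrier ?F" "h [(GY j, True)] = reduce (g' @ [(GY j, True)] @ winv g')"
        using hA j unfolding A_aut_iff by blast
      have "(f \<otimes>\<^bsub>\<AA> (gens n k)\<^esub> h) [(GY j, True)] = reduce (f g' @ reduce (g @ [(GY j, True)] @ winv g) @ winv (f g'))"
        using mult_AutoGroup_apply[OF f h y] auto_conj[OF f g'(1) y] g g' by simp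
      also have "\<dots> = reduce (reduce (f g' @ g) @ [(GY j, True)] @ winv (reduce (f g' @ g)))"
        unfolding reduce_conj_reduce by simp
      finally show ?thesis
        using auto_closed[OF f g'(1)] g(1) reduce_append_closed by blast
    qed
    then show "f \<otimes>\<^bsub>\<AA> (gens n k)\<^esub> h \<in> A_aut n k"
      using A.m_closed[of f h] f h unfolding A_aut_iff by (simp add: carrier_AA)
  qed
qed

section \<open>Elementary automorphisms\<close>

lemma gens_cases:
  assumes "a \<in> gens n k"
  obtains (X) i where "a = GX i" "i < n" | (Y) j where "a = GY j" "j < k"
  using assms by (auto simp: gens_def)

definition replace_gen :: "'a set \<Rightarrow> 'a \<Rightarrow> 'a word \<Rightarrow> 'a word \<Rightarrow> 'a word" where
  "replace_gen S x w = subst_map S (gen_word(x := w))"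

lemma replace_gen_auto:
  assumes "x \<in> S" "fst ` set w \<subseteq> S" "fst ` set w' \<subseteq> S"
    and "subst (gen_word(x := w)) w' = [(x, True)]" "subst (gen_word(x := w')) w = [(x, True)]"
  shows "replace_gen S x w \<in> auto (free_group S)"
  unfolding replace_gen_def
  by (rule subst_map_auto[where \<psi> = "gen_word(x := w')"])
     (use assms in \<open>auto simp: gen_word_def reduce_def subst_def\<close>)

lemma mult_replace_gen:
  assumes f: "f \<in> auto (free_group S)" and e: "replace_gen S x w \<in> auto (free_group S)"
    and a: "a \<in> S"
  shows "(f \<otimes>\<^bsub>\<AA> S\<^esub> replace_gen S x w) [(a, True)] = (if a = x then f (reduce w) else f [(a, True)])"
  using mult_AutoGroup_apply[OF f e, of "[(a, True)]"] a
  by (simp add: replace_gen_def subst_map_apply gen_word_def reduce_reduced)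

lemma replace_gen_left_auto:
  "x \<in> S \<Longrightarrow> fst v \<in> S \<Longrightarrow> fst v \<noteq> x \<Longrightarrow> replace_gen S x [v, (x, True)] \<in> auto (free_group S)"
  by (cases v, rule replace_gen_auto[where w' = "[flip v, (x, True)]"])
     (auto simp: subst_def reduce_def gen_word_def)

lemma replace_gen_right_auto:
  "x \<in> S \<Longrightarrow> fst v \<in> S \<Longrightarrow> fst v \<noteq> x \<Longrightarrow> replace_gen S x [(x, True), v] \<in> auto (free_group S)"
  by (cases v, rule replace_gen_auto[where w' = "[(x, True), flip v]"])
     (auto simp: subst_def reduce_def gen_word_def)

lemma replace_gen_conj_auto:
  "x \<in> S \<Longrightarrow> fst v \<in> S \<Longrightarrow> fst v \<noteq> x \<Longrightarrow> replace_gen S x [v, (x, True), flip v] \<in> auto (free_group S)"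
  by (cases v, rule replace_gen_auto[where w' = "[flip v, (x, True), v]"])
     (auto simp: subst_def reduce_def gen_word_def)

text \<open>The generator \<open>x\<^sub>i\<close> may be multiplied on either side by another letter, whereas \<open>y\<^sub>j\<close> may only be
  conjugated, as its conjugacy class has to be preserved.\<close>

definition transvections :: "nat \<Rightarrow> nat \<Rightarrow> (gen word \<Rightarrow> gen word) set" where
  "transvections n k =
     {replace_gen (gens n k) (GX i) [v, (GX i, True)] | i v. i < n \<and> fst v \<in> gens n k \<and> fst v \<noteq> GX i}
   \<union> {replace_gen (gens n k) (GX i) [(GX i, True), v] | i v. i < n \<and> fst v \<in> gens n k \<and> fst v \<noteq> GX i}
   \<union> {replace_gen (gens n k) (GY j) [v, (GY j, True), flip v] | j v. j < k \<and> fst v \<in> gens n k \<and> fst v \<noteq> GY j}"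

lemma replace_gen_apply:
  "a \<in> S \<Longrightarrow> replace_gen S x w [(a, True)] = (if a = x then reduce w else [(a, True)])"
  by (simp add: replace_gen_def subst_map_apply gen_word_def reduce_reduced)

lemma transvections_A_aut: "transvections n k \<subseteq> A_aut n k"
proof -
  have 0: "\<exists>g\<in>carrier (Fnk n k). [(GY j, True)] = reduce (g @ [(GY j, True)] @ winv g)" for j
    by (intro bexI[of _ "[]"]) (auto simp: carrier_free_group reduce_reduced)
  have 1: "\<exists>g\<in>carrier (Fnk n k). reduce [v, (GY j, True), flip v] = reduce (g @ [(GY j, True)] @ winv g)"
    if "fst v \<in> gens n k" for j v
    using that by (intro bexI[of _ "[v]"]) auto
  have A: "replace_gen (gens n k) x w \<in> A_aut n k"
    if "replace_gen (gens n k) x w \<in> auto (Fnk n k)"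
      "\<And>j. x = GY j \<Longrightarrow> \<exists>g\<in>carrier (Fnk n k). reduce w = reduce (g @ [(GY j, True)] @ winv g)" for x w
    unfolding A_aut_iff
  proof (intro conjI allI impI that(1))
    fix j assume "j < k"
    then show "\<exists>g\<in>carrier (Fnk n k). replace_gen (gens n k) x w [(GY j, True)] = reduce (g @ [(GY j, True)] @ winv g)"
      using that(2)[of j] 0[of j] by (cases "x = GY j") (simp_all add: replace_gen_apply)
  qed
  show ?thesis
  proof
    fix e assume "e \<in> transvections n k"
    then consider
      i v where "e = replace_gen (gens n k) (GX i) [v, (GX i, True)]" "i < n" "fst v \<in> gens n k" "fst v \<noteq> GX i"
    | i v where "e = replace_gen (gens n k) (GX i) [(GX i, True), v]" "i < n" "fst v \<in> gens n k" "fst v \<noteq> GX i"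
    | j v where "e = replace_gen (gens n k) (GY j) [v, (GY j, True), flip v]" "j < k" "fst v \<in> gens n k" "fst v \<noteq> GY j"
      unfolding transvections_def by blast
    then show "e \<in> A_aut n k"
    proof cases
      case 1
      then show ?thesis unfolding 1(1) by (intro A replace_gen_left_auto) auto
    next
      case 2
      then show ?thesis unfolding 2(1) by (intro A replace_gen_right_auto) auto
    next
      case 3
      then show ?thesis unfolding 3(1) using 1[of v]
        by (intro A replace_gen_conj_auto) (simp_all del: append.simps append_Cons)
    qed
  qed
qed

definition signed_perms :: "nat \<Rightarrow> nat \<Rightarrow> (gen word \<Rightarrow> gen word) set" where
  "signed_perms n k = {f \<in> auto (Fnk n k). (\<forall>j<k. f [(GY j, True)] = [(GY j, True)]) \<and>
     (\<forall>i<n. \<exists>i'<n. \<exists>b. f [(GX i, True)] = [(GX i', b)])}"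

lemma signed_perms_A_aut: "signed_perms n k \<subseteq> A_aut n k"
  by (auto simp: signed_perms_def A_aut_iff carrier_free_group reduce_reduced intro!: bexI[of _ "[]"])

section \<open>The complexity of an automorphism\<close>

text \<open>An injective numbering of the letters by numbers below \<open>4 * (n + k)\<close>. Read in this base, words of
  equal length are ordered lexicographically by \<open>word_value\<close>, and different ones have different
  values.\<close>

fun letter_code :: "gen \<times> bool \<Rightarrow> nat" where
  "letter_code (GX i, b) = 4 * i + (if b then 1 else 0)"
| "letter_code (GY i, b) = 4 * i + 2 + (if b then 1 else 0)"

lemma letter_code_inj: "letter_code p = letter_code q \<Longrightarrow> p = q"
  by (cases p rule: letter_code.cases; cases q rule: letter_code.cases) (auto split: if_splits; presburger)+

lemma letter_code_less: "fst p \<in> gens n k \<Longrightarrow> letter_code p < 4 * (n + k)"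
  by (cases p rule: letter_code.cases) auto

primrec word_value :: "nat \<Rightarrow> gen word \<Rightarrow> nat" where
  "word_value B [] = 0"
| "word_value B (p # w) = letter_code p * B ^ length w + word_value B w"

lemma word_value_append: "word_value B (u @ v) = word_value B u * B ^ length v + word_value B v"
  by (induction u) (auto simp: power_add algebra_simps)

lemma word_value_less:
  "fst ` set w \<subseteq> gens n k \<Longrightarrow> word_value (4 * (n + k)) w < (4 * (n + k)) ^ length w"
proof (induction w)
  case (Cons p w)
  let ?B = "4 * (n + k)"
  have 1: "letter_code p + 1 \<le> ?B" using letter_code_less[of p n k] Cons.prems by simp
  have 2: "word_value ?B w < ?B ^ length w" using Cons by simp
  have "word_value ?B (p # w) < (letter_code p + 1) * ?B ^ length w"
    using 2 by (simp add: algebra_simps)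
  also have "\<dots> \<le> ?B * ?B ^ length w" using 1 by (rule mult_right_mono) simp
  finally show ?case by simp
qed simp

lemma word_value_inj:
  assumes "length u = length v" "fst ` set u \<subseteq> gens n k" "fst ` set v \<subseteq> gens n k"
    "word_value (4 * (n + k)) u = word_value (4 * (n + k)) v"
  shows "u = v"
  using assms
proof (induction u v rule: list_induct2)
  case (Cons p u q v)
  let ?B = "4 * (n + k)"
  define M where "M = ?B ^ length u"
  have "word_value ?B u < M" "word_value ?B v < M"
    using word_value_less[of u n k] word_value_less[of v n k] Cons.prems Cons.hyps by (auto simp: M_def)
  moreover have eq: "letter_code p * M + word_value ?B u = letter_code q * M + word_value ?B v"
    using Cons.prems Cons.hyps by (simp add: M_def)
  ultimately have pq: "letter_code p = letter_code q"
    by (metis add.commute add.right_neutral div_less div_mult_self3 not_less_zero)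
  then have "word_value ?B u = word_value ?B v" using eq by simp
  then have "u = v" using Cons by simp
  then show ?case using letter_code_inj[OF pq] by simp
qed simp

text \<open>The tie-breaking weight takes into account the first half of a word and the first half of its inverse,
  so that it does not distinguish a word from its inverse, and so that replacing an initial segment
  of at most half the length affects only one of the two summands. The middle letter of a word of odd length
  is left out.\<close>

definition weight :: "nat \<Rightarrow> gen word \<Rightarrow> nat" where
  "weight B u = word_value B (take (length u div 2) u) + word_value B (take (length u div 2) (winv u))"

lemma weight_winv [simp]: "weight B (winv u) = weight B u"
  by (simp add: weight_def)

definition simpler :: "nat \<Rightarrow> gen word \<Rightarrow> gen word \<Rightarrow> bool" where
  "simpler B u v \<longleftrightarrow> length u < length v \<or> length u = length v \<and> weight B u < weight B v"

lemma simpler_winv [simp]: "simpler B (winv u) (winv v) = simpler B u v"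
  by (simp add: simpler_def)

definition total_length :: "nat \<Rightarrow> nat \<Rightarrow> (gen word \<Rightarrow> gen word) \<Rightarrow> nat" where
  "total_length n k f = (\<Sum>a\<in>gens n k. length (f [(a, True)]))"

definition total_weight :: "nat \<Rightarrow> nat \<Rightarrow> (gen word \<Rightarrow> gen word) \<Rightarrow> nat" where
  "total_weight n k f = (\<Sum>a\<in>gens n k. weight (4 * (n + k)) (f [(a, True)]))"

definition complexity_order :: "nat \<Rightarrow> nat \<Rightarrow> ((gen word \<Rightarrow> gen word) \<times> (gen word \<Rightarrow> gen word)) set" where
  "complexity_order n k = measures [total_length n k, total_weight n k]"

definition reducible :: "nat \<Rightarrow> nat \<Rightarrow> (gen word \<Rightarrow> gen word) \<Rightarrow> bool" where
  "reducible n k f \<longleftrightarrow> (\<exists>e\<in>transvections n k. (f \<otimes>\<^bsub>\<AA> (gens n k)\<^esub> e, f) \<in> complexity_order n k)"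

text \<open>Composing with \<open>replace_gen\<close> changes the image of one generator only, so both totals change
  by the change at this generator.\<close>

lemma reducibleI:
  assumes f: "f \<in> auto (Fnk n k)" and e: "replace_gen (gens n k) x w \<in> transvections n k"
    and x: "x \<in> gens n k" and simpler: "simpler (4 * (n + k)) (f (reduce w)) (f [(x, True)])"
  shows "reducible n k f"
proof -
  let ?e = "replace_gen (gens n k) x w"
  have e': "?e \<in> auto (Fnk n k)" using e transvections_A_aut by (auto simp: A_aut_def)
  have sum: "(\<Sum>a\<in>gens n k. F ((f \<otimes>\<^bsub>\<AA> (gens n k)\<^esub> ?e) [(a, True)]))
     = F (f (reduce w)) + (\<Sum>a\<in>gens n k - {x}. F (f [(a, True)]))"
    "(\<Sum>a\<in>gens n k. F (f [(a, True)])) = F (f [(x, True)]) + (\<Sum>a\<in>gens n k - {x}. F (f [(a, True)]))"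
    for F :: "gen word \<Rightarrow> nat"
    using x by (simp_all add: sum.remove[of _ x] mult_replace_gen[OF f e'])
  have "(f \<otimes>\<^bsub>\<AA> (gens n k)\<^esub> ?e, f) \<in> complexity_order n k"
    using simpler unfolding complexity_order_def simpler_def
    by (auto simp: total_length_def total_weight_def sum)
  then show ?thesis using e unfolding reducible_def by blast
qed

section \<open>Nielsen reduction\<close>

lemma fst_eq_cases: "fst p = fst q \<Longrightarrow> q = p \<or> q = flip p"
  by (cases "snd q = snd p") (auto simp: prod_eq_iff)

lemma suffix_of_append:
  assumes "u @ c = a @ b" "length c \<le> length b" shows "\<exists>d. b = d @ c"
proof -
  obtain us where "u = a @ us \<and> us @ c = b \<or> u @ us = a \<and> c = us @ b"
    using assms(1) unfolding append_eq_append_conv2 by blast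
  then show ?thesis
  proof
    assume "u @ us = a \<and> c = us @ b"
    then have "b = [] @ c" using assms(2) by simp
    then show ?thesis by blast
  qed blast
qed

locale class_preserving =
  fixes n k :: nat and f :: "gen word \<Rightarrow> gen word"
  assumes f_A: "f \<in> A_aut n k"
begin

abbreviation "B \<equiv> 4 * (n + k)"
abbreviation "S \<equiv> gens n k"

lemma f_auto: "f \<in> auto (Fnk n k)"
  using f_A by (simp add: A_aut_def)

lemma f_letter: "fst p \<in> S \<Longrightarrow> f [p] \<in> carrier (Fnk n k)"
  using auto_closed[OF f_auto] by simp

lemma f_letter_reduced: "fst p \<in> S \<Longrightarrow> reduced (f [p])"
  and f_letter_gens: "fst p \<in> S \<Longrightarrow> fst ` set (f [p]) \<subseteq> S"
  using f_letter by (auto simp: carrier_free_group)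

lemma f_flip: "fst p \<in> S \<Longrightarrow> f [flip p] = winv (f [p])"
  using auto_winv[OF f_auto, of "[p]"] by simp

lemma f_letter_ne: "fst p \<in> S \<Longrightarrow> f [p] \<noteq> []"
  using auto_inj[OF f_auto, of "[p]" "[]"] by (simp add: auto_Nil[OF f_auto] carrier_free_group)

lemma f_pair: "fst p \<in> S \<Longrightarrow> fst q \<in> S \<Longrightarrow> f (reduce [p, q]) = reduce (f [p] @ f [q])"
  using auto_mult[OF f_auto, of "[p]" "[q]"] by simp

text \<open>The image of \<open>y\<^sub>j\<close> or its inverse has the letter itself in the middle, by the normal form of
  conjugates.\<close>

lemma f_Y:
  assumes "fst p = GY j" "j < k" shows "\<exists>g. f [p] = g @ [p] @ winv g"
proof -
  obtain g where g: "g \<in> carrier (Fnk n k)" "f [(GY j, True)] = reduce (g @ [(GY j, True)] @ winv g)"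
    using f_A assms unfolding A_aut_iff by blast
  then obtain g' where g': "f [(GY j, True)] = g' @ [(GY j, True)] @ winv g'"
    using conj_letter_normal_form[of g "(GY j, True)"] by (auto simp: carrier_free_group)
  show ?thesis
  proof (cases "snd p")
    case True
    then have "p = (GY j, True)" using assms by (simp add: prod_eq_iff)
    then show ?thesis using g' by blast
  next
    case False
    then have p: "p = flip (GY j, True)" using assms by (simp add: prod_eq_iff)
    have "f [p] = winv (f [(GY j, True)])" unfolding p using assms by (intro f_flip) simp
    also have "\<dots> = g' @ [p] @ winv g'" unfolding g' p by (simp add: winv_Cons)
    finally show ?thesis by blast
  qed
qed

text \<open>Sufficient conditions for reducibility stated for a signed letter \<open>s\<close>: if \<open>s\<close> is an inverse generator,
  multiplying it by \<open>t\<close> on the left means multiplying the generator by the inverse of \<open>t\<close> on the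
  right.\<close>

lemma reducible_X:
  assumes s: "fst s = GX i" "i < n" and t: "fst t \<in> S" "fst t \<noteq> GX i"
    and simpler: "simpler B (reduce (f [t] @ f [s])) (f [s])"
  shows "reducible n k f"
proof (cases "snd s")
  case True
  then have s': "s = (GX i, True)" using s by (simp add: prod_eq_iff)
  show ?thesis
  proof (rule reducibleI[OF f_auto])
    show "replace_gen S (GX i) [t, (GX i, True)] \<in> transvections n k"
      unfolding transvections_def using s t by blast
    show "simpler B (f (reduce [t, (GX i, True)])) (f [(GX i, True)])"
      using simpler s t f_pair[of t s] by (simp add: s')
  qed (use s in simp)
next
  case False
  then have s': "s = flip (GX i, True)" using s by (simp add: prod_eq_iff)
  have fs: "f [s] = winv (f [(GX i, True)])" unfolding s' using s by (intro f_flip) simp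
  have "f (reduce [(GX i, True), flip t]) = reduce (f [(GX i, True)] @ winv (f [t]))"
    using s t by (simp add: f_pair f_flip)
  also have "\<dots> = winv (reduce (f [t] @ f [s]))"
    by (simp add: fs flip: reduce_winv)
  finally have eq: "f (reduce [(GX i, True), flip t]) = winv (reduce (f [t] @ f [s]))" .
  show ?thesis
  proof (rule reducibleI[OF f_auto])
    show "replace_gen S (GX i) [(GX i, True), flip t] \<in> transvections n k"
      unfolding transvections_def using s t by (intro UnI1 UnI2 CollectI exI[of _ i] exI[of _ "flip t"]) simp
    have "simpler B (winv (reduce (f [t] @ f [s]))) (winv (f [s]))"
      using simpler by simp
    then show "simpler B (f (reduce [(GX i, True), flip t])) (f [(GX i, True)])"
      unfolding eq by (simp add: fs)
  qed (use s in simp)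
qed

lemma reducible_Y:
  assumes s: "fst s = GY j" "j < k" and t: "fst t \<in> S" "fst t \<noteq> GY j"
    and simpler: "simpler B (reduce (f [t] @ f [s] @ winv (f [t]))) (f [s])"
  shows "reducible n k f"
proof (rule reducibleI[OF f_auto])
  let ?y = "(GY j, True)"
  show "replace_gen S (GY j) [t, ?y, flip t] \<in> transvections n k"
    unfolding transvections_def using s t by blast
  have eq: "f (reduce [t, ?y, flip t]) = reduce (f [t] @ f [?y] @ winv (f [t]))"
    using auto_conj[OF f_auto, of "[t]" "[?y]"] s t by simp
  show "simpler B (f (reduce [t, ?y, flip t])) (f [?y])"
  proof (cases "snd s")
    case True
    then have "s = ?y" using s by (simp add: prod_eq_iff)
    then show ?thesis using simpler eq by simp
  next
    case False
    then have s': "s = flip ?y" using s by (simp add: prod_eq_iff)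
    have fs: "f [s] = winv (f [?y])" unfolding s' using s by (intro f_flip) simp
    have "reduce (f [t] @ f [s] @ winv (f [t])) = winv (f (reduce [t, ?y, flip t]))"
      unfolding eq fs by (simp flip: reduce_winv)
    then show ?thesis using simpler unfolding fs by simp
  qed
qed (use s in simp)

lemma reducible_conj:
  assumes s: "fst s = GY j" "j < k" and t: "fst t \<in> S" "fst t \<noteq> GY j"
    and g: "f [s] = g @ [l] @ winv g" "reduce (f [t] @ g) = reduce g0"
    and simpler: "simpler B (reduce (g0 @ [l] @ winv g0)) (f [s])"
  shows "reducible n k f"
proof (rule reducible_Y[OF s t])
  have "reduce (f [t] @ f [s] @ winv (f [t])) = reduce ((f [t] @ g) @ [l] @ winv (f [t] @ g))"
    by (simp add: g(1))
  also have "\<dots> = reduce (g0 @ [l] @ winv g0)"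
    by (metis reduce_conj_reduce g(2))
  finally show "simpler B (reduce (f [t] @ f [s] @ winv (f [t]))) (f [s])" using simpler by simp
qed

text \<open>It is enough to shorten the conjugator, even if the new word is not reduced.\<close>

lemma reducible_shorter_conj:
  assumes s: "fst s = GY j" "j < k" and t: "fst t \<in> S" "fst t \<noteq> GY j"
    and g: "f [s] = g @ [l] @ winv g" "reduce (f [t] @ g) = reduce g0" "length g0 < length g"
  shows "reducible n k f"
proof (rule reducible_conj[OF s t g(1,2)])
  have "length (reduce (g0 @ [l] @ winv g0)) \<le> length (g0 @ [l] @ winv g0)"
    by (rule length_reduce_le)
  then show "simpler B (reduce (g0 @ [l] @ winv g0)) (f [s])"
    using g(3) unfolding simpler_def g(1) by simp
qed

text \<open>The first Nielsen condition. If more than half of \<open>f q\<close> cancels against \<open>f p\<close> then multiplying by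
  \<open>f q\<close> shortens \<open>f p\<close>; this is a transvection when \<open>p\<close> is an \<open>x\<close> letter. When \<open>p\<close> is a \<open>y\<close> letter,
  \<open>f p\<close> is \<open>g p winv g\<close>. If the cancelled part stays within \<open>winv g\<close>, conjugating by \<open>q\<close> shortens
  \<open>g\<close>. Otherwise \<open>f q\<close> begins with \<open>g\<close> followed by the inverse of \<open>p\<close>, and \<open>q\<close> can be shortened by
  \<open>p\<close>, or, if both are conjugates, the one with the longer conjugator by the other.\<close>

lemma reducible_of_overlap:
  assumes p: "fst p \<in> S" and q: "fst q \<in> S" "q \<noteq> flip p"
    and large: "length (f [q]) < 2 * overlap (f [p]) (f [q])"
  shows "reducible n k f"
proof -
  have "p \<noteq> q"
    using overlap_self[OF f_letter_reduced[OF p] f_letter_ne[OF p]] large by auto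
  then have ne: "fst p \<noteq> fst q" using q(2) by (auto simp: prod_eq_iff)
  obtain u' c v' where u: "f [p] = u' @ c" and v: "f [q] = winv c @ v'"
    and uv: "reduced (u' @ v')" and c: "length c = overlap (f [p]) (f [q])"
    by (rule overlapE[OF f_letter_reduced[OF p] f_letter_reduced[OF q(1)]])
  have v'c: "length v' < length c" using large c v by simp
  have flips: "fst (flip p) \<in> S" "fst (flip q) \<in> S" using p q by simp_all
  from p show ?thesis
  proof (cases rule: gens_cases)
    case X: (X i)
    show ?thesis
    proof (rule reducible_X[of "flip p" i "flip q"])
      have "reduce (f [flip q] @ f [flip p]) = reduce (winv v' @ c @ winv c @ winv u')"
        by (simp add: f_flip p q u v)
      also have "\<dots> = reduce (winv v' @ winv u')" by (rule reduce_winv_cancel_mid)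
      finally have "length (reduce (f [flip q] @ f [flip p])) \<le> length v' + length u'"
        using length_reduce_le[of "winv v' @ winv u'"] by simp
      then show "simpler B (reduce (f [flip q] @ f [flip p])) (f [flip p])"
        using v'c unfolding simpler_def by (simp add: f_flip p u)
    qed (use X q ne in auto)
  next
    case Y: (Y j)
    then obtain g where g: "f [p] = g @ [p] @ winv g" using f_Y by blast
    show ?thesis
    proof (cases "length c \<le> length g")
      case True
      have "u' @ c = (g @ [p]) @ winv g" using u g by simp
      then obtain d where "winv g = d @ c"
        using suffix_of_append True length_winv by metis
      then have g': "g = winv c @ winv d" by (metis winv_append winv_winv)
      have "reduce (f [flip q] @ g) = reduce (winv v' @ c @ winv c @ winv d)"
        by (simp add: f_flip q v g')
      also have "\<dots> = reduce (winv v' @ winv d)" by (rule reduce_winv_cancel_mid)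
      finally show ?thesis
        using v'c Y q ne by (intro reducible_shorter_conj[of p j "flip q" g p "winv v' @ winv d"] g)
          (auto simp: g')
    next
      case False
      have "u' @ c = g @ ([p] @ winv g)" using u g by simp
      then obtain d where "c = d @ [p] @ winv g"
        using suffix_of_append[of g "[p] @ winv g" u' c] False by (auto simp: not_le)
      then have v2: "f [q] = g @ [flip p] @ winv d @ v'" by (simp add: v winv_Cons)
      define r where "r = winv d @ v'"
      have v3: "f [q] = g @ [flip p] @ r" using v2 by (simp add: r_def)
      \<comment> \<open>Left multiplication by \<open>f p\<close> removes the letter \<open>flip p\<close> from words starting like \<open>f q\<close>.\<close>
      have cancel: "reduce (f [p] @ g @ [flip p] @ z) = reduce (g @ z)" for z
      proof -
        have "reduce (f [p] @ g @ [flip p] @ z) = reduce ((g @ [p]) @ winv g @ g @ ([flip p] @ z))"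
          by (simp add: g)
        also have "\<dots> = reduce ((g @ [p]) @ [flip p] @ z)" by (rule reduce_winv_cancel_mid)
        also have "\<dots> = reduce (g @ [p] @ winv [p] @ z)" by simp
        also have "\<dots> = reduce (g @ z)" by (rule reduce_winv_cancel_mid)
        finally show ?thesis .
      qed
      from q(1) show ?thesis
      proof (cases rule: gens_cases)
        case X: (X i)
        show ?thesis
        proof (rule reducible_X[of q i p])
          have "length (reduce (f [p] @ f [q])) \<le> length (g @ r)"
            unfolding v3 cancel by (rule length_reduce_le)
          then show "simpler B (reduce (f [p] @ f [q])) (f [q])"
            unfolding simpler_def by (simp add: v3)
        qed (use X Y p ne in auto)
      next
        case l: (Y l)
        then obtain h where h: "f [q] = h @ [q] @ winv h" using f_Y by blast
        have eq: "h @ ([q] @ winv h) = g @ ([flip p] @ r)" using h v3 by simp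
        consider "length h < length g" | "length h = length g" | "length h > length g" by linarith
        then show ?thesis
        proof cases
          case 1
          with eq obtain g1 where g1: "g = h @ g1" "[q] @ winv h = g1 @ [flip p] @ r"
            by (auto simp: append_eq_append_conv2)
          then obtain g2 where "g1 = q # g2" using 1 by (cases g1) auto
          then have g2: "g = h @ [q] @ g2" using g1 by simp
          have "reduce (f [flip q] @ g) = reduce ((h @ [flip q]) @ winv h @ h @ ([q] @ g2))"
            unfolding f_flip[OF q(1)] h g2 by (simp add: winv_Cons)
          also have "\<dots> = reduce ((h @ [flip q]) @ [q] @ g2)" by (rule reduce_winv_cancel_mid)
          also have "\<dots> = reduce (h @ winv [q] @ [q] @ g2)" by simp
          also have "\<dots> = reduce (h @ g2)" by (rule reduce_winv_cancel_mid)
          finally show ?thesis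
            using Y q ne by (intro reducible_shorter_conj[of p j "flip q" g p "h @ g2"] g)
              (auto simp: g2)
        next
          case 2
          then have "q = flip p" using eq by (auto simp: append_eq_append_conv)
          then show ?thesis using q(2) by simp
        next
          case 3
          with eq obtain h1 where h1: "h = g @ h1" "h1 @ [q] @ winv h = [flip p] @ r"
            by (auto simp: append_eq_append_conv2)
          then obtain h2 where "h1 = flip p # h2" using 3 by (cases h1) auto
          then have h2: "h = g @ [flip p] @ h2" using h1 by simp
          have "reduce (f [p] @ h) = reduce (g @ h2)" unfolding h2 by (rule cancel)
          then show ?thesis
            using l p ne by (intro reducible_shorter_conj[of q l p h q "g @ h2"] h) (auto simp: h2)
        qed
      qed
    qed
  qed
qed

lemma S_nonempty_power: "s \<in> S \<Longrightarrow> 0 < B ^ m"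
  by (cases s) auto

text \<open>The second Nielsen condition: if the initial segment \<open>a\<close> of \<open>f s\<close>, at most half of it, can be exchanged
  for a smaller word \<open>b\<close> of the same length by a factor \<open>f t\<close>, either the length drops, or
  it stays the same and the weight goes down. For a \<open>y\<close> letter the factor acts on the conjugator.\<close>

lemma reducible_of_exchange:
  assumes s: "fst s \<in> S" and t: "fst t \<in> S" "fst s \<noteq> fst t"
    and fs: "f [s] = a @ x" and ft: "f [t] = b @ winv a"
    and len: "length a = length b" "2 * length a \<le> length (f [s])"
    and less: "word_value B b < word_value B a"
  shows "reducible n k f"
proof -
  have cancel: "reduce (f [t] @ a @ z) = reduce (b @ z)" for z
  proof -
    have "reduce (f [t] @ a @ z) = reduce (b @ winv a @ a @ z)" by (simp add: ft)
    also have "\<dots> = reduce (b @ z)" by (rule reduce_winv_cancel_mid)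
    finally show ?thesis .
  qed
  have less': "word_value B (b @ z) < word_value B (a @ z)" for z
    using less len(1) S_nonempty_power[OF s, of "length z"] unfolding word_value_append by simp
  from s show ?thesis
  proof (cases rule: gens_cases)
    case X: (X i)
    have fts: "reduce (f [t] @ f [s]) = reduce (b @ x)" unfolding fs by (rule cancel)
    have "simpler B (reduce (f [t] @ f [s])) (f [s])"
    proof (cases "length (reduce (b @ x)) < length (f [s])")
      case True
      then show ?thesis unfolding simpler_def fts by simp
    next
      case False
      then have "length (reduce (b @ x)) = length (b @ x)"
        using length_reduce_le[of "b @ x"] len fs by simp
      then have bx: "reduce (b @ x) = b @ x" by (rule reduce_length_eq)
      define m where "m = length (a @ x) div 2"
      have m: "m \<le> length x" "length a \<le> m" using len fs unfolding m_def by auto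
      have "weight B (b @ x) = word_value B (b @ take (m - length b) x) + word_value B (take m (winv x))"
        unfolding weight_def using m len by (simp add: m_def take_append)
      moreover have "weight B (a @ x) = word_value B (a @ take (m - length a) x) + word_value B (take m (winv x))"
        unfolding weight_def using m len by (simp add: m_def take_append)
      ultimately have "weight B (b @ x) < weight B (a @ x)"
        using less' len(1) by simp
      then have "simpler B (b @ x) (a @ x)" unfolding simpler_def using len(1) by simp
      then show ?thesis by (simp only: fts bx) (simp only: fs)
    qed
    then show ?thesis using X t by (intro reducible_X[of s i t]) auto
  next
    case Y: (Y j)
    then obtain g where g: "f [s] = g @ [s] @ winv g" using f_Y by blast
    have "length a \<le> length g" using len(2) unfolding g by simp
    then obtain g' where g': "g = a @ g'"
      using fs g by (metis append_eq_append_conv_if append_eq_append_conv2 append_take_drop_id)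
    have t_g: "reduce (f [t] @ g) = reduce (b @ g')" unfolding g' by (rule cancel)
    have "simpler B (reduce ((b @ g') @ [s] @ winv (b @ g'))) (f [s])"
    proof (cases "length (reduce ((b @ g') @ [s] @ winv (b @ g'))) < length (f [s])")
      case True
      then show ?thesis unfolding simpler_def by simp
    next
      case False
      then have "length (reduce ((b @ g') @ [s] @ winv (b @ g'))) = length ((b @ g') @ [s] @ winv (b @ g'))"
        using length_reduce_le[of "(b @ g') @ [s] @ winv (b @ g')"] len(1) g g' by simp
      then have red: "reduce ((b @ g') @ [s] @ winv (b @ g')) = (b @ g') @ [s] @ winv (b @ g')"
        by (rule reduce_length_eq)
      have w: "weight B (h @ [l] @ winv h) = 2 * word_value B h" for h l
      proof -
        have "length (h @ [l] @ winv h) div 2 = length h" by simp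
        then show ?thesis unfolding weight_def by (simp add: winv_Cons)
      qed
      show ?thesis
        unfolding simpler_def red g w using less'[of g'] len(1) by (simp add: g')
    qed
    then show ?thesis using Y t g t_g by (intro reducible_conj[of s j t g s "b @ g'"]) auto
  qed
qed

text \<open>If the neighbours \<open>f p\<close> and \<open>f r\<close> together cancel all of \<open>f q\<close>, then by the first condition each of
  them cancels exactly one half, and \<open>f q\<close> is \<open>a winv b\<close> with \<open>a\<close> and \<open>b\<close> different of equal length.
  According to which of them is smaller, \<open>q\<close> can be used to improve \<open>p\<close> or \<open>r\<close>.\<close>

lemma reducible_of_middle_cancelled:
  assumes p: "fst p \<in> S" and q: "fst q \<in> S" "q \<noteq> flip p" and r: "fst r \<in> S" "r \<noteq> flip q"
    and large: "length (f [q]) \<le> overlap (f [p]) (f [q]) + overlap (f [q]) (f [r])"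
  shows "reducible n k f"
proof (rule ccontr)
  assume not_red: "\<not> reducible n k f"
  have le: "2 * overlap (f [s]) (f [t]) \<le> length (f [t])" "2 * overlap (f [s]) (f [t]) \<le> length (f [s])"
    if "fst s \<in> S" "fst t \<in> S" "t \<noteq> flip s" for s t
  proof -
    show "2 * overlap (f [s]) (f [t]) \<le> length (f [t])"
      using reducible_of_overlap[OF that] not_red by (meson not_le)
    have "flip s \<noteq> flip (flip t)" using that(3) by (metis flip_flip)
    then have "\<not> length (f [flip s]) < 2 * overlap (f [flip t]) (f [flip s])"
      using reducible_of_overlap[of "flip t" "flip s"] not_red that by auto
    then show "2 * overlap (f [s]) (f [t]) \<le> length (f [s])"
      using that by (simp add: f_flip overlap_winv)
  qed
  note red = f_letter_reduced[OF p] f_letter_reduced[OF q(1)] f_letter_reduced[OF r(1)]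
  obtain u' c v' where u: "f [p] = u' @ c" and v: "f [q] = winv c @ v'"
    and uv: "reduced (u' @ v')" and c: "length c = overlap (f [p]) (f [q])"
    by (rule overlapE[OF red(1,2)])
  obtain u2 d w where v2: "f [q] = u2 @ d" and w: "f [r] = winv d @ w"
    and vw: "reduced (u2 @ w)" and d: "length d = overlap (f [q]) (f [r])"
    by (rule overlapE[OF red(2,3)])
  have half: "2 * length c = length (f [q])" "2 * length d = length (f [q])"
    using large le[OF p q] le[OF q(1) r] c d by linarith+
  define a where "a = winv c"
  define b where "b = winv d"
  have "length v' = length d" using half v by simp
  moreover have "winv c @ v' = u2 @ d" using v v2 by simp
  ultimately have "v' = winv b" by (simp add: b_def append_eq_append_conv)
  then have fq: "f [q] = a @ winv b" using v by (simp add: a_def)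
  have ab: "length a = length b" using half by (simp add: a_def b_def)
  have "a \<noteq> b"
  proof
    assume "a = b"
    then have "reduce (f [q]) = []" by (simp add: fq)
    then show False using red(2) f_letter_ne[OF q(1)] by (simp add: reduce_reduced)
  qed
  moreover have "fst ` set a \<subseteq> S" "fst ` set b \<subseteq> S"
    using f_letter_gens[OF q(1)] unfolding fq by (auto simp: image_Un)
  ultimately have "word_value B a \<noteq> word_value B b"
    using word_value_inj ab by blast
  have not_self: "\<not> length (f [s]) \<le> 2 * overlap (f [s]) (f [s])" if "fst s \<in> S" for s
    using overlap_self[OF f_letter_reduced[OF that] f_letter_ne[OF that]] by simp
  have pq: "fst p \<noteq> fst q"
    using q(2) not_self[OF q(1)] half(1) c fst_eq_cases[of p q] by auto
  have rq: "fst r \<noteq> fst q"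
    using r(2) not_self[OF q(1)] half(2) d fst_eq_cases[of q r] by auto
  from \<open>word_value B a \<noteq> word_value B b\<close> consider
    "word_value B b < word_value B a" | "word_value B a < word_value B b" by linarith
  then have "reducible n k f"
  proof cases
    case 1
    show ?thesis
    proof (rule reducible_of_exchange[of "flip p" "flip q" a "winv u'" b])
      show "f [flip p] = a @ winv u'" using p by (simp add: f_flip u a_def)
      show "f [flip q] = b @ winv a" using q by (simp add: f_flip fq)
      show "2 * length a \<le> length (f [flip p])"
        using le(2)[OF p q] c p by (simp add: f_flip a_def)
    qed (use p q pq ab 1 in auto)
  next
    case 2
    show ?thesis
    proof (rule reducible_of_exchange[of r q b w a])
      show "f [r] = b @ w" using w by (simp add: b_def)
      show "2 * length b \<le> length (f [r])"
        using le(1)[OF q(1) r] d by (simp add: b_def)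
    qed (use r q rq ab 2 fq in auto)
  qed
  with not_red show False by simp
qed

text \<open>For an irreducible \<open>f\<close> every letter of \<open>w\<close> leaves at least one letter of its image uncancelled in
  \<open>f w\<close>.\<close>

lemma length_le_of_irreducible:
  assumes irred: "\<not> reducible n k f" and w: "w \<in> carrier (Fnk n k)"
  shows "length w \<le> length (f w)"
proof -
  have mid: "overlap (f [p]) (f [q]) + overlap (f [q]) (f [r]) < length (f [q])"
    if "fst p \<in> S" "fst q \<in> S" "q \<noteq> flip p" "fst r \<in> S" "r \<noteq> flip q" for p q r
    using reducible_of_middle_cancelled[OF that] irred by (meson not_le)
  \<comment> \<open>The end \<open>b\<close> of \<open>f q\<close> survives in \<open>f (v q)\<close> and is longer than what any next letter can cancel.\<close>
  have inv: "\<exists>z a b. f (v @ [q]) = z @ b \<and> f [q] = a @ b \<and> length v \<le> length z \<and> b \<noteq> [] \<and>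
      (\<forall>r. fst r \<in> S \<longrightarrow> r \<noteq> flip q \<longrightarrow> overlap (f [q]) (f [r]) < length b)"
    if "v @ [q] \<in> carrier (Fnk n k)" for v q
    using that
  proof (induction v arbitrary: q rule: rev_induct)
    case Nil
    then have q: "fst q \<in> S" by simp
    have "overlap (f [q]) (f [r]) < length (f [q])" if "fst r \<in> S" "r \<noteq> flip q" for r
      using mid[of q q r] q that by simp
    then show ?case using f_letter_ne[OF q] by (intro exI[of _ "[]"] exI[of _ "f [q]"]) simp
  next
    case (snoc p v)
    then have p: "fst p \<in> S" and q: "fst q \<in> S" and red: "reduced (v @ [p, q])"
      and vp: "v @ [p] \<in> carrier (Fnk n k)"
      by (auto simp: carrier_free_group reduced_append image_Un)
    have qp: "q \<noteq> flip p"
      using red by (auto simp: reduced_append reduced_Cons)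
    obtain z a b where IH: "f (v @ [p]) = z @ b" "f [p] = a @ b" "length v \<le> length z" "b \<noteq> []"
      "overlap (f [p]) (f [q]) < length b"
      using snoc.IH[OF vp] q qp by blast
    obtain u' c v' where u: "f [p] = u' @ c" and v: "f [q] = winv c @ v'"
      and uv: "reduced (u' @ v')" and c: "length c = overlap (f [p]) (f [q])"
      by (rule overlapE[OF f_letter_reduced[OF p] f_letter_reduced[OF q]])
    have "\<exists>m. b = m @ c"
      using suffix_of_append[of u' c a b] u IH(2,5) c by simp
    then obtain m where m: "b = m @ c" by blast
    have m_ne: "m \<noteq> []" using IH(5) c m by auto
    have "a @ m @ c = u' @ c" using m u IH(2) by simp
    then have u': "u' = a @ m" by (metis append.assoc append_same_eq)
    have "(v @ [p]) @ [q] \<in> carrier (Fnk n k)" using snoc.prems by simp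
    then have "reduce ((v @ [p]) @ [q]) = (v @ [p]) @ [q]"
      by (simp only: carrier_free_group reduce_reduced)
    then have "f ((v @ [p]) @ [q]) = reduce (f (v @ [p]) @ f [q])"
      using auto_mult[OF f_auto vp, of "[q]"] q by simp
    also have "\<dots> = reduce ((z @ m) @ c @ winv c @ v')" by (simp add: IH(1) m v)
    also have "\<dots> = reduce ((z @ m) @ v')" by (rule reduce_winv_cancel_mid)
    also have "\<dots> = (z @ m) @ v'"
    proof (rule reduce_reduced)
      have "reduced (f (v @ [p]))" using auto_closed[OF f_auto vp] by (simp add: carrier_free_group)
      then have "reduced ((z @ m) @ c)" using IH(1) m by simp
      then have "reduced (z @ m)" by (simp only: reduced_append[of "z @ m"])
      then show "reduced ((z @ m) @ v')"
        using uv m_ne unfolding u' by (auto simp: reduced_append)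
    qed
    finally have fq: "f ((v @ [p]) @ [q]) = (z @ m) @ v'" .
    have "length (v @ [p]) \<le> length (z @ m)" using IH(3) m_ne by (cases m) auto
    moreover have ov: "overlap (f [q]) (f [r]) < length v'" if "fst r \<in> S" "r \<noteq> flip q" for r
      using mid[OF p q qp that] c v by simp
    moreover have "v' \<noteq> []" using ov[of q] q by auto
    ultimately show ?case using fq v by (intro exI[of _ "z @ m"] exI[of _ "winv c"] exI[of _ v']) blast
  qed
  show ?thesis
  proof (cases w rule: rev_cases)
    case (snoc v q)
    then obtain z a b where "f w = z @ b" "length v \<le> length z" "b \<noteq> []"
      using inv[of v q] w by auto
    then show ?thesis using snoc by (cases b) auto
  qed simp
qed

text \<open>The inverse \<open>h\<close> does not lengthen letters, as \<open>f\<close> does not shorten \<open>h l\<close>; so \<open>h\<close> maps letters to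
  letters. A conjugate of \<open>y\<^sub>j\<close> of length one is \<open>y\<^sub>j\<close>, and by injectivity \<open>x\<close> letters go to \<open>x\<close>
  letters.\<close>

lemma signed_perm_of_irreducible:
  assumes irred: "\<not> reducible n k f"
  shows "inv\<^bsub>\<AA> S\<^esub> f \<in> signed_perms n k"
proof -
  define h where "h = inv\<^bsub>\<AA> S\<^esub> f"
  have h: "h \<in> auto (Fnk n k)" and fh: "\<And>x. x \<in> carrier (Fnk n k) \<Longrightarrow> f (h x) = x"
    unfolding h_def using auto_inv_closed[OF f_auto] auto_inv_right[OF f_auto] by auto
  have letter: "\<exists>p. fst p \<in> S \<and> h [l] = [p]" if l: "fst l \<in> S" for l
  proof -
    have c: "h [l] \<in> carrier (Fnk n k)" using auto_closed[OF h] l by simp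
    then have "length (h [l]) \<le> 1"
      using length_le_of_irreducible[OF irred c] fh[of "[l]"] l by simp
    moreover have "h [l] \<noteq> []"
      using auto_inj[OF h, of "[l]" "[]"] l by (simp add: auto_Nil[OF h] carrier_free_group)
    ultimately obtain p where "h [l] = [p]" by (cases "h [l]") auto
    then show ?thesis using c by (intro exI[of _ p]) simp
  qed
  have hA: "h \<in> A_aut n k"
    unfolding h_def using subgroup_A_aut f_A by (rule subgroup.m_inv_closed)
  interpret h: class_preserving n k h by unfold_locales (rule hA)
  have y: "h [p] = [p]" if p: "fst p = GY j" "j < k" for p j
  proof -
    obtain g where g: "h [p] = g @ [p] @ winv g" using h.f_Y[OF p] by blast
    obtain p' where "h [p] = [p']" using letter[of p] p by auto
    then show ?thesis using g by (cases g) auto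
  qed
  have "\<exists>i'<n. \<exists>b. h [(GX i, True)] = [(GX i', b)]" if i: "i < n" for i
  proof -
    obtain p where p: "fst p \<in> S" "h [(GX i, True)] = [p]" using letter[of "(GX i, True)"] i by auto
    from p(1) show ?thesis
    proof (cases rule: gens_cases)
      case (X i')
      then show ?thesis using p(2) by (cases p) auto
    next
      case (Y j)
      then have "h [(GX i, True)] = h [p]" using y p by simp
      then have "[(GX i, True)] = [p]" using auto_inj[OF h, of "[(GX i, True)]" "[p]"] i p(1) by simp
      then show ?thesis using Y by auto
    qed
  qed
  then show ?thesis
    using h y unfolding h_def[symmetric] signed_perms_def by auto
qed

end

lemma wf_complexity_order: "wf (complexity_order n k)"
  unfolding complexity_order_def by (rule wf_measures)

text \<open>Transvections lower the complexity until an automorphism is reached whose inverse is a signed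
  permutation.\<close>

theorem A_aut_generated:
  "f \<in> A_aut n k \<Longrightarrow> f \<in> generate (\<AA> (gens n k)) (transvections n k \<union> signed_perms n k)"
proof (induction f rule: wf_induct_rule[OF wf_complexity_order[of n k]])
  case (1 f)
  let ?A = "\<AA> (gens n k)" and ?E = "transvections n k \<union> signed_perms n k"
  interpret A: group ?A by (rule group_AutoGroup)
  interpret class_preserving n k f by unfold_locales (rule 1(2))
  have E_A: "?E \<subseteq> A_aut n k" using transvections_A_aut signed_perms_A_aut by blast
  have E: "?E \<subseteq> carrier ?A" using E_A by (auto simp: carrier_AA A_aut_def)
  have fc: "f \<in> carrier ?A" using f_auto by (simp add: carrier_AA)
  show ?case
  proof (cases "reducible n k f")
    case True
    then obtain e where e: "e \<in> transvections n k" "(f \<otimes>\<^bsub>?A\<^esub> e, f) \<in> complexity_order n k"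
      by (auto simp: reducible_def)
    have ec: "e \<in> carrier ?A" using e(1) E by blast
    have "f \<otimes>\<^bsub>?A\<^esub> e \<in> A_aut n k"
      using subgroup.m_closed[OF subgroup_A_aut] 1(2) e(1) E_A by blast
    then have "f \<otimes>\<^bsub>?A\<^esub> e \<in> generate ?A ?E" using 1(1)[OF e(2)] by blast
    moreover have "inv\<^bsub>?A\<^esub> e \<in> generate ?A ?E" using e(1) by (intro generate.inv) blast
    ultimately have "f \<otimes>\<^bsub>?A\<^esub> e \<otimes>\<^bsub>?A\<^esub> inv\<^bsub>?A\<^esub> e \<in> generate ?A ?E" by (rule generate.eng)
    then show ?thesis using fc ec by (simp add: A.m_assoc)
  next
    case False
    then have "inv\<^bsub>?A\<^esub> f \<in> generate ?A ?E"
      using signed_perm_of_irreducible by (intro generate.incl) blast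
    then have "inv\<^bsub>?A\<^esub> (inv\<^bsub>?A\<^esub> f) \<in> generate ?A ?E" by (rule A.generate_m_inv_closed[OF E])
    then show ?thesis using fc by simp
  qed
qed

section \<open>Computing with automorphisms\<close>

text \<open>Identities between products of elementary automorphisms are proved by composing
  substitutions and comparing the images of the generators. The rules for \<open>realizes\<close> do this
  syntactically, and carry along that the maps are automorphisms, which the group operation
  presupposes.\<close>

definition realizes :: "'a set \<Rightarrow> ('a word \<Rightarrow> 'a word) \<Rightarrow> ('a \<Rightarrow> 'a word) \<Rightarrow> bool" where
  "realizes S f \<phi> \<longleftrightarrow> f \<in> auto (free_group S) \<and> f = subst_map S \<phi>"

lemma realizes_auto: "realizes S f \<phi> \<Longrightarrow> f \<in> auto (free_group S)"
  unfolding realizes_def by (rule conjunct1)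

lemma realizes_mult:
  "realizes S f \<phi> \<Longrightarrow> realizes S g \<psi> \<Longrightarrow> realizes S (f \<otimes>\<^bsub>\<AA> S\<^esub> g) (\<lambda>a. subst \<phi> (\<psi> a))"
proof -
  assume f: "realizes S f \<phi>" and g: "realizes S g \<psi>"
  have 1: "f \<otimes>\<^bsub>\<AA> S\<^esub> g \<in> auto (free_group S)"
    using monoid.m_closed[OF group.is_monoid[OF group_AutoGroup[of S]], of f g]
      realizes_auto[OF f] realizes_auto[OF g] by (simp only: carrier_AA)
  have "f \<otimes>\<^bsub>\<AA> S\<^esub> g = subst_map S (\<lambda>a. subst \<phi> (\<psi> a))"
    using f g subst_map_mult[of S \<phi> \<psi>] unfolding realizes_def by metis
  then show ?thesis using 1 unfolding realizes_def by blast
qed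

lemma realizes_eq:
  assumes "realizes S f \<phi>" "realizes S g \<psi>" "\<And>a. a \<in> S \<Longrightarrow> reduce (\<phi> a) = reduce (\<psi> a)"
  shows "f = g"
  using subst_map_eqI[of S \<phi> \<psi>] assms by (simp add: realizes_def)

lemma realizes_apply:
  assumes "realizes S f \<phi>" "a \<in> S" shows "f [(a, True)] = reduce (\<phi> a)"
  using assms subst_map_apply[of "[(a, True)]" S \<phi>] unfolding realizes_def by simp

lemmas word_simps = subst_def reduce_def gen_word_def winv_Cons

definition right_mult :: "gen set \<Rightarrow> nat \<Rightarrow> gen \<times> bool \<Rightarrow> gen word \<Rightarrow> gen word" where
  "right_mult S i v = replace_gen S (GX i) [(GX i, True), v]"

definition left_mult :: "gen set \<Rightarrow> nat \<Rightarrow> gen \<times> bool \<Rightarrow> gen word \<Rightarrow> gen word" where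
  "left_mult S i v = replace_gen S (GX i) [v, (GX i, True)]"

definition part_conj :: "gen set \<Rightarrow> gen \<Rightarrow> gen \<times> bool \<Rightarrow> gen word \<Rightarrow> gen word" where
  "part_conj S x v = replace_gen S x [v, (x, True), flip v]"

lemma realizes_right_mult:
  "GX i \<in> S \<Longrightarrow> fst v \<in> S \<Longrightarrow> fst v \<noteq> GX i \<Longrightarrow>
    realizes S (right_mult S i v) (gen_word(GX i := [(GX i, True), v]))"
  unfolding realizes_def right_mult_def by (simp add: replace_gen_right_auto) (simp add: replace_gen_def)

lemma realizes_left_mult:
  "GX i \<in> S \<Longrightarrow> fst v \<in> S \<Longrightarrow> fst v \<noteq> GX i \<Longrightarrow>
    realizes S (left_mult S i v) (gen_word(GX i := [v, (GX i, True)]))"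
  unfolding realizes_def left_mult_def by (simp add: replace_gen_left_auto) (simp add: replace_gen_def)

lemma realizes_part_conj:
  "x \<in> S \<Longrightarrow> fst v \<in> S \<Longrightarrow> fst v \<noteq> x \<Longrightarrow>
    realizes S (part_conj S x v) (gen_word(x := [v, (x, True), flip v]))"
  unfolding realizes_def part_conj_def by (simp add: replace_gen_conj_auto) (simp add: replace_gen_def)

lemmas realizes_intros = realizes_mult realizes_right_mult realizes_left_mult realizes_part_conj

lemma realizes_one: "realizes S \<one>\<^bsub>\<AA> S\<^esub> gen_word"
proof -
  have "(\<lambda>x\<in>carrier (free_group S). x) = subst_map S gen_word"
    unfolding subst_map_def
    by (rule restrict_ext) (simp add: subst_gen_word reduce_reduced carrier_free_group)
  then show ?thesis
    using group.id_in_auto[OF group_free_group, of S] unfolding realizes_def one_AutoGroup by simp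
qed

lemma inv_AutoGroup_eq:
  assumes "realizes S f \<phi>" "realizes S g \<psi>" "\<And>a. a \<in> S \<Longrightarrow> subst \<phi> (\<psi> a) = [(a, True)]"
  shows "inv\<^bsub>\<AA> S\<^esub> g = f"
proof (rule group.inv_equality[OF group_AutoGroup])
  show "f \<otimes>\<^bsub>\<AA> S\<^esub> g = \<one>\<^bsub>\<AA> S\<^esub>"
    by (rule realizes_eq[OF realizes_mult[OF assms(1,2)] realizes_one])
       (simp add: assms(3) gen_word_def)
qed (use assms realizes_auto in \<open>auto simp: carrier_AA\<close>)

lemma inv_right_mult:
  "GX i \<in> S \<Longrightarrow> fst v \<in> S \<Longrightarrow> fst v \<noteq> GX i \<Longrightarrow> inv\<^bsub>\<AA> S\<^esub> (right_mult S i v) = right_mult S i (flip v)"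
  by (rule inv_AutoGroup_eq[OF realizes_right_mult realizes_right_mult]; cases v) (auto simp: word_simps)

lemma inv_left_mult:
  "GX i \<in> S \<Longrightarrow> fst v \<in> S \<Longrightarrow> fst v \<noteq> GX i \<Longrightarrow> inv\<^bsub>\<AA> S\<^esub> (left_mult S i v) = left_mult S i (flip v)"
  by (rule inv_AutoGroup_eq[OF realizes_left_mult realizes_left_mult]; cases v) (auto simp: word_simps)

lemma inv_part_conj:
  "x \<in> S \<Longrightarrow> fst v \<in> S \<Longrightarrow> fst v \<noteq> x \<Longrightarrow> inv\<^bsub>\<AA> S\<^esub> (part_conj S x v) = part_conj S x (flip v)"
  by (rule inv_AutoGroup_eq[OF realizes_part_conj realizes_part_conj]; cases v) (auto simp: word_simps)

section \<open>The kernel of the projection to the automorphism group of the smaller free group\<close>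

lemma kill_y_eq_subst:
  "kill_y w = subst (\<lambda>a. case a of GX i \<Rightarrow> [(GX i, True)] | GY j \<Rightarrow> []) w"
proof -
  have "filter (\<lambda>p. \<exists>i. fst p = GX i) w = concat (map (\<lambda>p. if snd p then
      (\<lambda>a. case a of GX i \<Rightarrow> [(GX i, True)] | GY j \<Rightarrow> []) (fst p)
      else winv ((\<lambda>a. case a of GX i \<Rightarrow> [(GX i, True)] | GY j \<Rightarrow> []) (fst p))) w)"
    by (induction w) (auto split: gen.splits simp: prod_eq_iff)
  then show ?thesis unfolding kill_y_def subst_def by (simp only:)
qed

lemma kill_y_hom: "kill_y \<in> hom (Fnk n k) (Fnk n 0)"
proof -
  have "subst (\<lambda>a. case a of GX i \<Rightarrow> [(GX i, True)] | GY j \<Rightarrow> []) \<in> hom (Fnk n k) (Fnk n 0)"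
    by (rule subst_hom) (auto simp: gens_def)
  moreover have "kill_y = subst (\<lambda>a. case a of GX i \<Rightarrow> [(GX i, True)] | GY j \<Rightarrow> [])"
    by (rule ext) (rule kill_y_eq_subst)
  ultimately show ?thesis by simp
qed

lemma kill_y_letter [simp]: "kill_y [(GX i, b)] = [(GX i, b)]" "kill_y [(GY j, b)] = []"
  by (simp_all add: kill_y_def reduce_def)

lemma kill_y_id: "w \<in> carrier (Fnk n 0) \<Longrightarrow> kill_y w = w"
proof -
  assume w: "w \<in> carrier (Fnk n 0)"
  then have "filter (\<lambda>p. \<exists>i. fst p = GX i) w = w"
    by (intro filter_True) (auto simp: carrier_free_group gens_def)
  then show ?thesis using w by (simp add: kill_y_def carrier_free_group reduce_reduced)
qed

text \<open>Conjugates of \<open>y\<^sub>j\<close> are killed anyway, so only the \<open>x\<close> generators impose a condition.\<close>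

lemma kill_y_invariant_iff:
  assumes fA: "f \<in> A_aut n k"
  shows "(\<forall>z\<in>carrier (Fnk n k). kill_y (f z) = kill_y z) \<longleftrightarrow>
    (\<forall>i<n. kill_y (f [(GX i, True)]) = [(GX i, True)])"
proof
  assume "\<forall>z\<in>carrier (Fnk n k). kill_y (f z) = kill_y z"
  then show "\<forall>i<n. kill_y (f [(GX i, True)]) = [(GX i, True)]" by simp
next
  assume x: "\<forall>i<n. kill_y (f [(GX i, True)]) = [(GX i, True)]"
  have f: "f \<in> auto (Fnk n k)" using fA by (simp add: A_aut_def)
  have h: "(\<lambda>z. kill_y (f z)) \<in> hom (Fnk n k) (Fnk n 0)"
    using kill_y_hom[of n k] auto_hom[OF f] by (auto simp: hom_def Pi_iff simp del: mult_free_group)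
  have "kill_y (f [(a, True)]) = kill_y [(a, True)]" if "a \<in> gens n k" for a
    using that
  proof (cases rule: gens_cases)
    case (X i)
    then show ?thesis using x by simp
  next
    case (Y j)
    then obtain g where "f [(GY j, True)] = reduce (g @ [(GY j, True)] @ winv g)"
      using fA unfolding A_aut_iff by blast
    then show ?thesis using Y
      by (simp add: kill_y_eq_subst subst_append subst_Cons subst_winv)
  qed
  then show "\<forall>z\<in>carrier (Fnk n k). kill_y (f z) = kill_y z"
    using free_group_hom_eqI[OF group_free_group h kill_y_hom] by blast
qed

lemma K_aut_iff:
  "f \<in> K_aut n k \<longleftrightarrow> f \<in> A_aut n k \<and> (\<forall>z\<in>carrier (Fnk n k). kill_y (f z) = kill_y z)"
proof -
  have "gens n 0 \<subseteq> gens n k" by (auto simp: gens_def)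
  then have sub: "carrier (Fnk n 0) \<subseteq> carrier (Fnk n k)"
    by (metis (no_types, lifting) carrier_free_group subsetI subset_trans)
  have "f \<in> K_aut n k \<longleftrightarrow> f \<in> A_aut n k \<and> (\<forall>z\<in>carrier (Fnk n 0). kill_y (f z) = z)"
    unfolding K_aut_def kernel_def induced_aut_def one_AutoGroup
    by (auto simp: fun_eq_iff restrict_def)
  moreover have "(\<forall>z\<in>carrier (Fnk n 0). kill_y (f z) = z) \<longleftrightarrow> (\<forall>z\<in>carrier (Fnk n k). kill_y (f z) = kill_y z)"
    if fA: "f \<in> A_aut n k"
  proof
    assume "\<forall>z\<in>carrier (Fnk n 0). kill_y (f z) = z"
    then show "\<forall>z\<in>carrier (Fnk n k). kill_y (f z) = kill_y z"
      unfolding kill_y_invariant_iff[OF fA] by simp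
  qed (use sub kill_y_id in auto)
  ultimately show ?thesis by blast
qed

lemma subgroup_K_aut: "subgroup (K_aut n k) (\<AA> (gens n k))"
proof -
  interpret A: group "\<AA> (gens n k)" by (rule group_AutoGroup)
  interpret H: subgroup "A_aut n k" "\<AA> (gens n k)" by (rule subgroup_A_aut)
  show ?thesis
  proof (rule A.subgroupI)
    show "K_aut n k \<subseteq> carrier (\<AA> (gens n k))" using H.subset by (auto simp: K_aut_iff)
    have "\<one>\<^bsub>\<AA> (gens n k)\<^esub> \<in> K_aut n k"
      unfolding K_aut_iff using H.one_closed by (simp add: one_AutoGroup)
    then show "K_aut n k \<noteq> {}" by blast
  next
    fix f assume f: "f \<in> K_aut n k"
    then have fa: "f \<in> auto (Fnk n k)" by (simp add: K_aut_iff A_aut_def)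
    let ?h = "inv\<^bsub>\<AA> (gens n k)\<^esub> f"
    have ha: "?h \<in> auto (Fnk n k)" using fa by (rule auto_inv_closed)
    have "kill_y (?h z) = kill_y z" if z: "z \<in> carrier (Fnk n k)" for z
      using f auto_closed[OF ha z] auto_inv_right[OF fa z] unfolding K_aut_iff by metis
    then show "?h \<in> K_aut n k" using f H.m_inv_closed unfolding K_aut_iff by blast
  next
    fix f h assume f: "f \<in> K_aut n k" and h: "h \<in> K_aut n k"
    then have fa: "f \<in> auto (Fnk n k)" "h \<in> auto (Fnk n k)" by (auto simp: K_aut_iff A_aut_def)
    then show "f \<otimes>\<^bsub>\<AA> (gens n k)\<^esub> h \<in> K_aut n k"
      using f h H.m_closed unfolding K_aut_iff by (simp add: mult_AutoGroup_apply auto_closed)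
  qed
qed

text \<open>Both signs are included, which makes the set closed under inverses.\<close>

definition K_generators :: "nat \<Rightarrow> nat \<Rightarrow> (gen word \<Rightarrow> gen word) set" where
  "K_generators n k =
     {right_mult (gens n k) i (GY j, b) | i j b. i < n \<and> j < k}
   \<union> {part_conj (gens n k) (GX i) (GY j, b) | i j b. i < n \<and> j < k}
   \<union> {part_conj (gens n k) (GY j) v | j v. j < k \<and> fst v \<in> gens n k \<and> fst v \<noteq> GY j}"

lemma K_autI:
  assumes f: "f \<in> auto (Fnk n k)"
    and y: "\<And>j. j < k \<Longrightarrow> \<exists>g\<in>carrier (Fnk n k). f [(GY j, True)] = reduce (g @ [(GY j, True)] @ winv g)"
    and x: "\<And>i. i < n \<Longrightarrow> kill_y (f [(GX i, True)]) = [(GX i, True)]"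
  shows "f \<in> K_aut n k"
  unfolding K_aut_iff
proof
  show "f \<in> A_aut n k" using f y by (simp add: A_aut_iff)
  then show "\<forall>z\<in>carrier (Fnk n k). kill_y (f z) = kill_y z" using x by (simp add: kill_y_invariant_iff)
qed

lemma part_conj_K_aut:
  assumes "x \<in> gens n k" "fst v \<in> gens n k" "fst v \<noteq> x" "\<And>i. x = GX i \<Longrightarrow> \<exists>j. fst v = GY j"
  shows "part_conj (gens n k) x v \<in> K_aut n k"
proof (rule K_autI)
  note r = realizes_part_conj[OF assms(1-3)]
  show "part_conj (gens n k) x v \<in> auto (Fnk n k)" using r by (rule realizes_auto)
  show "\<exists>g\<in>carrier (Fnk n k). part_conj (gens n k) x v [(GY j, True)] = reduce (g @ [(GY j, True)] @ winv g)"
    if j: "j < k" for j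
  proof (cases "x = GY j")
    case True
    then show ?thesis
      using realizes_apply[OF r, of "GY j"] j assms(2) by (intro bexI[of _ "[v]"]) auto
  next
    case False
    then show ?thesis
      using realizes_apply[OF r, of "GY j"] j
      by (intro bexI[of _ "[]"]) (auto simp: gen_word_def carrier_free_group)
  qed
  show "kill_y (part_conj (gens n k) x v [(GX i, True)]) = [(GX i, True)]" if i: "i < n" for i
  proof (cases "x = GX i")
    case True
    then obtain j b where "v = (GY j, b)" using assms(4) by (cases v) auto
    then show ?thesis
      using realizes_apply[OF r, of "GX i"] i True by (simp add: word_simps kill_y_eq_subst)
  next
    case False
    then show ?thesis
      using realizes_apply[OF r, of "GX i"] i by (simp add: gen_word_def reduce_reduced)
  qed
qed

lemma right_mult_K_aut:
  assumes "i < n" "j < k" shows "right_mult (gens n k) i (GY j, b) \<in> K_aut n k"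
proof (rule K_autI)
  have r: "realizes (gens n k) (right_mult (gens n k) i (GY j, b)) (gen_word(GX i := [(GX i, True), (GY j, b)]))"
    using assms by (intro realizes_right_mult) auto
  show "right_mult (gens n k) i (GY j, b) \<in> auto (Fnk n k)" using r by (rule realizes_auto)
  show "\<exists>g\<in>carrier (Fnk n k). right_mult (gens n k) i (GY j, b) [(GY l, True)] = reduce (g @ [(GY l, True)] @ winv g)"
    if "l < k" for l
    using realizes_apply[OF r, of "GY l"] that
    by (intro bexI[of _ "[]"]) (auto simp: gen_word_def carrier_free_group)
  show "kill_y (right_mult (gens n k) i (GY j, b) [(GX h, True)]) = [(GX h, True)]" if "h < n" for h
    using realizes_apply[OF r, of "GX h"] that
    by (cases "h = i") (auto simp: word_simps kill_y_eq_subst)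
qed

lemma K_generators_K_aut: "K_generators n k \<subseteq> K_aut n k"
  unfolding K_generators_def
  by (auto intro!: right_mult_K_aut part_conj_K_aut simp del: gens_iff) (simp_all add: gens_iff)

section \<open>Conjugating the generators of the kernel\<close>

text \<open>How \<open>R\<close>, the map \<open>x\<^sub>a \<mapsto> x\<^sub>a x\<^sub>b\<close>, passes the generators of the kernel. In each case the factors to
  the left of \<open>R\<close> on the right-hand side are again such generators.\<close>

locale kernel_conjugation =
  fixes n k a b j :: nat and e :: bool
  assumes lt: "a < n" "b < n" "j < k" and ab: "a \<noteq> b"
begin

abbreviation "S \<equiv> gens n k"
abbreviation mult (infixl "\<star>" 70) where "u \<star> v \<equiv> u \<otimes>\<^bsub>\<AA> S\<^esub> v"
abbreviation "R \<equiv> right_mult S a (GX b, True)"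
abbreviation "c \<equiv> part_conj S (GY j) (GX b, True)"
abbreviation "c' \<equiv> part_conj S (GY j) (GX b, False)"

lemma push_right_mult_a: "R \<star> right_mult S a (GY j, e) = c \<star> right_mult S a (GY j, e) \<star> c' \<star> R"
  by (rule realizes_eq, (rule realizes_intros | (use lt ab in simp; fail))+)
     (use lt ab in \<open>auto simp: word_simps\<close>)

lemma push_right_mult_b: "R \<star> right_mult S b (GY j, e)
    = c \<star> right_mult S a (GY j, \<not> e) \<star> c' \<star> right_mult S b (GY j, e) \<star> R"
  by (rule realizes_eq, (rule realizes_intros | (use lt ab in simp; fail))+)
     (use lt ab in \<open>auto simp: word_simps\<close>)

lemma push_part_conj_a: "R \<star> part_conj S (GX a) (GY j, e)
    = part_conj S (GX a) (GY j, e) \<star> right_mult S a (GY j, e) \<star> c \<star> right_mult S a (GY j, \<not> e) \<star> c' \<star> R"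
  by (rule realizes_eq, (rule realizes_intros | (use lt ab in simp; fail))+)
     (use lt ab in \<open>auto simp: word_simps\<close>)

lemma push_part_conj_b: "R \<star> part_conj S (GX b) (GY j, e)
    = c \<star> right_mult S a (GY j, e) \<star> c' \<star> right_mult S a (GY j, \<not> e) \<star> part_conj S (GX b) (GY j, e) \<star> R"
  by (rule realizes_eq, (rule realizes_intros | (use lt ab in simp; fail))+)
     (use lt ab in \<open>auto simp: word_simps\<close>)

lemma push_y_conj_a: "R \<star> part_conj S (GY j) (GX a, True) = c \<star> part_conj S (GY j) (GX a, True) \<star> R"
  by (rule realizes_eq, (rule realizes_intros | (use lt ab in simp; fail))+)
     (use lt ab in \<open>auto simp: word_simps\<close>)

lemma push_y_conj_a_inv: "R \<star> part_conj S (GY j) (GX a, False) = part_conj S (GY j) (GX a, False) \<star> c' \<star> R"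
  by (rule realizes_eq, (rule realizes_intros | (use lt ab in simp; fail))+)
     (use lt ab in \<open>auto simp: word_simps\<close>)

end

lemma right_mult_commute:
  assumes "a < n" "i < n" "fst v \<in> gens n k" "fst w \<in> gens n k" "i \<noteq> a"
    "fst v \<noteq> GX a" "fst w \<noteq> GX i" "fst v \<noteq> GX i" "fst w \<noteq> GX a"
  shows "right_mult (gens n k) a v \<otimes>\<^bsub>\<AA> (gens n k)\<^esub> right_mult (gens n k) i w
    = right_mult (gens n k) i w \<otimes>\<^bsub>\<AA> (gens n k)\<^esub> right_mult (gens n k) a v"
  by (rule realizes_eq, (rule realizes_intros | (use assms in simp; fail))+)
     (use assms in \<open>cases v; cases w; auto simp: word_simps\<close>)

lemma right_mult_part_conj_commute:
  assumes "a < n" "x \<in> gens n k" "fst v \<in> gens n k" "fst w \<in> gens n k" "x \<noteq> GX a"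
    "fst v \<noteq> GX a" "fst w \<noteq> x" "fst v \<noteq> x" "fst w \<noteq> GX a"
  shows "right_mult (gens n k) a v \<otimes>\<^bsub>\<AA> (gens n k)\<^esub> part_conj (gens n k) x w
    = part_conj (gens n k) x w \<otimes>\<^bsub>\<AA> (gens n k)\<^esub> right_mult (gens n k) a v"
  by (rule realizes_eq, (rule realizes_intros | (use assms in simp; fail))+)
     (use assms in \<open>cases v; cases w; auto simp: word_simps\<close>)

text \<open>Left multiplications by \<open>y\<close> letters are dispensable as generators of the kernel.\<close>

lemma left_mult_eq:
  assumes "i < n" "fst v \<in> gens n k" "fst v \<noteq> GX i"
  shows "left_mult (gens n k) i v = part_conj (gens n k) (GX i) v \<otimes>\<^bsub>\<AA> (gens n k)\<^esub> right_mult (gens n k) i v"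
  by (rule realizes_eq, (rule realizes_intros | (use assms in simp; fail))+)
     (use assms in \<open>cases v; auto simp: word_simps\<close>)

text \<open>The indices are permuted injectively, as \<open>f\<close> cannot map two different generators to the same letter
  up to inversion.\<close>

lemma signed_perm_realizes:
  assumes "f \<in> signed_perms n k"
  obtains \<pi> \<epsilon> where
    "realizes (gens n k) f (case_gen (\<lambda>i. [(GX (\<pi> i), \<epsilon> i)]) (\<lambda>j. [(GY j, True)]))"
    "\<And>i. i < n \<Longrightarrow> \<pi> i < n" "inj_on \<pi> {..<n}"
proof -
  have f: "f \<in> auto (Fnk n k)" and y: "\<And>j. j < k \<Longrightarrow> f [(GY j, True)] = [(GY j, True)]"
    and "\<forall>i. \<exists>i' b. i < n \<longrightarrow> i' < n \<and> f [(GX i, True)] = [(GX i', b)]"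
    using assms unfolding signed_perms_def by blast+
  then obtain \<pi> \<epsilon> where x: "\<And>i. i < n \<Longrightarrow> \<pi> i < n \<and> f [(GX i, True)] = [(GX (\<pi> i), \<epsilon> i)]"
    by metis
  have "inj_on \<pi> {..<n}"
  proof (rule inj_onI)
    fix h i assume "h \<in> {..<n}" "i \<in> {..<n}" and eq: "\<pi> h = \<pi> i"
    then have hi: "h < n" "i < n" by auto
    have E: "f [(GX i, b)] = f [(GX h, True)]" if "b = (\<epsilon> h = \<epsilon> i)" for b
    proof (cases b)
      case True
      then show ?thesis using that x[OF hi(1)] x[OF hi(2)] eq by simp
    next
      case False
      have "f [(GX i, False)] = winv (f [(GX i, True)])"
        using auto_winv[OF f, of "[(GX i, True)]"] hi by simp
      then show ?thesis using False that x[OF hi(1)] x[OF hi(2)] eq by simp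
    qed
    have "[(GX i, \<epsilon> h = \<epsilon> i)] = [(GX h, True)]"
      by (rule iffD1[OF auto_inj[OF f] E[OF refl]]) (simp_all add: hi)
    then show "h = i" by simp
  qed
  moreover have "f = subst_map (gens n k) (case_gen (\<lambda>i. [(GX (\<pi> i), \<epsilon> i)]) (\<lambda>j. [(GY j, True)]))"
    by (subst auto_eq_subst_map[OF f], rule subst_map_eqI) (use x y in \<open>auto simp: gens_def\<close>)
  ultimately show thesis using that f x unfolding realizes_def by blast
qed

locale signed_perm_conjugation =
  fixes n k :: nat and f :: "gen word \<Rightarrow> gen word" and \<pi> :: "nat \<Rightarrow> nat" and \<epsilon> :: "nat \<Rightarrow> bool"
  assumes f: "realizes (gens n k) f (case_gen (\<lambda>i. [(GX (\<pi> i), \<epsilon> i)]) (\<lambda>j. [(GY j, True)]))"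
    and \<pi>: "\<And>i. i < n \<Longrightarrow> \<pi> i < n" "inj_on \<pi> {..<n}"
begin

abbreviation "S \<equiv> gens n k"
abbreviation mult (infixl "\<star>" 70) where "u \<star> v \<equiv> u \<otimes>\<^bsub>\<AA> S\<^esub> v"

lemma \<pi>_eq: "h < n \<Longrightarrow> i < n \<Longrightarrow> \<pi> h = \<pi> i \<longleftrightarrow> h = i"
  using \<pi>(2) by (auto simp: inj_on_def)

lemma conj_right_mult:
  assumes "i < n" "j < k"
  shows "f \<star> right_mult S i (GY j, e) = (if \<epsilon> i then right_mult S (\<pi> i) (GY j, e) \<star> f
    else part_conj S (GX (\<pi> i)) (GY j, \<not> e) \<star> right_mult S (\<pi> i) (GY j, \<not> e) \<star> f)"
proof (cases "\<epsilon> i")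
  case True
  have "f \<star> right_mult S i (GY j, e) = right_mult S (\<pi> i) (GY j, e) \<star> f"
    by (rule realizes_eq, (rule f realizes_intros | (use assms \<pi> in simp; fail))+)
       (use assms \<pi>_eq True in \<open>auto simp: word_simps elim!: gens_cases split: if_splits\<close>)
  then show ?thesis using True by simp
next
  case False
  have "f \<star> right_mult S i (GY j, e)
      = part_conj S (GX (\<pi> i)) (GY j, \<not> e) \<star> right_mult S (\<pi> i) (GY j, \<not> e) \<star> f"
    by (rule realizes_eq, (rule f realizes_intros | (use assms \<pi> in simp; fail))+)
       (use assms \<pi>_eq False in \<open>auto simp: word_simps elim!: gens_cases split: if_splits\<close>)
  then show ?thesis using False by simp
qed

lemma conj_part_conj_X:
  assumes "i < n" "j < k"
  shows "f \<star> part_conj S (GX i) (GY j, e) = part_conj S (GX (\<pi> i)) (GY j, e) \<star> f"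
  by (rule realizes_eq, (rule f realizes_intros | (use assms \<pi> in simp; fail))+)
     (use assms \<pi>_eq in \<open>auto simp: word_simps elim!: gens_cases split: if_splits\<close>)

lemma conj_part_conj_Y:
  assumes "i < n" "j < k"
  shows "f \<star> part_conj S (GY j) (GX i, e) = part_conj S (GY j) (GX (\<pi> i), e = \<epsilon> i) \<star> f"
  by (rule realizes_eq, (rule f realizes_intros | (use assms \<pi> in simp; fail))+)
     (use assms \<pi>_eq in \<open>auto simp: word_simps elim!: gens_cases split: if_splits\<close>)

lemma conj_part_conj_Y':
  assumes "l < k" "j < k" "l \<noteq> j"
  shows "f \<star> part_conj S (GY j) (GY l, e) = part_conj S (GY j) (GY l, e) \<star> f"
  by (rule realizes_eq, (rule f realizes_intros | (use assms \<pi> in simp; fail))+)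
     (use assms in \<open>auto simp: word_simps elim!: gens_cases split: if_splits\<close>)

end

section \<open>Generators of the kernel\<close>

text \<open>The elements \<open>\<sigma>\<close> with \<open>\<sigma> H \<sigma>\<inverse> \<subseteq> H\<close>, in the form that fits identities moving \<open>\<sigma>\<close> past elements of
  \<open>H\<close>. The inclusion may be strict, so this set is closed under products but in general not under
  inverses.\<close>

definition (in group) pushing :: "'a set \<Rightarrow> 'a set" where
  "pushing H = {\<sigma> \<in> carrier G. \<forall>s\<in>H. \<exists>t\<in>H. \<sigma> \<otimes> s = t \<otimes> \<sigma>}"

lemma (in group) push_through_generate:
  assumes \<sigma>: "\<sigma> \<in> carrier G" and T: "T \<subseteq> carrier G" and H: "subgroup H G"
    and push: "\<And>s. s \<in> T \<Longrightarrow> \<exists>t\<in>H. \<sigma> \<otimes> s = t \<otimes> \<sigma>" and s: "s \<in> generate G T"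
  shows "\<exists>t\<in>H. \<sigma> \<otimes> s = t \<otimes> \<sigma>"
  using s
proof (induction s rule: generate.induct)
  case one
  then show ?case using \<sigma> subgroup.one_closed[OF H] by (intro bexI[of _ \<one>]) auto
next
  case (incl s)
  then show ?case using push by blast
next
  case (inv s)
  then obtain t where t: "t \<in> H" "\<sigma> \<otimes> s = t \<otimes> \<sigma>" using push by blast
  have c: "s \<in> carrier G" "t \<in> carrier G" using inv T t subgroup.mem_carrier[OF H] by auto
  have "t \<otimes> (\<sigma> \<otimes> inv s) = (t \<otimes> \<sigma>) \<otimes> inv s" using c \<sigma> by (simp add: m_assoc)
  also have "\<dots> = \<sigma>" using t(2)[symmetric] c \<sigma> by (simp add: m_assoc)
  finally have "\<sigma> \<otimes> inv s = inv t \<otimes> \<sigma>"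
    using c \<sigma> by (metis inv_closed inv_solve_left m_closed)
  then show ?case using subgroup.m_inv_closed[OF H t(1)] by blast
next
  case (eng s1 s2)
  then obtain t1 t2 where t: "t1 \<in> H" "\<sigma> \<otimes> s1 = t1 \<otimes> \<sigma>" "t2 \<in> H" "\<sigma> \<otimes> s2 = t2 \<otimes> \<sigma>" by blast
  have c: "s1 \<in> carrier G" "s2 \<in> carrier G" "t1 \<in> carrier G" "t2 \<in> carrier G"
    using eng(1,2) T generate_in_carrier subgroup.mem_carrier[OF H] t by auto
  have "\<sigma> \<otimes> (s1 \<otimes> s2) = t1 \<otimes> (\<sigma> \<otimes> s2)" using c \<sigma> t(2) by (simp add: m_assoc[symmetric])
  also have "\<dots> = (t1 \<otimes> t2) \<otimes> \<sigma>" using c \<sigma> t(4) by (simp add: m_assoc)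
  finally show ?case using subgroup.m_closed[OF H t(1,3)] by blast
qed

lemma (in group) pushing_generateI:
  assumes "\<sigma> \<in> carrier G" "T \<subseteq> carrier G"
    "\<And>s. s \<in> T \<Longrightarrow> \<exists>t\<in>generate G T. \<sigma> \<otimes> s = t \<otimes> \<sigma>"
  shows "\<sigma> \<in> pushing (generate G T)"
  unfolding pushing_def
  using push_through_generate[OF assms(1,2) generate_is_subgroup[OF assms(2)] assms(3)] assms(1) by blast

lemma (in group) pushing_mult:
  assumes H: "subgroup H G" and \<sigma>: "\<sigma> \<in> pushing H" and \<tau>: "\<tau> \<in> pushing H"
  shows "\<sigma> \<otimes> \<tau> \<in> pushing H"
proof -
  have c: "\<sigma> \<in> carrier G" "\<tau> \<in> carrier G" using \<sigma> \<tau> by (auto simp: pushing_def)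
  have "\<exists>t\<in>H. \<sigma> \<otimes> \<tau> \<otimes> s = t \<otimes> (\<sigma> \<otimes> \<tau>)" if s: "s \<in> H" for s
  proof -
    obtain t where t: "t \<in> H" "\<tau> \<otimes> s = t \<otimes> \<tau>" using \<tau> s by (auto simp: pushing_def)
    obtain u where u: "u \<in> H" "\<sigma> \<otimes> t = u \<otimes> \<sigma>" using \<sigma> t by (auto simp: pushing_def)
    have cc: "s \<in> carrier G" "t \<in> carrier G" "u \<in> carrier G"
      using s t u subgroup.mem_carrier[OF H] by auto
    have "\<sigma> \<otimes> \<tau> \<otimes> s = \<sigma> \<otimes> (t \<otimes> \<tau>)" using c cc t(2) by (simp add: m_assoc)
    also have "\<dots> = u \<otimes> \<sigma> \<otimes> \<tau>" using c cc u(2) by (simp add: m_assoc[symmetric])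
    finally have "\<sigma> \<otimes> \<tau> \<otimes> s = u \<otimes> (\<sigma> \<otimes> \<tau>)" using c cc by (simp add: m_assoc)
    then show ?thesis using u(1) by blast
  qed
  then show ?thesis unfolding pushing_def using c m_closed by blast
qed

lemma (in group) subgroup_pushing_self:
  assumes H: "subgroup H G" shows "H \<subseteq> pushing H"
proof
  fix \<sigma> assume \<sigma>: "\<sigma> \<in> H"
  have "\<exists>t\<in>H. \<sigma> \<otimes> s = t \<otimes> \<sigma>" if s: "s \<in> H" for s
  proof -
    have "\<sigma> \<otimes> s = (\<sigma> \<otimes> s \<otimes> inv \<sigma>) \<otimes> \<sigma>"
      using \<sigma> s subgroup.mem_carrier[OF H] by (simp add: m_assoc)
    moreover have "\<sigma> \<otimes> s \<otimes> inv \<sigma> \<in> H"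
      using \<sigma> s subgroup.m_closed[OF H] subgroup.m_inv_closed[OF H] by blast
    ultimately show ?thesis by blast
  qed
  then show "\<sigma> \<in> pushing H" unfolding pushing_def using subgroup.mem_carrier[OF H \<sigma>] by blast
qed

locale free_factor =
  fixes n k :: nat
begin

abbreviation "S \<equiv> gens n k"
abbreviation mult (infixl "\<bullet>" 70) where "u \<bullet> v \<equiv> u \<otimes>\<^bsub>\<AA> S\<^esub> v"

definition "K0 = generate (\<AA> S) (K_generators n k)"

sublocale A: group "\<AA> S" by (rule group_AutoGroup)

lemma K_generators_carrier: "K_generators n k \<subseteq> carrier (\<AA> S)"
  using K_generators_K_aut subgroup.subset[OF subgroup_K_aut] by blast

sublocale K0: subgroup K0 "\<AA> S"
  unfolding K0_def by (rule A.generate_is_subgroup[OF K_generators_carrier])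

lemma K0_K_aut: "K0 \<subseteq> K_aut n k"
  unfolding K0_def by (rule A.generate_subgroup_incl[OF K_generators_K_aut subgroup_K_aut])

lemma right_mult_K0: "i < n \<Longrightarrow> j < k \<Longrightarrow> right_mult S i (GY j, b) \<in> K0"
  unfolding K0_def K_generators_def by (intro generate.incl) blast

lemma part_conj_X_K0: "i < n \<Longrightarrow> j < k \<Longrightarrow> part_conj S (GX i) (GY j, b) \<in> K0"
  unfolding K0_def K_generators_def by (intro generate.incl) blast

lemma part_conj_Y_K0: "j < k \<Longrightarrow> fst v \<in> S \<Longrightarrow> fst v \<noteq> GY j \<Longrightarrow> part_conj S (GY j) v \<in> K0"
  unfolding K0_def K_generators_def by (intro generate.incl) blast

abbreviation "pushes \<equiv> A.pushing K0"

lemma pushesI: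
  "\<sigma> \<in> carrier (\<AA> S) \<Longrightarrow> (\<And>s. s \<in> K_generators n k \<Longrightarrow> \<exists>t\<in>K0. \<sigma> \<bullet> s = t \<bullet> \<sigma>) \<Longrightarrow> \<sigma> \<in> pushes"
  unfolding K0_def by (rule A.pushing_generateI[OF _ K_generators_carrier])

lemmas pushes_mult = A.pushing_mult[OF K0.subgroup_axioms]

lemma K_generators_cases:
  assumes "s \<in> K_generators n k"
  obtains i j e where "s = right_mult S i (GY j, e)" "i < n" "j < k"
  | i j e where "s = part_conj S (GX i) (GY j, e)" "i < n" "j < k"
  | i j e where "s = part_conj S (GY j) (GX i, e)" "i < n" "j < k"
  | l j e where "s = part_conj S (GY j) (GY l, e)" "l < k" "j < k" "l \<noteq> j"
proof -
  from assms consider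
      i j e where "s = right_mult S i (GY j, e)" "i < n" "j < k"
    | i j e where "s = part_conj S (GX i) (GY j, e)" "i < n" "j < k"
    | j v where "s = part_conj S (GY j) v" "j < k" "fst v \<in> S" "fst v \<noteq> GY j"
    unfolding K_generators_def by blast
  then show thesis
  proof cases
    case (3 j v)
    then obtain a e where v: "v = (a, e)" by (cases v) auto
    from 3(3) have "a \<in> S" by (simp add: v)
    then show thesis by (cases rule: gens_cases) (use 3 v that(3,4) in auto)
  qed (rule that(1,2); assumption)+
qed

lemma signed_perm_pushes: "f \<in> signed_perms n k \<Longrightarrow> f \<in> pushes"
proof (rule pushesI)
  assume f: "f \<in> signed_perms n k"
  show "f \<in> carrier (\<AA> S)" using f by (simp add: signed_perms_def carrier_AA)
  obtain \<pi> \<epsilon> where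
    *: "realizes (gens n k) f (case_gen (\<lambda>i. [(GX (\<pi> i), \<epsilon> i)]) (\<lambda>j. [(GY j, True)]))"
    "\<And>i. i < n \<Longrightarrow> \<pi> i < n" "inj_on \<pi> {..<n}" using signed_perm_realizes[OF f] by blast
  interpret c: signed_perm_conjugation n k f \<pi> \<epsilon> by unfold_locales (use * in auto)
  fix s assume "s \<in> K_generators n k"
  then show "\<exists>t\<in>K0. f \<bullet> s = t \<bullet> f"
  proof (cases rule: K_generators_cases)
    case (1 i j e)
    then show ?thesis
      unfolding 1(1) c.conj_right_mult[OF 1(2,3)] using *(2)
      by (cases "\<epsilon> i") (auto intro!: right_mult_K0 part_conj_X_K0 K0.m_closed)
  next
    case (2 i j e)
    then show ?thesis unfolding 2(1) c.conj_part_conj_X[OF 2(2,3)] using *(2) part_conj_X_K0 by blast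
  next
    case (3 i j e)
    have "part_conj S (GY j) (GX (\<pi> i), e = \<epsilon> i) \<in> K0" using 3 *(2) by (intro part_conj_Y_K0) auto
    then show ?thesis unfolding 3(1) c.conj_part_conj_Y[OF 3(2,3)] by blast
  next
    case (4 l j e)
    have "part_conj S (GY j) (GY l, e) \<in> K0" using 4 by (intro part_conj_Y_K0) auto
    then show ?thesis unfolding 4(1) c.conj_part_conj_Y'[OF 4(2-4)] by blast
  qed
qed

text \<open>The generators that neither involve \<open>x\<^sub>a\<close> nor move \<open>x\<^sub>b\<close> commute with the transvection; the
  others are covered by the formulas above.\<close>

lemma right_mult_pos_pushes:
  assumes "a < n" "b < n" "a \<noteq> b" shows "right_mult S a (GX b, True) \<in> pushes"
proof (rule pushesI)
  let ?R = "right_mult S a (GX b, True)"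
  have "realizes S ?R (gen_word(GX a := [(GX a, True), (GX b, True)]))"
    using assms by (intro realizes_right_mult) auto
  then show "?R \<in> carrier (\<AA> S)" unfolding carrier_AA by (rule realizes_auto)
  have Y: "part_conj S (GY j) (GX i, e) \<in> K0" if "i < n" "j < k" for i j e
    using that by (intro part_conj_Y_K0) auto
  note K = right_mult_K0 part_conj_X_K0 Y K0.m_closed
  fix s assume "s \<in> K_generators n k"
  then show "\<exists>t\<in>K0. ?R \<bullet> s = t \<bullet> ?R"
  proof (cases rule: K_generators_cases)
    case (1 i j e)
    interpret L: kernel_conjugation n k a b j e by unfold_locales (use assms 1 in auto)
    consider "i = a" | "i = b" | "i \<noteq> a" "i \<noteq> b" by blast
    then show ?thesis
    proof cases
      case 1 show ?thesis unfolding \<open>s = _\<close> \<open>i = a\<close> L.push_right_mult_a by (rule bexI, rule refl, intro K L.lt)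
    next
      case 2 show ?thesis unfolding \<open>s = _\<close> \<open>i = b\<close> L.push_right_mult_b by (rule bexI, rule refl, intro K L.lt)
    next
      case 3
      have "?R \<bullet> s = s \<bullet> ?R" unfolding \<open>s = _\<close> by (rule right_mult_commute) (use 1 3 assms in auto)
      then show ?thesis using K(1)[OF 1(2,3)] 1(1) by blast
    qed
  next
    case (2 i j e)
    interpret L: kernel_conjugation n k a b j e by unfold_locales (use assms 2 in auto)
    consider "i = a" | "i = b" | "i \<noteq> a" "i \<noteq> b" by blast
    then show ?thesis
    proof cases
      case 1 show ?thesis unfolding \<open>s = _\<close> \<open>i = a\<close> L.push_part_conj_a by (rule bexI, rule refl, intro K L.lt)
    next
      case 2 show ?thesis unfolding \<open>s = _\<close> \<open>i = b\<close> L.push_part_conj_b by (rule bexI, rule refl, intro K L.lt)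
    next
      case 3
      have "?R \<bullet> s = s \<bullet> ?R" unfolding \<open>s = _\<close>
        by (rule right_mult_part_conj_commute) (use 2 3 assms in auto)
      then show ?thesis using K(2)[OF 2(2,3)] 2(1) by blast
    qed
  next
    case (3 i j e)
    interpret L: kernel_conjugation n k a b j e by unfold_locales (use assms 3 in auto)
    consider "i = a" e | "i = a" "\<not> e" | "i \<noteq> a" by blast
    then show ?thesis
    proof cases
      case 1
      then have s: "s = part_conj S (GY j) (GX a, True)" using 3(1) by simp
      show ?thesis unfolding s L.push_y_conj_a by (rule bexI, rule refl, intro K L.lt)
    next
      case 2
      then have s: "s = part_conj S (GY j) (GX a, False)" using 3(1) by simp
      show ?thesis unfolding s L.push_y_conj_a_inv by (rule bexI, rule refl, intro K L.lt)
    next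
      case ia: 3
      have "?R \<bullet> s = s \<bullet> ?R" unfolding \<open>s = _\<close>
        by (rule right_mult_part_conj_commute) (use 3 ia assms in auto)
      then show ?thesis using Y[OF 3(2,3)] 3(1) by blast
    qed
  next
    case (4 l j e)
    have "?R \<bullet> s = s \<bullet> ?R" unfolding \<open>s = _\<close>
      by (rule right_mult_part_conj_commute) (use 4 assms in auto)
    moreover have "s \<in> K0" unfolding \<open>s = _\<close> using 4 by (intro part_conj_Y_K0) auto
    ultimately show ?thesis by blast
  qed
qed

text \<open>Inverting one \<open>x\<close> generator conjugates the transvections \<open>x\<^sub>a \<mapsto> x\<^sub>a x\<^sub>b\<close> into the remaining ones between
  \<open>x\<close> letters, so these need no formulas of their own.\<close>

definition "sign_change i = replace_gen S (GX i) [(GX i, False)]"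

lemma realizes_sign_change:
  "i < n \<Longrightarrow> realizes S (sign_change i) (gen_word(GX i := [(GX i, False)]))"
  unfolding realizes_def sign_change_def
  by (intro conjI replace_gen_auto[where w' = "[(GX i, False)]"])
     (auto simp: word_simps replace_gen_def)

lemma sign_change_pushes: "i < n \<Longrightarrow> sign_change i \<in> pushes"
proof (rule signed_perm_pushes)
  assume i: "i < n"
  note r = realizes_sign_change[OF i]
  have "\<exists>i'<n. \<exists>b. sign_change i [(GX h, True)] = [(GX i', b)]" if "h < n" for h
    using realizes_apply[OF r, of "GX h"] that
    by (cases "h = i") (auto simp: word_simps)
  moreover have "sign_change i [(GY j, True)] = [(GY j, True)]" if "j < k" for j
    using realizes_apply[OF r, of "GY j"] that by (auto simp: word_simps)
  ultimately show "sign_change i \<in> signed_perms n k"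
    using realizes_auto[OF r] unfolding signed_perms_def by blast
qed

lemma right_mult_pushes:
  assumes "a < n" "b < n" "a \<noteq> b" shows "right_mult S a (GX b, e) \<in> pushes"
proof (cases e)
  case False
  have "right_mult S a (GX b, False) = sign_change b \<bullet> right_mult S a (GX b, True) \<bullet> sign_change b"
    by (rule realizes_eq, (rule realizes_sign_change realizes_intros | (use assms in simp; fail))+)
       (use assms in \<open>auto simp: word_simps\<close>)
  then show ?thesis
    using False pushes_mult right_mult_pos_pushes sign_change_pushes assms by simp
qed (use right_mult_pos_pushes assms in simp)

lemma left_mult_pushes:
  assumes "a < n" "b < n" "a \<noteq> b" shows "left_mult S a (GX b, e) \<in> pushes"
proof -
  have "left_mult S a (GX b, e) = sign_change a \<bullet> right_mult S a (GX b, \<not> e) \<bullet> sign_change a"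
    by (rule realizes_eq, (rule realizes_sign_change realizes_intros | (use assms in simp; fail))+)
       (use assms in \<open>auto simp: word_simps\<close>)
  then show ?thesis
    using pushes_mult right_mult_pushes sign_change_pushes assms by simp
qed

end

lemma signed_perms_inv:
  assumes f: "f \<in> signed_perms n k" shows "inv\<^bsub>\<AA> (gens n k)\<^esub> f \<in> signed_perms n k"
proof -
  have fa: "f \<in> auto (Fnk n k)" using f by (simp add: signed_perms_def)
  define h where "h = inv\<^bsub>\<AA> (gens n k)\<^esub> f"
  have h: "h \<in> auto (Fnk n k)" and hf: "\<And>x. x \<in> carrier (Fnk n k) \<Longrightarrow> h (f x) = x"
    unfolding h_def using auto_inv_closed[OF fa] auto_inv_left[OF fa] by auto
  obtain \<pi> \<epsilon> where
    *: "realizes (gens n k) f (case_gen (\<lambda>i. [(GX (\<pi> i), \<epsilon> i)]) (\<lambda>j. [(GY j, True)]))"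
    "\<And>i. i < n \<Longrightarrow> \<pi> i < n" "inj_on \<pi> {..<n}" using signed_perm_realizes[OF f] by blast
  have "\<pi> ` {..<n} \<subseteq> {..<n}" using *(2) by auto
  then have surj: "\<pi> ` {..<n} = {..<n}" by (intro endo_inj_surj *(3)) simp_all
  have "\<exists>i'<n. \<exists>b. h [(GX i, True)] = [(GX i', b)]" if i: "i < n" for i
  proof -
    obtain i' where i': "i' < n" "\<pi> i' = i" using surj i by (metis imageE lessThan_iff)
    have fx: "f [(GX i', True)] = [(GX i, \<epsilon> i')]"
      using realizes_apply[OF *(1), of "GX i'"] i' by (simp add: reduce_def)
    then have "f [(GX i', False)] = [(GX i, \<not> \<epsilon> i')]"
      using auto_winv[OF fa, of "[(GX i', True)]"] i' by simp
    with fx have "f [(GX i', \<epsilon> i')] = [(GX i, True)]" by (cases "\<epsilon> i'") simp_all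
    then have "h [(GX i, True)] = [(GX i', \<epsilon> i')]"
      using hf[of "[(GX i', \<epsilon> i')]"] i'(1) by simp
    then show ?thesis using i'(1) by blast
  qed
  moreover have "h [(GY j, True)] = [(GY j, True)]" if "j < k" for j
    using hf[of "[(GY j, True)]"] f that by (simp add: signed_perms_def)
  ultimately show ?thesis using h unfolding h_def[symmetric] signed_perms_def by blast
qed

lemma transvections_cases:
  assumes "e \<in> transvections n k"
  obtains i v where "e = left_mult (gens n k) i v" "i < n" "fst v \<in> gens n k" "fst v \<noteq> GX i"
  | i v where "e = right_mult (gens n k) i v" "i < n" "fst v \<in> gens n k" "fst v \<noteq> GX i"
  | j v where "e = part_conj (gens n k) (GY j) v" "j < k" "fst v \<in> gens n k" "fst v \<noteq> GY j"
  using assms unfolding transvections_def left_mult_def right_mult_def part_conj_def by blast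

lemma transvections_intros:
  "i < n \<Longrightarrow> fst v \<in> gens n k \<Longrightarrow> fst v \<noteq> GX i \<Longrightarrow> left_mult (gens n k) i v \<in> transvections n k"
  "i < n \<Longrightarrow> fst v \<in> gens n k \<Longrightarrow> fst v \<noteq> GX i \<Longrightarrow> right_mult (gens n k) i v \<in> transvections n k"
  "j < k \<Longrightarrow> fst v \<in> gens n k \<Longrightarrow> fst v \<noteq> GY j \<Longrightarrow> part_conj (gens n k) (GY j) v \<in> transvections n k"
  unfolding transvections_def left_mult_def right_mult_def part_conj_def by blast+

lemma transvections_inv:
  assumes "e \<in> transvections n k" shows "inv\<^bsub>\<AA> (gens n k)\<^esub> e \<in> transvections n k"
  using assms
proof (cases rule: transvections_cases)
  case (1 i v)
  then have "inv\<^bsub>\<AA> (gens n k)\<^esub> e = left_mult (gens n k) i (flip v)" by (simp add: inv_left_mult)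
  then show ?thesis using 1 transvections_intros(1)[of i n "flip v" k] by simp
next
  case (2 i v)
  then have "inv\<^bsub>\<AA> (gens n k)\<^esub> e = right_mult (gens n k) i (flip v)" by (simp add: inv_right_mult)
  then show ?thesis using 2 transvections_intros(2)[of i n "flip v" k] by simp
next
  case (3 j v)
  then have "inv\<^bsub>\<AA> (gens n k)\<^esub> e = part_conj (gens n k) (GY j) (flip v)" by (simp add: inv_part_conj)
  then show ?thesis using 3 transvections_intros(3)[of j k "flip v" n] by simp
qed

context free_factor
begin

text \<open>Elements of a complement of the kernel: automorphisms of the free group on the \<open>x\<^sub>i\<close>, extended by the
  identity on the \<open>y\<^sub>j\<close>. That they carry \<open>K0\<close> into itself is part of the definition, since it is known for
  generators only.\<close>

definition "fixers = {\<sigma> \<in> pushes. (\<forall>j<k. \<sigma> [(GY j, True)] = [(GY j, True)]) \<and>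
  (\<forall>i<n. \<sigma> [(GX i, True)] \<in> carrier (Fnk n 0))}"

definition "split_form = {\<kappa> \<bullet> \<sigma> | \<kappa> \<sigma>. \<kappa> \<in> K0 \<and> \<sigma> \<in> fixers}"

lemma pushes_auto: "\<sigma> \<in> pushes \<Longrightarrow> \<sigma> \<in> auto (Fnk n k)"
  unfolding A.pushing_def by (simp add: carrier_AA)

lemma fixers_apply:
  assumes \<sigma>: "\<sigma> \<in> fixers" and w: "w \<in> carrier (Fnk n 0)" shows "\<sigma> w \<in> carrier (Fnk n 0)"
proof -
  have sub: "gens n 0 \<subseteq> gens n k" by (auto simp: gens_def)
  have wk: "w \<in> carrier (Fnk n k)" using w sub unfolding carrier_free_group by blast
  have a: "\<sigma> \<in> auto (Fnk n k)" using \<sigma> pushes_auto by (auto simp: fixers_def)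
  have "\<sigma> w = subst (\<lambda>a. \<sigma> [(a, True)]) w"
    by (rule hom_eq_subst[OF auto_hom[OF a] wk])
  also have "\<dots> \<in> carrier (Fnk n 0)"
  proof (rule subst_in_free_group)
    show "fst ` set w \<subseteq> gens n 0" using w by (simp add: carrier_free_group)
    fix a assume "a \<in> gens n 0"
    then obtain i where "a = GX i" "i < n" by (auto simp: gens_def)
    then show "fst ` set (\<sigma> [(a, True)]) \<subseteq> gens n 0"
      using \<sigma> by (simp add: fixers_def carrier_free_group)
  qed
  finally show ?thesis .
qed

lemma fixers_mult: assumes "\<sigma> \<in> fixers" "\<tau> \<in> fixers" shows "\<sigma> \<bullet> \<tau> \<in> fixers"
proof -
  have P: "\<sigma> \<in> pushes" "\<tau> \<in> pushes" using assms by (auto simp: fixers_def)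
  have a: "\<sigma> \<in> auto (Fnk n k)" "\<tau> \<in> auto (Fnk n k)" using P pushes_auto by auto
  have "(\<sigma> \<bullet> \<tau>) [(GY j, True)] = [(GY j, True)]" if "j < k" for j
    using assms that by (simp add: mult_AutoGroup_apply[OF a] fixers_def)
  moreover have "(\<sigma> \<bullet> \<tau>) [(GX i, True)] \<in> carrier (Fnk n 0)" if "i < n" for i
  proof -
    have "\<tau> [(GX i, True)] \<in> carrier (Fnk n 0)" using assms(2) that by (simp add: fixers_def)
    then show ?thesis using fixers_apply[OF assms(1)] that by (simp add: mult_AutoGroup_apply[OF a])
  qed
  ultimately show ?thesis using pushes_mult[OF P] unfolding fixers_def by blast
qed

text \<open>As in a semidirect product, \<open>\<kappa> \<sigma> \<kappa>' \<tau>\<close> is \<open>(\<kappa> t) (\<sigma> \<tau>)\<close>, where \<open>t\<close> is obtained by moving \<open>\<sigma>\<close> past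
  \<open>\<kappa>'\<close>.\<close>

lemma split_form_mult: assumes "f \<in> split_form" "g \<in> split_form" shows "f \<bullet> g \<in> split_form"
proof -
  obtain \<kappa> \<sigma> where f: "f = \<kappa> \<bullet> \<sigma>" "\<kappa> \<in> K0" "\<sigma> \<in> fixers" using assms(1) unfolding split_form_def by blast
  obtain \<kappa>' \<tau> where g: "g = \<kappa>' \<bullet> \<tau>" "\<kappa>' \<in> K0" "\<tau> \<in> fixers" using assms(2) unfolding split_form_def by blast
  obtain t where t: "t \<in> K0" "\<sigma> \<bullet> \<kappa>' = t \<bullet> \<sigma>" using f(3) g(2) unfolding fixers_def A.pushing_def by blast
  have c: "\<kappa> \<in> carrier (\<AA> S)" "\<kappa>' \<in> carrier (\<AA> S)" "t \<in> carrier (\<AA> S)"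
    "\<sigma> \<in> carrier (\<AA> S)" "\<tau> \<in> carrier (\<AA> S)"
    using f g t by (auto simp: fixers_def A.pushing_def K0.mem_carrier)
  have "f \<bullet> g = \<kappa> \<bullet> ((\<sigma> \<bullet> \<kappa>') \<bullet> \<tau>)" unfolding f(1) g(1) using c by (simp add: A.m_assoc)
  also have "\<dots> = (\<kappa> \<bullet> t) \<bullet> (\<sigma> \<bullet> \<tau>)" unfolding t(2) using c by (simp add: A.m_assoc)
  finally show ?thesis
    using K0.m_closed[OF f(2) t(1)] fixers_mult[OF f(3) g(3)] unfolding split_form_def by blast
qed

lemma one_fixers: "\<one>\<^bsub>\<AA> S\<^esub> \<in> fixers"
proof -
  have "\<one>\<^bsub>\<AA> S\<^esub> \<in> pushes"
    unfolding A.pushing_def using K0.mem_carrier by auto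
  moreover have "\<one>\<^bsub>\<AA> S\<^esub> [(a, True)] = [(a, True)]" if "a \<in> S" for a
    using that by (simp add: one_AutoGroup)
  ultimately show ?thesis unfolding fixers_def by simp
qed

lemma K0_split_form: "\<kappa> \<in> K0 \<Longrightarrow> \<kappa> \<in> split_form"
proof -
  assume \<kappa>: "\<kappa> \<in> K0"
  then have "\<kappa> = \<kappa> \<bullet> \<one>\<^bsub>\<AA> S\<^esub>" using K0.mem_carrier by simp
  then show ?thesis using \<kappa> one_fixers unfolding split_form_def by blast
qed

lemma fixers_split_form: "\<sigma> \<in> fixers \<Longrightarrow> \<sigma> \<in> split_form"
proof -
  assume \<sigma>: "\<sigma> \<in> fixers"
  then have "\<sigma> = \<one>\<^bsub>\<AA> S\<^esub> \<bullet> \<sigma>" by (simp add: fixers_def A.pushing_def)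
  then show ?thesis using \<sigma> K0.one_closed unfolding split_form_def by blast
qed

lemma fixers_of_realizes:
  assumes "realizes S f \<phi>" "f \<in> pushes"
    "\<And>j. j < k \<Longrightarrow> \<phi> (GY j) = [(GY j, True)]" "\<And>i. i < n \<Longrightarrow> fst ` set (\<phi> (GX i)) \<subseteq> gens n 0"
  shows "f \<in> fixers"
proof -
  have "f [(GY j, True)] = [(GY j, True)]" if "j < k" for j
    using realizes_apply[OF assms(1), of "GY j"] assms(3) that by (simp add: reduce_reduced)
  moreover have "f [(GX i, True)] \<in> carrier (Fnk n 0)" if "i < n" for i
    using realizes_apply[OF assms(1), of "GX i"] assms(4)[OF that] that by (simp add: reduce_in_free_group)
  ultimately show ?thesis using assms(2) unfolding fixers_def by blast
qed

lemma transvection_split_form: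
  assumes "e \<in> transvections n k" shows "e \<in> split_form"
  using assms
proof (cases rule: transvections_cases)
  case (1 i v)
  from 1(3) show ?thesis
  proof (cases rule: gens_cases)
    case (X b)
    then obtain d where v: "v = (GX b, d)" "b \<noteq> i" using X 1(4) by (cases v) auto
    have "left_mult S i (GX b, d) \<in> fixers"
      by (rule fixers_of_realizes[OF realizes_left_mult])
         (use 1 X v left_mult_pushes in \<open>auto simp: gen_word_def\<close>)
    then show ?thesis using fixers_split_form v(1) 1(1) by simp
  next
    case (Y j)
    then obtain d where v: "v = (GY j, d)" using Y by (cases v) auto
    have "left_mult S i v \<in> K0"
      unfolding left_mult_eq[OF 1(2-4)] unfolding v
      by (intro K0.m_closed part_conj_X_K0 right_mult_K0 1 Y)
    then show ?thesis using K0_split_form 1(1) by simp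
  qed
next
  case (2 i v)
  from 2(3) show ?thesis
  proof (cases rule: gens_cases)
    case (X b)
    then obtain d where v: "v = (GX b, d)" "b \<noteq> i" using X 2(4) by (cases v) auto
    have "right_mult S i (GX b, d) \<in> fixers"
      by (rule fixers_of_realizes[OF realizes_right_mult])
         (use 2 X v right_mult_pushes in \<open>auto simp: gen_word_def\<close>)
    then show ?thesis using fixers_split_form v(1) 2(1) by simp
  next
    case (Y j)
    then obtain d where v: "v = (GY j, d)" using Y by (cases v) auto
    have "right_mult S i v \<in> K0" unfolding v by (intro right_mult_K0 2 Y)
    then show ?thesis using K0_split_form 2(1) by simp
  qed
next
  case (3 j v)
  then show ?thesis using K0_split_form part_conj_Y_K0 by simp
qed

lemma signed_perm_split_form:
  assumes "f \<in> signed_perms n k" shows "f \<in> split_form"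
proof -
  obtain \<pi> \<epsilon> where
    *: "realizes (gens n k) f (case_gen (\<lambda>i. [(GX (\<pi> i), \<epsilon> i)]) (\<lambda>j. [(GY j, True)]))"
    "\<And>i. i < n \<Longrightarrow> \<pi> i < n" "inj_on \<pi> {..<n}" using signed_perm_realizes[OF assms] by blast
  have "f \<in> fixers"
    by (rule fixers_of_realizes[OF *(1) signed_perm_pushes[OF assms]]) (use *(2) in auto)
  then show ?thesis by (rule fixers_split_form)
qed

lemma A_aut_split_form: assumes "f \<in> A_aut n k" shows "f \<in> split_form"
  using A_aut_generated[OF assms]
proof (induction f rule: generate.induct)
  case one
  show ?case by (rule K0_split_form[OF K0.one_closed])
next
  case (incl h)
  then show ?case using transvection_split_form signed_perm_split_form by blast
next
  case (inv h)
  then show ?case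
    using transvection_split_form[OF transvections_inv] signed_perm_split_form[OF signed_perms_inv] by blast
next
  case (eng h1 h2)
  then show ?case using split_form_mult by blast
qed

text \<open>If \<open>\<kappa> \<sigma>\<close> is in the kernel then so is \<open>\<sigma>\<close>. But \<open>\<sigma>\<close> maps \<open>x\<^sub>i\<close> to a word in the \<open>x\<close> letters, which is
  not affected by killing the \<open>y\<^sub>j\<close>, so \<open>\<sigma>\<close> is the identity.\<close>

theorem K_aut_eq: "K_aut n k = K0"
proof
  show "K0 \<subseteq> K_aut n k" by (rule K0_K_aut)
  show "K_aut n k \<subseteq> K0"
  proof
    interpret K: subgroup "K_aut n k" "\<AA> S" by (rule subgroup_K_aut)
    fix f assume f: "f \<in> K_aut n k"
    then have "f \<in> split_form" using A_aut_split_form by (simp add: K_aut_iff)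
    then obtain \<kappa> \<sigma> where \<kappa>\<sigma>: "f = \<kappa> \<bullet> \<sigma>" "\<kappa> \<in> K0" "\<sigma> \<in> fixers"
      unfolding split_form_def by blast
    have c: "\<kappa> \<in> carrier (\<AA> S)" "\<sigma> \<in> carrier (\<AA> S)"
      using \<kappa>\<sigma> K0.mem_carrier by (auto simp: fixers_def A.pushing_def)
    have "\<sigma> = inv\<^bsub>\<AA> S\<^esub> \<kappa> \<bullet> f" unfolding \<kappa>\<sigma>(1) using c by (simp add: A.m_assoc[symmetric])
    moreover have "inv\<^bsub>\<AA> S\<^esub> \<kappa> \<in> K_aut n k" using \<kappa>\<sigma>(2) K0_K_aut by (intro K.m_inv_closed) blast
    ultimately have \<sigma>K: "\<sigma> \<in> K_aut n k" using f by simp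
    have "\<sigma> = \<one>\<^bsub>\<AA> S\<^esub>"
    proof (rule auto_eqI)
      show "\<sigma> \<in> auto (Fnk n k)" "\<one>\<^bsub>\<AA> S\<^esub> \<in> auto (Fnk n k)"
        using c A.one_closed unfolding carrier_AA by auto
      fix a assume a: "a \<in> S"
      then show "\<sigma> [(a, True)] = \<one>\<^bsub>\<AA> S\<^esub> [(a, True)]"
      proof (cases rule: gens_cases)
        case (X i)
        have "\<sigma> [(GX i, True)] = kill_y (\<sigma> [(GX i, True)])"
          using \<kappa>\<sigma>(3) X by (intro kill_y_id[of _ n, symmetric]) (simp add: fixers_def)
        also have "\<dots> = kill_y [(GX i, True)]" using \<sigma>K X unfolding K_aut_iff by simp
        finally show ?thesis using X by (simp add: one_AutoGroup)
      next
        case (Y j)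
        then show ?thesis using \<kappa>\<sigma>(3) by (simp add: fixers_def one_AutoGroup)
      qed
    qed
    then show "f \<in> K0" using \<kappa>\<sigma> c by simp
  qed
qed

end

section \<open>Exponent sums and second-order Magnus coefficients\<close>

definition letter_sign :: "'a \<times> bool \<Rightarrow> int" where
  "letter_sign p = (if snd p then 1 else -1)"

primrec expo :: "'a \<Rightarrow> 'a word \<Rightarrow> int" where
  "expo a [] = 0"
| "expo a (p # w) = (if fst p = a then letter_sign p else 0) + expo a w"

text \<open>The signed number of ways to choose an occurrence of \<open>a\<close> and a later occurrence of \<open>b\<close>. For \<open>a \<noteq> b\<close>
  this is the coefficient of \<open>X\<^sub>a X\<^sub>b\<close> in the Magnus expansion, which maps a generator to \<open>1 + X\<^sub>a\<close>.
  For \<open>a = b\<close> the two differ by the squares coming from the inverse letters, and only the Magnus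
  coefficient would be invariant under reduction.\<close>

primrec magnus :: "'a \<Rightarrow> 'a \<Rightarrow> 'a word \<Rightarrow> int" where
  "magnus a b [] = 0"
| "magnus a b (p # w) = (if fst p = a then letter_sign p * expo b w else 0) + magnus a b w"

lemma letter_sign_flip [simp]: "letter_sign (flip p) = - letter_sign p"
  by (simp add: letter_sign_def)

lemma expo_append [simp]: "expo a (u @ v) = expo a u + expo a v"
  by (induction u) auto

lemma expo_winv [simp]: "expo a (winv w) = - expo a w"
  by (induction w) (auto simp: winv_Cons)

lemma expo_cons_cancel: "expo a (cons_cancel p w) = expo a (p # w)"
  by (cases w) (auto simp: cons_cancel_eq)

lemma expo_reduce [simp]: "expo a (reduce w) = expo a w"
  by (induction w) (simp_all add: reduce_Cons expo_cons_cancel del: cons_cancel.simps)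

text \<open>The product rule for second-order coefficients; the mixed term vanishes on the commutator subgroup.\<close>

lemma magnus_append: "magnus a b (u @ v) = magnus a b u + magnus a b v + expo a u * expo b v"
  by (induction u) (auto simp: algebra_simps)

lemma magnus_reduce:
  assumes "a \<noteq> b" shows "magnus a b (reduce w) = magnus a b w"
proof (induction w)
  case (Cons p w)
  have "magnus a b (cons_cancel p v) = magnus a b (p # v)" for v
    by (cases v) (use assms in \<open>auto simp: cons_cancel_eq algebra_simps\<close>)
  then show ?case using Cons by (simp add: reduce_Cons)
qed simp

lemma magnus_winv:
  assumes "a \<noteq> b" shows "magnus a b (winv w) = expo a w * expo b w - magnus a b w"
proof -
  have "magnus a b (reduce (w @ winv w)) = 0" by simp
  then show ?thesis unfolding magnus_reduce[OF assms] by (simp add: magnus_append)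
qed

section \<open>Generalities on commutator subgroups\<close>

lemma commutator_eq_derived: "commutator G = derived G (carrier G)"
proof -
  have "{comm G a b | a b. a \<in> carrier G \<and> b \<in> carrier G} = derived_set G (carrier G)"
    unfolding comm_def by blast
  then show ?thesis unfolding commutator_def comm_subgroup_def derived_def by simp
qed

lemma (in group) commutator_normal: "commutator G \<lhd> G"
  unfolding commutator_eq_derived by (rule derived_is_normal[OF normal_self])

lemma (in group) abelianization_comm_group: "comm_group (abelianization G)"
  unfolding abelianization_def commutator_eq_derived by (rule derived_quot_is_comm_group)

lemma (in group) comm_closed [simp]: "a \<in> carrier G \<Longrightarrow> b \<in> carrier G \<Longrightarrow> comm G a b \<in> carrier G"
  by (simp add: comm_def)

lemma (in group) comm_in_commutator: "a \<in> carrier G \<Longrightarrow> b \<in> carrier G \<Longrightarrow> comm G a b \<in> commutator G"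
  unfolding commutator_def comm_subgroup_def by (intro generate.incl) blast

lemma (in group) rcos_eqI:
  assumes "subgroup H G" "x \<in> carrier G" "y \<in> carrier G" "x \<otimes> inv y \<in> H"
  shows "H #> x = H #> y"
proof -
  have "x = (x \<otimes> inv y) \<otimes> y" using assms by (simp add: m_assoc)
  then have "x \<in> H #> y" using assms(4) unfolding r_coset_def by blast
  then show ?thesis using repr_independence[OF _ assms(3,1)] by blast
qed

lemma (in group) rcos_eqD:
  assumes "subgroup H G" "x \<in> carrier G" "y \<in> carrier G" "H #> x = H #> y"
  shows "x \<otimes> inv y \<in> H"
proof -
  have "x \<in> H #> y" using rcos_self[OF assms(2,1)] assms(4) by simp
  then obtain h where h: "h \<in> H" "x = h \<otimes> y" unfolding r_coset_def by blast
  then have "x \<otimes> inv y = h" using assms subgroup.mem_carrier[OF assms(1)] by (simp add: m_assoc)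
  then show ?thesis using h by simp
qed

lemma (in group) hom_eq_on_generate:
  assumes T: "T \<subseteq> carrier G" and H: "group H"
    and p: "p \<in> hom (G\<lparr>carrier := generate G T\<rparr>) H" and q: "q \<in> hom (G\<lparr>carrier := generate G T\<rparr>) H"
    and eq: "\<And>t. t \<in> T \<Longrightarrow> p t = q t" and z: "z \<in> generate G T"
  shows "p z = q z"
proof -
  let ?D = "G\<lparr>carrier := generate G T\<rparr>"
  have sub: "subgroup (generate G T) G" by (rule generate_is_subgroup[OF T])
  have D: "group ?D" by (rule subgroup_imp_group[OF sub])
  interpret p: group_hom ?D H p by (intro group_hom.intro group_hom_axioms.intro D H p)
  interpret q: group_hom ?D H q by (intro group_hom.intro group_hom_axioms.intro D H q)
  show ?thesis using z
  proof (induction z rule: generate.induct)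
    case one
    then show ?case using p.hom_one q.hom_one by simp
  next
    case (incl h)
    then show ?case using eq by simp
  next
    case (inv h)
    have h: "h \<in> generate G T" using inv by (rule generate.incl)
    have "p (inv\<^bsub>?D\<^esub> h) = q (inv\<^bsub>?D\<^esub> h)"
      using p.hom_inv[of h] q.hom_inv[of h] h eq[OF inv] by simp
    then show ?case using m_inv_consistent[OF sub h] by simp
  next
    case (eng h1 h2)
    then show ?case using p.hom_mult[of h1 h2] q.hom_mult[of h1 h2] by simp
  qed
qed

lemma (in group) commutator_hom_eq:
  assumes H: "group H"
    and p: "p \<in> hom (G\<lparr>carrier := commutator G\<rparr>) H" and q: "q \<in> hom (G\<lparr>carrier := commutator G\<rparr>) H"
    and eq: "\<And>a b. a \<in> carrier G \<Longrightarrow> b \<in> carrier G \<Longrightarrow> p (comm G a b) = q (comm G a b)"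
    and z: "z \<in> commutator G"
  shows "p z = q z"
  by (rule hom_eq_on_generate[of "{comm G a b | a b. a \<in> carrier G \<and> b \<in> carrier G}" H p q])
     (use assms in \<open>auto simp: commutator_def comm_subgroup_def\<close>)

text \<open>Stated for arbitrary maps to abelian groups, this makes exponent sums, Magnus coordinates and the
  Johnson homomorphism factor through abelianizations.\<close>

lemma (in group) hom_commutator_one:
  assumes H: "comm_group H" and h: "h \<in> hom G H" and z: "z \<in> commutator G"
  shows "h z = \<one>\<^bsub>H\<^esub>"
proof -
  interpret H: comm_group H by (rule H)
  interpret h: group_hom G H h by (intro group_hom.intro group_hom_axioms.intro H.group_axioms group_axioms h)
  have "commutator G \<subseteq> kernel G H h"
    unfolding commutator_def comm_subgroup_def
  proof (rule generate_subgroup_incl[OF _ h.subgroup_kernel], safe)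
    fix a b assume ab: "a \<in> carrier G" "b \<in> carrier G"
    then have "h (comm G a b) = h a \<otimes>\<^bsub>H\<^esub> h b \<otimes>\<^bsub>H\<^esub> inv\<^bsub>H\<^esub> (h a) \<otimes>\<^bsub>H\<^esub> inv\<^bsub>H\<^esub> (h b)"
      by (simp add: comm_def)
    also have "\<dots> = (h a \<otimes>\<^bsub>H\<^esub> inv\<^bsub>H\<^esub> (h a)) \<otimes>\<^bsub>H\<^esub> (h b \<otimes>\<^bsub>H\<^esub> inv\<^bsub>H\<^esub> (h b))"
      using ab by (simp only: H.m_ac h.hom_closed H.inv_closed H.m_closed)
    also have "\<dots> = \<one>\<^bsub>H\<^esub>" using ab by simp
    finally show "comm G a b \<in> kernel G H h" using ab by (simp add: kernel_def)
  qed
  then show ?thesis using z by (auto simp: kernel_def)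
qed

lemma (in group) ab_class_mult:
  "z \<in> carrier G \<Longrightarrow> w \<in> carrier G \<Longrightarrow> ab_class G (z \<otimes> w) = ab_class G z \<otimes>\<^bsub>abelianization G\<^esub> ab_class G w"
  using normal.rcos_sum[OF commutator_normal] by (simp add: ab_class_def abelianization_def)

lemma (in group) ab_class_closed: "z \<in> carrier G \<Longrightarrow> ab_class G z \<in> carrier (abelianization G)"
  by (auto simp: ab_class_def abelianization_def carrier_FactGroup)

lemma (in group) ab_class_surj: "C \<in> carrier (abelianization G) \<Longrightarrow> \<exists>z\<in>carrier G. C = ab_class G z"
  by (auto simp: ab_class_def abelianization_def carrier_FactGroup)

lemma (in group) ab_class_hom: "ab_class G \<in> hom G (abelianization G)"
  by (rule homI) (simp_all add: ab_class_closed ab_class_mult)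

lemma (in group) ab_class_eq_iff:
  "x \<in> carrier G \<Longrightarrow> y \<in> carrier G \<Longrightarrow> ab_class G x = ab_class G y \<longleftrightarrow> x \<otimes> inv y \<in> commutator G"
  unfolding ab_class_def
  using rcos_eqI rcos_eqD normal_imp_subgroup[OF commutator_normal] by blast

lemma (in group) third_term_normal:
  "comm_subgroup G (carrier G) (commutator G) \<lhd> G"
  unfolding comm_subgroup_def
proof (rule normal_generateI)
  interpret C: normal "commutator G" G by (rule commutator_normal)
  show "{comm G a b |a b. a \<in> carrier G \<and> b \<in> commutator G} \<subseteq> carrier G"
    using C.subset by auto
  fix h g assume "h \<in> {comm G a b |a b. a \<in> carrier G \<and> b \<in> commutator G}" and g: "g \<in> carrier G"
  then obtain a b where ab: "h = comm G a b" "a \<in> carrier G" "b \<in> commutator G" by blast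
  have b: "b \<in> carrier G" using ab(3) C.subset by blast
  have "inv g \<otimes> (g \<otimes> x) = x" if "x \<in> carrier G" for x using that g by (simp add: m_assoc[symmetric])
  then have "g \<otimes> h \<otimes> inv g = comm G (g \<otimes> a \<otimes> inv g) (g \<otimes> b \<otimes> inv g)"
    unfolding ab(1) comm_def using g ab(2) b by (simp add: inv_mult_group m_assoc)
  moreover have "g \<otimes> b \<otimes> inv g \<in> commutator G" using C.inv_op_closed2 g ab(3) by blast
  ultimately show "g \<otimes> h \<otimes> inv g \<in> {comm G a b |a b. a \<in> carrier G \<and> b \<in> commutator G}"
    using g ab(2) by blast
qed

lemma (in group) third_term_subset:
  "comm_subgroup G (carrier G) (commutator G) \<subseteq> commutator G"
  unfolding comm_subgroup_def
proof (rule generate_subgroup_incl)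
  show sub: "subgroup (commutator G) G" by (rule normal_imp_subgroup[OF commutator_normal])
  show "{comm G a b |a b. a \<in> carrier G \<and> b \<in> commutator G} \<subseteq> commutator G"
    by (auto intro: comm_in_commutator subgroup.mem_carrier[OF sub])
qed

section \<open>Alternating bilinear maps on a free group\<close>

text \<open>Any injection into the natural numbers would do; it selects one ordering of each pair of generators.\<close>

definition gen_index :: "gen \<Rightarrow> nat" where
  "gen_index a = letter_code (a, True)"

lemma gen_index_inj: "gen_index a = gen_index b \<Longrightarrow> a = b"
  unfolding gen_index_def by (drule letter_code_inj) simp

context free_factor
begin

abbreviation "F \<equiv> Fnk n k"

definition "pairs = {(a, b) \<in> S \<times> S. gen_index a < gen_index b}"

lemma finite_pairs [simp]: "finite pairs"
  unfolding pairs_def by (rule finite_subset[of _ "S \<times> S"]) auto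

lemma pairs_neq: "(a, b) \<in> pairs \<Longrightarrow> a \<noteq> b"
  by (auto simp: pairs_def)

sublocale F: group F by (rule group_free_group)

definition pair_product ::
  "('c, 'd) monoid_scheme \<Rightarrow> (gen word \<Rightarrow> gen word \<Rightarrow> 'c) \<Rightarrow> (gen \<Rightarrow> gen \<Rightarrow> int) \<Rightarrow> 'c" where
  "pair_product C p c = finprod C (\<lambda>(a, b). p [(a, True)] [(b, True)] [^]\<^bsub>C\<^esub> c a b) pairs"

end

locale alternating_map = free_factor n k + C: comm_group C
  for n k :: nat and C :: "('c, 'd) monoid_scheme" (structure) +
  fixes p :: "gen word \<Rightarrow> gen word \<Rightarrow> 'c"
  assumes p_closed: "z \<in> carrier F \<Longrightarrow> w \<in> carrier F \<Longrightarrow> p z w \<in> carrier C"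
    and p_left: "z \<in> carrier F \<Longrightarrow> z' \<in> carrier F \<Longrightarrow> w \<in> carrier F \<Longrightarrow> p (reduce (z @ z')) w = p z w \<otimes>\<^bsub>C\<^esub> p z' w"
    and p_right: "z \<in> carrier F \<Longrightarrow> w \<in> carrier F \<Longrightarrow> w' \<in> carrier F \<Longrightarrow> p z (reduce (w @ w')) = p z w \<otimes>\<^bsub>C\<^esub> p z w'"
    and p_alt: "z \<in> carrier F \<Longrightarrow> p z z = \<one>\<^bsub>C\<^esub>"
begin

abbreviation "Pr \<equiv> pair_product C p"

lemma Pr_factor_closed: "(\<lambda>(a, b). p [(a, True)] [(b, True)] [^]\<^bsub>C\<^esub> (c a b :: int)) \<in> pairs \<rightarrow> carrier C"
  by (auto simp: pairs_def p_closed)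

lemma Pr_closed: "Pr c \<in> carrier C"
  unfolding pair_product_def by (rule C.finprod_closed[OF Pr_factor_closed])

lemma Pr_add: "Pr (\<lambda>a b. c a b + d a b) = Pr c \<otimes>\<^bsub>C\<^esub> Pr d"
proof -
  have "Pr (\<lambda>a b. c a b + d a b) = finprod C (\<lambda>x. (case x of (a, b) \<Rightarrow> p [(a, True)] [(b, True)] [^]\<^bsub>C\<^esub> c a b)
      \<otimes>\<^bsub>C\<^esub> (case x of (a, b) \<Rightarrow> p [(a, True)] [(b, True)] [^]\<^bsub>C\<^esub> d a b)) pairs"
    unfolding pair_product_def
    by (rule C.finprod_cong') (auto simp: pairs_def p_closed C.int_pow_mult)
  also have "\<dots> = Pr c \<otimes>\<^bsub>C\<^esub> Pr d"
    unfolding pair_product_def by (rule C.finprod_multf[OF Pr_factor_closed Pr_factor_closed])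
  finally show ?thesis .
qed

lemma Pr_zero: "(\<And>a b. (a, b) \<in> pairs \<Longrightarrow> c a b = 0) \<Longrightarrow> Pr c = \<one>\<^bsub>C\<^esub>"
  unfolding pair_product_def by (rule C.finprod_one_eqI) auto

lemma Pr_cong: "(\<And>a b. (a, b) \<in> pairs \<Longrightarrow> c a b = d a b) \<Longrightarrow> Pr c = Pr d"
  unfolding pair_product_def by (rule C.finprod_cong') (auto simp: pairs_def p_closed)

lemma Pr_single:
  assumes "(a, b) \<in> pairs" "\<And>x y. (x, y) \<in> pairs \<Longrightarrow> (x, y) \<noteq> (a, b) \<Longrightarrow> c x y = 0"
  shows "Pr c = p [(a, True)] [(b, True)] [^]\<^bsub>C\<^esub> c a b"
proof -
  have "Pr c = finprod C (\<lambda>(a, b). p [(a, True)] [(b, True)] [^]\<^bsub>C\<^esub> c a b) {(a, b)}"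
    unfolding pair_product_def
  proof (rule C.finprod_mono_neutral_cong_right[OF finite_pairs _ _ _ Pr_factor_closed])
    show "{(a, b)} \<subseteq> pairs" using assms(1) by simp
    show "(case i of (a, b) \<Rightarrow> p [(a, True)] [(b, True)] [^]\<^bsub>C\<^esub> c a b) = \<one>\<^bsub>C\<^esub>" if "i \<in> pairs - {(a, b)}" for i
      using that assms(2) by (cases i) auto
  qed simp
  also have "\<dots> = p [(a, True)] [(b, True)] [^]\<^bsub>C\<^esub> c a b"
    using assms(1) by (subst C.finprod_insert) (auto simp: pairs_def p_closed)
  finally show ?thesis .
qed

lemma p_hom_left: "w \<in> carrier F \<Longrightarrow> (\<lambda>z. p z w) \<in> hom F C"
  by (rule homI) (simp_all add: p_closed p_left)

lemma p_hom_right: "z \<in> carrier F \<Longrightarrow> p z \<in> hom F C"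
  by (rule homI) (simp_all add: p_closed p_right)

lemma p_antisym:
  assumes "z \<in> carrier F" "w \<in> carrier F" shows "p w z = inv\<^bsub>C\<^esub> (p z w)"
proof -
  have c: "reduce (z @ w) \<in> carrier F" using assms by (rule reduce_append_closed)
  have "\<one>\<^bsub>C\<^esub> = p (reduce (z @ w)) (reduce (z @ w))" using p_alt[OF c] by simp
  also have "\<dots> = p z (reduce (z @ w)) \<otimes>\<^bsub>C\<^esub> p w (reduce (z @ w))"
    by (rule p_left[OF assms c])
  also have "\<dots> = p z w \<otimes>\<^bsub>C\<^esub> p w z"
    using assms by (simp add: p_right p_alt p_closed)
  finally have "p w z \<otimes>\<^bsub>C\<^esub> p z w = \<one>\<^bsub>C\<^esub>"
    using assms by (metis C.m_comm p_closed)
  then show ?thesis using assms by (intro C.inv_equality[symmetric]) (auto simp: p_closed)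
qed

text \<open>Both sides are homomorphisms in each variable, so it suffices to compare them on generators, where
  the exponent is \<open>1\<close>, \<open>-1\<close> or \<open>0\<close>.\<close>

lemma alternating_expansion:
  assumes z: "z \<in> carrier F" and w: "w \<in> carrier F"
  shows "p z w = Pr (\<lambda>a b. expo a z * expo b w - expo b z * expo a w)"
proof -
  define q where "q z w = Pr (\<lambda>a b. expo a z * expo b w - expo b z * expo a w)" for z w
  have q_left: "(\<lambda>z. q z w) \<in> hom F C" for w
  proof (rule homI)
    fix x y assume "x \<in> carrier F" "y \<in> carrier F"
    show "q (x \<otimes>\<^bsub>F\<^esub> y) w = q x w \<otimes>\<^bsub>C\<^esub> q y w"
      unfolding q_def Pr_add[symmetric] by (rule Pr_cong) (simp add: algebra_simps)
  qed (simp add: q_def Pr_closed)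
  have q_right: "q z \<in> hom F C" for z
  proof (rule homI)
    fix x y assume "x \<in> carrier F" "y \<in> carrier F"
    show "q z (x \<otimes>\<^bsub>F\<^esub> y) = q z x \<otimes>\<^bsub>C\<^esub> q z y"
      unfolding q_def Pr_add[symmetric] by (rule Pr_cong) (simp add: algebra_simps)
  qed (simp add: q_def Pr_closed)
  have gens: "p [(a, True)] [(b, True)] = q [(a, True)] [(b, True)]" if ab: "a \<in> S" "b \<in> S" for a b
  proof -
    consider "a = b" | "gen_index a < gen_index b" | "gen_index b < gen_index a"
      using gen_index_inj[of a b] by linarith
    then show ?thesis
    proof cases
      case 1
      then show ?thesis using ab p_alt[of "[(a, True)]"] unfolding q_def by (subst Pr_zero) auto
    next
      case 2
      then have "(a, b) \<in> pairs" "a \<noteq> b" using ab by (auto simp: pairs_def)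
      then have "q [(a, True)] [(b, True)] = p [(a, True)] [(b, True)] [^]\<^bsub>C\<^esub> (1 :: int)"
        unfolding q_def by (subst Pr_single[of a b]) (auto simp: letter_sign_def pairs_def)
      then show ?thesis using ab by (simp add: p_closed)
    next
      case 3
      then have "(b, a) \<in> pairs" "a \<noteq> b" using ab by (auto simp: pairs_def)
      then have "q [(a, True)] [(b, True)] = p [(b, True)] [(a, True)] [^]\<^bsub>C\<^esub> (- 1 :: int)"
        unfolding q_def by (subst Pr_single[of b a]) (auto simp: letter_sign_def pairs_def)
      also have "\<dots> = inv\<^bsub>C\<^esub> (p [(b, True)] [(a, True)])"
        using ab by (simp add: p_closed C.int_pow_neg)
      also have "\<dots> = p [(a, True)] [(b, True)]" using ab by (intro p_antisym[symmetric]) auto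
      finally show ?thesis by simp
    qed
  qed
  have 1: "p [(a, True)] w = q [(a, True)] w" if "a \<in> S" for a
    using free_group_hom_eqI[OF C.group_axioms p_hom_right q_right gens[OF that] w] that by simp
  have "p z w = q z w"
    by (rule free_group_hom_eqI[OF C.group_axioms p_hom_left[OF w] q_left _ z]) (rule 1)
  then show ?thesis by (simp add: q_def)
qed

end

context free_factor
begin

abbreviation "\<gamma>2 \<equiv> commutator F"
abbreviation "\<gamma>3 \<equiv> comm_subgroup F (carrier F) (commutator F)"
abbreviation "D \<equiv> F\<lparr>carrier := commutator F\<rparr>"

lemma subgroup_\<gamma>2: "subgroup \<gamma>2 F"
  by (rule normal_imp_subgroup[OF F.commutator_normal])

lemma \<gamma>2_carrier: "z \<in> \<gamma>2 \<Longrightarrow> z \<in> carrier F"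
  using subgroup.mem_carrier[OF subgroup_\<gamma>2] .

sublocale D: group D by (rule F.subgroup_imp_group[OF subgroup_\<gamma>2])

lemma F_comm: "z \<in> carrier F \<Longrightarrow> w \<in> carrier F \<Longrightarrow> comm F z w = reduce (z @ w @ winv z @ winv w)"
  by (simp add: comm_def inv_free_group)

lemma expo_hom: "expo a \<in> hom F integer_group"
  by (rule homI) simp_all

lemma expo_\<gamma>2: "z \<in> \<gamma>2 \<Longrightarrow> expo a z = 0"
  using F.hom_commutator_one[OF abelian_integer_group expo_hom] by simp

lemma magnus_comm:
  assumes "a \<noteq> b" "z \<in> carrier F" "w \<in> carrier F"
  shows "magnus a b (comm F z w) = expo a z * expo b w - expo b z * expo a w"
  using assms by (simp add: F_comm magnus_reduce magnus_append magnus_winv algebra_simps)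

lemma magnus_hom: "a \<noteq> b \<Longrightarrow> magnus a b \<in> hom D integer_group"
  by (rule homI) (simp_all add: magnus_reduce magnus_append expo_\<gamma>2)

end

context alternating_map
begin

text \<open>On commutators \<open>[z, w]\<close> the Magnus coefficients are the determinants in the expansion of \<open>p z w\<close>. So
  this homomorphism on the commutator subgroup is the one with \<open>[z, w] \<mapsto> p z w\<close>.\<close>

definition "extension z = Pr (\<lambda>a b. magnus a b z)"

lemma extension_hom: "extension \<in> hom D C"
proof (rule homI)
  fix x y assume "x \<in> carrier D" "y \<in> carrier D"
  then show "extension (x \<otimes>\<^bsub>D\<^esub> y) = extension x \<otimes>\<^bsub>C\<^esub> extension y"
    unfolding extension_def Pr_add[symmetric]
    by (intro Pr_cong) (simp add: magnus_reduce[OF pairs_neq] magnus_append expo_\<gamma>2)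
qed (simp add: extension_def Pr_closed)

lemma extension_comm: "z \<in> carrier F \<Longrightarrow> w \<in> carrier F \<Longrightarrow> extension (comm F z w) = p z w"
  unfolding extension_def alternating_expansion
  by (rule Pr_cong) (simp add: magnus_comm[OF pairs_neq])

end

section \<open>Generators of free abelian groups\<close>

lemma free_Abelian_group_generated:
  "generate (free_Abelian_group S) (frag_of ` S) = carrier (free_Abelian_group S)"
proof
  interpret Z: group "free_Abelian_group S" by (rule group_free_Abelian_group)
  have sub: "frag_of ` S \<subseteq> carrier (free_Abelian_group S)" by auto
  show "generate (free_Abelian_group S) (frag_of ` S) \<subseteq> carrier (free_Abelian_group S)"
    by (rule Z.generate_incl[OF sub])
  have H: "subgroup (generate (free_Abelian_group S) (frag_of ` S)) (free_Abelian_group S)"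
    by (rule Z.generate_is_subgroup[OF sub])
  show "carrier (free_Abelian_group S) \<subseteq> generate (free_Abelian_group S) (frag_of ` S)"
  proof
    fix x assume "x \<in> carrier (free_Abelian_group S)"
    then have "Poly_Mapping.keys x \<subseteq> S" by simp
    then show "x \<in> generate (free_Abelian_group S) (frag_of ` S)"
    proof (rule free_Abelian_group_induct)
      show "0 \<in> generate (free_Abelian_group S) (frag_of ` S)"
        using subgroup.one_closed[OF H] by simp
      show "u - v \<in> generate (free_Abelian_group S) (frag_of ` S)"
        if "Poly_Mapping.keys v \<subseteq> S" "u \<in> generate (free_Abelian_group S) (frag_of ` S)"
          "v \<in> generate (free_Abelian_group S) (frag_of ` S)" for u v
        using subgroup.m_closed[OF H that(2) subgroup.m_inv_closed[OF H that(3)]] that(1) by simp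
    qed (blast intro: generate.incl)
  qed
qed

lemma free_Abelian_group_hom_eqI:
  assumes "group H" "p \<in> hom (free_Abelian_group S) H" "q \<in> hom (free_Abelian_group S) H"
    and eq: "\<And>a. a \<in> S \<Longrightarrow> p (frag_of a) = q (frag_of a)" and x: "x \<in> carrier (free_Abelian_group S)"
  shows "p x = q x"
proof -
  have "free_Abelian_group S\<lparr>carrier := generate (free_Abelian_group S) (frag_of ` S)\<rparr> = free_Abelian_group S"
    by (simp add: free_Abelian_group_generated)
  then show ?thesis
    using assms by (intro group.hom_eq_on_generate[OF group_free_Abelian_group, of "frag_of ` S" S H p q x])
      (auto simp: free_Abelian_group_generated)
qed

section \<open>The exterior square\<close>

lemma wedge_relators_carrier:
  assumes "group A"
  shows "wedge_relators A \<subseteq> carrier (free_Abelian_group (carrier A \<times> carrier A))"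
proof -
  interpret group A by fact
  show ?thesis
    unfolding wedge_relators_def
    by (auto dest!: keys_diff[THEN subsetD])
qed

lemma subgroup_wedge_null:
  "group A \<Longrightarrow> subgroup (wedge_null A) (free_Abelian_group (carrier A \<times> carrier A))"
  unfolding wedge_null_def
  by (rule group.generate_is_subgroup[OF group_free_Abelian_group wedge_relators_carrier])

lemma normal_wedge_null:
  "group A \<Longrightarrow> wedge_null A \<lhd> free_Abelian_group (carrier A \<times> carrier A)"
  using comm_group.subgroup_imp_normal[OF abelian_free_Abelian_group subgroup_wedge_null] .

lemma exterior_square_comm_group: "group A \<Longrightarrow> comm_group (exterior_square A)"
  unfolding exterior_square_def
  by (rule comm_group.abelian_FactGroup[OF abelian_free_Abelian_group subgroup_wedge_null])

lemma wedge_closed: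
  "a \<in> carrier A \<Longrightarrow> b \<in> carrier A \<Longrightarrow> wedge A a b \<in> carrier (exterior_square A)"
  unfolding exterior_square_def wedge_def carrier_FactGroup by (intro imageI) simp

lemma wedge_null_coset_eq:
  assumes "group A" "Poly_Mapping.keys x \<subseteq> carrier A \<times> carrier A" "Poly_Mapping.keys y \<subseteq> carrier A \<times> carrier A"
    "x - y \<in> wedge_null A"
  shows "wedge_null A #>\<^bsub>free_Abelian_group (carrier A \<times> carrier A)\<^esub> x
    = wedge_null A #>\<^bsub>free_Abelian_group (carrier A \<times> carrier A)\<^esub> y"
  by (rule group.rcos_eqI[OF group_free_Abelian_group subgroup_wedge_null[OF assms(1)]]) (use assms in simp_all)

lemma wedge_left:
  assumes A: "group A" and abc: "a \<in> carrier A" "b \<in> carrier A" "c \<in> carrier A"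
  shows "wedge A (a \<otimes>\<^bsub>A\<^esub> b) c = wedge A a c \<otimes>\<^bsub>exterior_square A\<^esub> wedge A b c"
proof -
  interpret A: group A by (rule A)
  let ?Z = "free_Abelian_group (carrier A \<times> carrier A)"
  have "frag_of (a \<otimes>\<^bsub>A\<^esub> b, c) - frag_of (a, c) - frag_of (b, c) \<in> wedge_relators A"
    unfolding wedge_relators_def using abc by blast
  then have "frag_of (a \<otimes>\<^bsub>A\<^esub> b, c) - frag_of (a, c) - frag_of (b, c) \<in> wedge_null A"
    unfolding wedge_null_def by (rule generate.incl)
  then have "wedge A (a \<otimes>\<^bsub>A\<^esub> b) c = wedge_null A #>\<^bsub>?Z\<^esub> (frag_of (a, c) + frag_of (b, c))"
    unfolding wedge_def using abc keys_add[of "frag_of (a, c)" "frag_of (b, c)"]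
    by (intro wedge_null_coset_eq[OF A]) (auto simp: algebra_simps)
  also have "\<dots> = wedge A a c \<otimes>\<^bsub>exterior_square A\<^esub> wedge A b c"
    unfolding exterior_square_def wedge_def
    using normal.rcos_sum[OF normal_wedge_null[OF A], of "frag_of (a, c)" "frag_of (b, c)"] abc by simp
  finally show ?thesis .
qed

lemma wedge_right:
  assumes A: "group A" and abc: "a \<in> carrier A" "b \<in> carrier A" "c \<in> carrier A"
  shows "wedge A a (b \<otimes>\<^bsub>A\<^esub> c) = wedge A a b \<otimes>\<^bsub>exterior_square A\<^esub> wedge A a c"
proof -
  interpret A: group A by (rule A)
  let ?Z = "free_Abelian_group (carrier A \<times> carrier A)"
  have "frag_of (a, b \<otimes>\<^bsub>A\<^esub> c) - frag_of (a, b) - frag_of (a, c) \<in> wedge_relators A"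
    unfolding wedge_relators_def using abc by blast
  then have "frag_of (a, b \<otimes>\<^bsub>A\<^esub> c) - frag_of (a, b) - frag_of (a, c) \<in> wedge_null A"
    unfolding wedge_null_def by (rule generate.incl)
  then have "wedge A a (b \<otimes>\<^bsub>A\<^esub> c) = wedge_null A #>\<^bsub>?Z\<^esub> (frag_of (a, b) + frag_of (a, c))"
    unfolding wedge_def using abc keys_add[of "frag_of (a, b)" "frag_of (a, c)"]
    by (intro wedge_null_coset_eq[OF A]) (auto simp: algebra_simps)
  also have "\<dots> = wedge A a b \<otimes>\<^bsub>exterior_square A\<^esub> wedge A a c"
    unfolding exterior_square_def wedge_def
    using normal.rcos_sum[OF normal_wedge_null[OF A], of "frag_of (a, b)" "frag_of (a, c)"] abc by simp
  finally show ?thesis .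
qed

lemma wedge_self:
  assumes A: "group A" and a: "a \<in> carrier A"
  shows "wedge A a a = \<one>\<^bsub>exterior_square A\<^esub>"
proof -
  have "frag_of (a, a) \<in> wedge_null A"
    unfolding wedge_null_def wedge_relators_def using a by (intro generate.incl) blast
  then show ?thesis
    unfolding wedge_def exterior_square_def one_FactGroup
    using group.coset_join2[OF group_free_Abelian_group _ subgroup_wedge_null[OF A]] a by simp
qed

text \<open>The exterior square is generated by the classes of pairs.\<close>

lemma exterior_square_induct:
  assumes A: "group A" and U: "U \<in> carrier (exterior_square A)" and H: "subgroup H (exterior_square A)"
    and wedge: "\<And>a b. a \<in> carrier A \<Longrightarrow> b \<in> carrier A \<Longrightarrow> wedge A a b \<in> H"
  shows "U \<in> H"
proof -
  let ?Z = "free_Abelian_group (carrier A \<times> carrier A)"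
  let ?q = "\<lambda>x. wedge_null A #>\<^bsub>?Z\<^esub> x"
  interpret N: normal "wedge_null A" ?Z by (rule normal_wedge_null[OF A])
  interpret q: group_hom ?Z "exterior_square A" ?q
    unfolding exterior_square_def
    by (intro group_hom.intro group_hom_axioms.intro group_free_Abelian_group
        N.factorgroup_is_group N.r_coset_hom_Mod)
  have "carrier (exterior_square A) = ?q ` generate ?Z (frag_of ` (carrier A \<times> carrier A))"
    unfolding free_Abelian_group_generated exterior_square_def by (simp add: carrier_FactGroup)
  also have "\<dots> = generate (exterior_square A) (?q ` frag_of ` (carrier A \<times> carrier A))"
    by (rule q.generate_img[symmetric]) auto
  also have "\<dots> \<subseteq> H"
    by (rule q.H.generate_subgroup_incl[OF _ H]) (use wedge in \<open>auto simp: wedge_def\<close>)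
  finally show ?thesis using U by blast
qed

section \<open>The projection onto the exterior square\<close>

context free_factor
begin

abbreviation "Ab \<equiv> abelianization F"

lemma Ab_comm_group: "comm_group Ab"
  by (rule F.abelianization_comm_group)

lemma Ab_group: "group Ab"
  using Ab_comm_group by (simp add: comm_group_def)

lemma wedge_alternating:
  "alternating_map n k (ext2 n k) (\<lambda>z w. wedge Ab (ab_class F z) (ab_class F w))"
proof (intro alternating_map.intro alternating_map_axioms.intro)
  show "comm_group (ext2 n k)" by (rule exterior_square_comm_group[OF Ab_group])
  fix z w assume z: "z \<in> carrier F" and w: "w \<in> carrier F"
  show "wedge Ab (ab_class F z) (ab_class F w) \<in> carrier (ext2 n k)"
    using z w by (intro wedge_closed F.ab_class_closed)
  show "wedge Ab (ab_class F z) (ab_class F z) = \<one>\<^bsub>ext2 n k\<^esub>"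
    using z by (intro wedge_self Ab_group F.ab_class_closed)
  fix v assume v: "v \<in> carrier F"
  show "wedge Ab (ab_class F (reduce (z @ w))) (ab_class F v)
      = wedge Ab (ab_class F z) (ab_class F v) \<otimes>\<^bsub>ext2 n k\<^esub> wedge Ab (ab_class F w) (ab_class F v)"
    using F.ab_class_mult[OF z w] z w v by (simp add: wedge_left Ab_group F.ab_class_closed)
  show "wedge Ab (ab_class F z) (ab_class F (reduce (w @ v)))
      = wedge Ab (ab_class F z) (ab_class F w) \<otimes>\<^bsub>ext2 n k\<^esub> wedge Ab (ab_class F z) (ab_class F v)"
    using F.ab_class_mult[OF w v] z w v by (simp add: wedge_right Ab_group F.ab_class_closed)
qed

interpretation W: alternating_map n k "ext2 n k" "\<lambda>z w. wedge Ab (ab_class F z) (ab_class F w)"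
  by (rule wedge_alternating)

text \<open>The projection \<open>\<pi>\<close>, by its formula in terms of Magnus coefficients. The product ranges over pairs of
  generators \<open>a\<close>, \<open>b\<close> and has the factors \<open>(a \<and> b)\<close> raised to the coefficient.\<close>

definition "ext_proj = restrict (pair_product (ext2 n k) (\<lambda>z w. wedge Ab (ab_class F z) (ab_class F w)) \<circ>
  (\<lambda>z a b. magnus a b z)) \<gamma>2"

lemma ext_proj_eq: "z \<in> \<gamma>2 \<Longrightarrow> ext_proj z = W.extension z"
  by (simp add: ext_proj_def W.extension_def)

lemma ext_proj_hom: "ext_proj \<in> hom D (ext2 n k)"
  using W.extension_hom D.m_closed ext_proj_eq by (auto simp: hom_def Pi_iff)

lemma ext_proj_comm:
  "z \<in> carrier F \<Longrightarrow> w \<in> carrier F \<Longrightarrow> ext_proj (comm F z w) = wedge Ab (ab_class F z) (ab_class F w)"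
  by (simp add: ext_proj_eq F.comm_in_commutator W.extension_comm)

text \<open>Exponent sums vanish on commutators, so the choice of a representative does not matter.\<close>

definition "class_expo a C = expo a (SOME z. z \<in> carrier F \<and> C = ab_class F z)"

lemma class_expo_ab_class: assumes z: "z \<in> carrier F" shows "class_expo a (ab_class F z) = expo a z"
proof -
  define w where "w = (SOME w. w \<in> carrier F \<and> ab_class F z = ab_class F w)"
  have w: "w \<in> carrier F" "ab_class F z = ab_class F w"
    using someI[of "\<lambda>w. w \<in> carrier F \<and> ab_class F z = ab_class F w" z] z unfolding w_def by auto
  then have "z \<otimes>\<^bsub>F\<^esub> inv\<^bsub>F\<^esub> w \<in> \<gamma>2" using F.ab_class_eq_iff z by blast
  then have "expo a (z \<otimes>\<^bsub>F\<^esub> inv\<^bsub>F\<^esub> w) = 0" by (rule expo_\<gamma>2)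
  then show ?thesis using w(1) by (simp add: inv_free_group class_expo_def w_def)
qed

text \<open>The determinant of exponent sums is alternating and bilinear on the abelianization, so it induces
  a homomorphism on the exterior square. Composed with the projection it agrees with the Magnus
  coefficient on commutators, hence everywhere.\<close>

lemma ext_coordinate:
  assumes ab: "a \<noteq> b"
  obtains g where "g \<in> hom (ext2 n k) integer_group" "\<And>z. z \<in> \<gamma>2 \<Longrightarrow> g (ext_proj z) = magnus a b z"
proof -
  let ?Z = "free_Abelian_group (carrier Ab \<times> carrier Ab)"
  define c where "c = (\<lambda>(C, C'). class_expo a C * class_expo b C' - class_expo b C * class_expo a C')"
  obtain h where h: "h \<in> hom ?Z integer_group" "\<And>x. x \<in> carrier Ab \<times> carrier Ab \<Longrightarrow> h (frag_of x) = c x"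
    using comm_group.free_Abelian_group_universal[OF abelian_integer_group, of c "carrier Ab \<times> carrier Ab"] by auto
  interpret h: group_hom ?Z integer_group h
    by (intro group_hom.intro group_hom_axioms.intro h(1)) simp_all
  have add: "class_expo d (C \<otimes>\<^bsub>Ab\<^esub> C') = class_expo d C + class_expo d C'"
    if C: "C \<in> carrier Ab" "C' \<in> carrier Ab" for d C C'
  proof -
    obtain z w where zw: "z \<in> carrier F" "C = ab_class F z" "w \<in> carrier F" "C' = ab_class F w"
      using F.ab_class_surj C by metis
    then have "C \<otimes>\<^bsub>Ab\<^esub> C' = ab_class F (z \<otimes>\<^bsub>F\<^esub> w)" by (simp only: F.ab_class_mult)
    then show ?thesis using zw by (simp only: class_expo_ab_class F.m_closed) simp
  qed
  interpret Ab: group Ab by (rule Ab_group)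
  have diff: "h (x - y) = h x - h y" if "x \<in> carrier ?Z" "y \<in> carrier ?Z" for x y
    using h.hom_mult[of x "- y"] h.hom_inv[of y] that by (simp add: keys_minus)
  have cl: "frag_of (C, C') \<in> carrier ?Z" "h (frag_of (C, C')) = c (C, C')"
    if "C \<in> carrier Ab" "C' \<in> carrier Ab" for C C'
    using that h(2) by auto
  have cl2: "frag_of x - frag_of y \<in> carrier ?Z"
    if "x \<in> carrier Ab \<times> carrier Ab" "y \<in> carrier Ab \<times> carrier Ab" for x y
    using keys_diff[of "frag_of x" "frag_of y"] that by auto
  have "h r = 0" if "r \<in> wedge_relators Ab" for r
    using that unfolding wedge_relators_def
  proof (elim UnE CollectE exE conjE)
    fix C C' C'' assume r: "r = frag_of (C \<otimes>\<^bsub>Ab\<^esub> C', C'') - frag_of (C, C'') - frag_of (C', C'')"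
      and C: "C \<in> carrier Ab" "C' \<in> carrier Ab" "C'' \<in> carrier Ab"
    have "h r = h (frag_of (C \<otimes>\<^bsub>Ab\<^esub> C', C'')) - h (frag_of (C, C'')) - h (frag_of (C', C''))"
      unfolding r using C by (simp only: diff cl(1) cl2 SigmaI Ab.m_closed)
    then show "h r = 0" using C by (simp add: cl(2) c_def add algebra_simps)
  next
    fix C C' C'' assume r: "r = frag_of (C, C' \<otimes>\<^bsub>Ab\<^esub> C'') - frag_of (C, C') - frag_of (C, C'')"
      and C: "C \<in> carrier Ab" "C' \<in> carrier Ab" "C'' \<in> carrier Ab"
    have "h r = h (frag_of (C, C' \<otimes>\<^bsub>Ab\<^esub> C'')) - h (frag_of (C, C')) - h (frag_of (C, C''))"
      unfolding r using C by (simp only: diff cl(1) cl2 SigmaI Ab.m_closed)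
    then show "h r = 0" using C by (simp add: cl(2) c_def add algebra_simps)
  next
    fix C assume "r = frag_of (C, C)" "C \<in> carrier Ab"
    then show "h r = 0" by (simp add: cl(2) c_def)
  qed
  then have "wedge_relators Ab \<subseteq> kernel ?Z integer_group h"
    using wedge_relators_carrier[OF Ab_group] by (auto simp: kernel_def simp del: carrier_free_Abelian_group_iff)
  then have "wedge_null Ab \<subseteq> kernel ?Z integer_group h"
    unfolding wedge_null_def
    by (rule group.generate_subgroup_incl[OF group_free_Abelian_group _ h.subgroup_kernel])
  then obtain g where g: "g \<in> hom (ext2 n k) integer_group"
    "\<And>x. x \<in> carrier ?Z \<Longrightarrow> g (wedge_null Ab #>\<^bsub>?Z\<^esub> x) = h x"
    using h.FactGroup_universal_kernel[OF normal_wedge_null[OF Ab_group]]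
    unfolding exterior_square_def by blast
  have g_wedge: "g (wedge Ab C C') = c (C, C')" if "C \<in> carrier Ab" "C' \<in> carrier Ab" for C C'
    unfolding wedge_def using g(2)[of "frag_of (C, C')"] h(2)[of "(C, C')"] that by simp
  have comp: "g \<circ> ext_proj \<in> hom D integer_group"
    using ext_proj_hom g(1) by (auto simp: hom_def Pi_iff simp del: mult_free_group)
  have "(g \<circ> ext_proj) z = magnus a b z" if "z \<in> \<gamma>2" for z
  proof (rule F.commutator_hom_eq[OF group_integer_group comp magnus_hom[OF ab] _ that])
    fix z w assume "z \<in> carrier F" "w \<in> carrier F"
    then show "(g \<circ> ext_proj) (comm F z w) = magnus a b (comm F z w)"
      by (simp add: ext_proj_comm g_wedge F.ab_class_closed c_def class_expo_ab_class magnus_comm[OF ab])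
  qed
  then show thesis using that g(1) by simp
qed

lemma ext_proj_eq_imp_magnus:
  assumes "a \<noteq> b" "z \<in> \<gamma>2" "w \<in> \<gamma>2" "ext_proj z = ext_proj w" shows "magnus a b z = magnus a b w"
  using ext_coordinate[OF assms(1)] assms(2-4) by metis

lemma \<gamma>3_normal_D: "\<gamma>3 \<lhd> D"
proof -
  interpret N: normal \<gamma>3 F by (rule F.third_term_normal)
  show ?thesis
  proof (rule D.normal_invI)
    show "subgroup \<gamma>3 D"
      using F.subgroup_incl[OF N.subgroup_axioms subgroup_\<gamma>2 F.third_term_subset] .
    fix x h assume "x \<in> carrier D" "h \<in> \<gamma>3"
    then show "x \<otimes>\<^bsub>D\<^esub> h \<otimes>\<^bsub>D\<^esub> inv\<^bsub>D\<^esub> x \<in> \<gamma>3"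
      using N.inv_op_closed2[of x h] F.m_inv_consistent[OF subgroup_\<gamma>2, of x] \<gamma>2_carrier
      by (simp del: mult_free_group one_free_group)
  qed
qed

lemma comm_\<gamma>3: "z \<in> carrier F \<Longrightarrow> d \<in> \<gamma>2 \<Longrightarrow> comm F z d \<in> \<gamma>3"
  unfolding comm_subgroup_def by (intro generate.incl) blast

text \<open>The quotient of the second by the third term of the lower central series.\<close>

abbreviation "T \<equiv> D Mod \<gamma>3"
abbreviation "T_class z \<equiv> \<gamma>3 #>\<^bsub>D\<^esub> z"

lemma T_class_eq:
  assumes "x \<in> \<gamma>2" "y \<in> \<gamma>2" "x \<otimes>\<^bsub>F\<^esub> inv\<^bsub>F\<^esub> y \<in> \<gamma>3" shows "T_class x = T_class y"
  using assms F.m_inv_consistent[OF subgroup_\<gamma>2, of y] normal_imp_subgroup[OF \<gamma>3_normal_D]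
  by (intro D.rcos_eqI) (simp_all del: mult_free_group one_free_group)

lemma T_class_mult:
  "x \<in> \<gamma>2 \<Longrightarrow> y \<in> \<gamma>2 \<Longrightarrow> T_class x \<otimes>\<^bsub>T\<^esub> T_class y = T_class (x \<otimes>\<^bsub>F\<^esub> y)"
  using normal.rcos_sum[OF \<gamma>3_normal_D, of x y] by (simp del: mult_free_group one_free_group)

lemma T_comm_group: "comm_group T"
proof (rule group.group_comm_groupI[OF normal.factorgroup_is_group[OF \<gamma>3_normal_D]])
  fix U V assume "U \<in> carrier T" "V \<in> carrier T"
  then obtain x y where xy: "x \<in> \<gamma>2" "y \<in> \<gamma>2" "U = T_class x" "V = T_class y"
    by (auto simp: carrier_FactGroup)
  have c: "x \<in> carrier F" "y \<in> carrier F" using xy \<gamma>2_carrier by auto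
  have "(x \<otimes>\<^bsub>F\<^esub> y) \<otimes>\<^bsub>F\<^esub> inv\<^bsub>F\<^esub> (y \<otimes>\<^bsub>F\<^esub> x) = comm F x y"
    using c by (simp add: comm_def F.inv_mult_group F.m_assoc del: mult_free_group one_free_group)
  then have "(x \<otimes>\<^bsub>F\<^esub> y) \<otimes>\<^bsub>F\<^esub> inv\<^bsub>F\<^esub> (y \<otimes>\<^bsub>F\<^esub> x) \<in> \<gamma>3"
    using comm_\<gamma>3[OF c(1) xy(2)] by simp
  then show "U \<otimes>\<^bsub>T\<^esub> V = V \<otimes>\<^bsub>T\<^esub> U"
    using xy subgroup.m_closed[OF subgroup_\<gamma>2]
    by (simp only: T_class_mult) (intro T_class_eq; simp del: mult_free_group one_free_group)
qed

text \<open>Commutators are bilinear modulo the third term, since conjugation acts trivially on the quotient.\<close>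

lemma T_class_comm_alternating: "alternating_map n k T (\<lambda>z w. T_class (comm F z w))"
proof (intro alternating_map.intro alternating_map_axioms.intro)
  interpret N: normal \<gamma>3 F by (rule F.third_term_normal)
  show "comm_group T" by (rule T_comm_group)
  fix z w assume z: "z \<in> carrier F" and w: "w \<in> carrier F"
  show "T_class (comm F z w) \<in> carrier T"
    using F.comm_in_commutator[OF z w] by (auto simp: carrier_FactGroup)
  have "comm F z z = []" using z by (simp add: F_comm reduce_winv_cancel_mid)
  then show "T_class (comm F z z) = \<one>\<^bsub>T\<^esub>"
    using D.coset_join2[OF _ normal_imp_subgroup[OF \<gamma>3_normal_D], of "[]"] N.one_closed
      subgroup.one_closed[OF subgroup_\<gamma>2] by simp
  fix v assume v: "v \<in> carrier F"
  note c2 = F.comm_in_commutator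
  have inv: "inv\<^bsub>F\<^esub> x \<otimes>\<^bsub>F\<^esub> (x \<otimes>\<^bsub>F\<^esub> y) = y" "x \<otimes>\<^bsub>F\<^esub> (inv\<^bsub>F\<^esub> x \<otimes>\<^bsub>F\<^esub> y) = y" if "x \<in> carrier F" "y \<in> carrier F" for x y
    using that by (simp_all add: F.m_assoc[symmetric] del: mult_free_group one_free_group)
  have m: "comm F z v \<otimes>\<^bsub>F\<^esub> comm F w v \<in> \<gamma>2" "comm F z w \<otimes>\<^bsub>F\<^esub> comm F z v \<in> \<gamma>2"
    using z w v by (blast intro: subgroup.m_closed[OF subgroup_\<gamma>2] c2)+
  have "T_class (comm F (z \<otimes>\<^bsub>F\<^esub> w) v) = T_class (comm F z v \<otimes>\<^bsub>F\<^esub> comm F w v)"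
  proof (rule T_class_eq)
    have "comm F (z \<otimes>\<^bsub>F\<^esub> w) v \<otimes>\<^bsub>F\<^esub> inv\<^bsub>F\<^esub> (comm F z v \<otimes>\<^bsub>F\<^esub> comm F w v)
      = comm F z (comm F w v) \<otimes>\<^bsub>F\<^esub> comm F (comm F w v) (comm F z v)"
      using z w v by (simp add: comm_def F.inv_mult_group F.m_assoc inv del: mult_free_group one_free_group)
    then show "comm F (z \<otimes>\<^bsub>F\<^esub> w) v \<otimes>\<^bsub>F\<^esub> inv\<^bsub>F\<^esub> (comm F z v \<otimes>\<^bsub>F\<^esub> comm F w v) \<in> \<gamma>3"
      using z w v by (simp only:) (intro subgroup.m_closed[OF N.subgroup_axioms] comm_\<gamma>3 c2 F.comm_closed; assumption)
  qed (use z w v m c2 F.m_closed in blast)+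
  then show "T_class (comm F (reduce (z @ w)) v) = T_class (comm F z v) \<otimes>\<^bsub>T\<^esub> T_class (comm F w v)"
    using z w v by (simp only: T_class_mult c2 mult_free_group[where S = S, symmetric])
  have "T_class (comm F z (w \<otimes>\<^bsub>F\<^esub> v)) = T_class (comm F z w \<otimes>\<^bsub>F\<^esub> comm F z v)"
  proof (rule T_class_eq)
    have "comm F z (w \<otimes>\<^bsub>F\<^esub> v) \<otimes>\<^bsub>F\<^esub> inv\<^bsub>F\<^esub> (comm F z w \<otimes>\<^bsub>F\<^esub> comm F z v)
      = comm F z w \<otimes>\<^bsub>F\<^esub> comm F w (comm F z v) \<otimes>\<^bsub>F\<^esub> inv\<^bsub>F\<^esub> comm F z w"
      using z w v by (simp add: comm_def F.inv_mult_group F.m_assoc inv del: mult_free_group one_free_group)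
    then show "comm F z (w \<otimes>\<^bsub>F\<^esub> v) \<otimes>\<^bsub>F\<^esub> inv\<^bsub>F\<^esub> (comm F z w \<otimes>\<^bsub>F\<^esub> comm F z v) \<in> \<gamma>3"
      using z w v by (simp only:) (intro N.inv_op_closed2 comm_\<gamma>3 c2 F.comm_closed; assumption)
  qed (use z w v m c2 F.m_closed in blast)+
  then show "T_class (comm F z (reduce (w @ v))) = T_class (comm F z w) \<otimes>\<^bsub>T\<^esub> T_class (comm F z v)"
    using z w v by (simp only: T_class_mult c2 mult_free_group[where S = S, symmetric])
qed

interpretation Q: alternating_map n k T "\<lambda>z w. T_class (comm F z w)"
  by (rule T_class_comm_alternating)

text \<open>The class of \<open>z\<close> in the quotient is a product of powers of classes of commutators of generators with
  the Magnus coefficients as exponents.\<close>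

lemma magnus_zero_imp_\<gamma>3:
  assumes z: "z \<in> \<gamma>2" and 0: "\<And>a b. a \<noteq> b \<Longrightarrow> magnus a b z = 0" shows "z \<in> \<gamma>3"
proof -
  have hom: "T_class \<in> hom D T"
    using normal.r_coset_hom_Mod[OF \<gamma>3_normal_D] .
  have "Q.extension z = T_class z"
    by (rule F.commutator_hom_eq[OF normal.factorgroup_is_group[OF \<gamma>3_normal_D] Q.extension_hom hom _ z])
       (rule Q.extension_comm)
  moreover have "Q.extension z = \<one>\<^bsub>T\<^esub>"
    unfolding Q.extension_def by (rule Q.Pr_zero) (rule 0[OF pairs_neq])
  ultimately have "T_class z = \<gamma>3" by simp
  then show ?thesis using D.rcos_self[OF _ normal_imp_subgroup[OF \<gamma>3_normal_D], of z] z by simp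
qed

end

section \<open>Groups of homomorphisms\<close>

lemma Hom_group_comm_group:
  assumes "group A" "comm_group B" shows "comm_group (Hom_group A B)"
proof -
  interpret A: group A by (rule assms)
  interpret B: comm_group B by (rule assms)
  have cl: "s x \<in> carrier B" if "s \<in> carrier (Hom_group A B)" "x \<in> carrier A" for s x
    using that by (auto simp: Hom_group_def hom_def)
  have ext: "s \<in> extensional (carrier A)" if "s \<in> carrier (Hom_group A B)" for s
    using that by (auto simp: Hom_group_def)
  have hom: "s (x \<otimes>\<^bsub>A\<^esub> y) = s x \<otimes>\<^bsub>B\<^esub> s y"
    if "s \<in> carrier (Hom_group A B)" "x \<in> carrier A" "y \<in> carrier A" for s x y
    using that by (auto simp: Hom_group_def hom_def)
  have mult: "(s \<otimes>\<^bsub>Hom_group A B\<^esub> t) x = s x \<otimes>\<^bsub>B\<^esub> t x" if "x \<in> carrier A" for s t x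
    using that by (simp add: Hom_group_def)
  have mem: "restrict s (carrier A) \<in> carrier (Hom_group A B)"
    if "\<And>x. x \<in> carrier A \<Longrightarrow> s x \<in> carrier B"
      "\<And>x y. x \<in> carrier A \<Longrightarrow> y \<in> carrier A \<Longrightarrow> s (x \<otimes>\<^bsub>A\<^esub> y) = s x \<otimes>\<^bsub>B\<^esub> s y" for s
    using that by (auto simp: Hom_group_def hom_def)
  have eqI: "s = t" if "s \<in> carrier (Hom_group A B)" "t \<in> carrier (Hom_group A B)"
    "\<And>x. x \<in> carrier A \<Longrightarrow> s x = t x" for s t
    by (rule extensionalityI[OF ext ext]) (use that in auto)
  have closed: "s \<otimes>\<^bsub>Hom_group A B\<^esub> t \<in> carrier (Hom_group A B)"
    if "s \<in> carrier (Hom_group A B)" "t \<in> carrier (Hom_group A B)" for s t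
  proof -
    have "restrict (\<lambda>x. s x \<otimes>\<^bsub>B\<^esub> t x) (carrier A) \<in> carrier (Hom_group A B)"
      by (rule mem) (use that in \<open>simp_all add: cl hom B.m_ac\<close>)
    then show ?thesis by (simp add: Hom_group_def)
  qed
  have one: "\<one>\<^bsub>Hom_group A B\<^esub> \<in> carrier (Hom_group A B)"
    using mem[of "\<lambda>_. \<one>\<^bsub>B\<^esub>"] by (simp add: Hom_group_def)
  have one_apply: "\<one>\<^bsub>Hom_group A B\<^esub> x = \<one>\<^bsub>B\<^esub>" if "x \<in> carrier A" for x
    using that by (simp add: Hom_group_def)
  show ?thesis
  proof (rule comm_groupI)
    fix s assume s: "s \<in> carrier (Hom_group A B)"
    show "\<exists>t\<in>carrier (Hom_group A B). t \<otimes>\<^bsub>Hom_group A B\<^esub> s = \<one>\<^bsub>Hom_group A B\<^esub>"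
    proof (rule bexI)
      show r: "restrict (\<lambda>x. inv\<^bsub>B\<^esub> (s x)) (carrier A) \<in> carrier (Hom_group A B)"
        by (rule mem) (use s in \<open>simp_all add: cl hom B.inv_mult\<close>)
      show "restrict (\<lambda>x. inv\<^bsub>B\<^esub> (s x)) (carrier A) \<otimes>\<^bsub>Hom_group A B\<^esub> s = \<one>\<^bsub>Hom_group A B\<^esub>"
        by (rule eqI[OF closed[OF r s] one]) (use s in \<open>simp add: mult cl one_apply\<close>)
    qed
  next
    fix s t u assume s: "s \<in> carrier (Hom_group A B)" and t: "t \<in> carrier (Hom_group A B)"
      and u: "u \<in> carrier (Hom_group A B)"
    show "s \<otimes>\<^bsub>Hom_group A B\<^esub> t \<otimes>\<^bsub>Hom_group A B\<^esub> u = s \<otimes>\<^bsub>Hom_group A B\<^esub> (t \<otimes>\<^bsub>Hom_group A B\<^esub> u)"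
      by (rule eqI) (use s t u in \<open>simp_all add: closed mult cl B.m_assoc\<close>)
  next
    fix s t assume s: "s \<in> carrier (Hom_group A B)" and t: "t \<in> carrier (Hom_group A B)"
    show "s \<otimes>\<^bsub>Hom_group A B\<^esub> t = t \<otimes>\<^bsub>Hom_group A B\<^esub> s"
      by (rule eqI) (use s t in \<open>simp_all add: closed mult cl B.m_comm\<close>)
  next
    fix s assume s: "s \<in> carrier (Hom_group A B)"
    show "\<one>\<^bsub>Hom_group A B\<^esub> \<otimes>\<^bsub>Hom_group A B\<^esub> s = s"
      by (rule eqI) (use s in \<open>simp_all add: closed one mult cl one_apply\<close>)
  qed (use closed one in auto)
qed

context free_factor
begin

abbreviation "E2 \<equiv> ext2 n k"

lemma E2_comm_group: "comm_group E2"
  by (rule exterior_square_comm_group[OF Ab_group])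

sublocale E2: comm_group E2 by (rule E2_comm_group)

sublocale ext_proj: group_hom D E2 ext_proj
  by (intro group_hom.intro group_hom_axioms.intro D.group_axioms E2.group_axioms ext_proj_hom)

lemma ext_proj_one: "z \<in> \<gamma>2 \<Longrightarrow> (\<And>a b. a \<noteq> b \<Longrightarrow> magnus a b z = 0) \<Longrightarrow> ext_proj z = \<one>\<^bsub>E2\<^esub>"
proof -
  interpret W: alternating_map n k E2 "\<lambda>z w. wedge Ab (ab_class F z) (ab_class F w)"
    by (rule wedge_alternating)
  assume z: "z \<in> \<gamma>2" and 0: "\<And>a b. a \<noteq> b \<Longrightarrow> magnus a b z = 0"
  show ?thesis
    unfolding ext_proj_eq[OF z] W.extension_def by (rule W.Pr_zero) (rule 0[OF pairs_neq])
qed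

lemma kernel_ext_proj: "kernel D E2 ext_proj = \<gamma>3"
proof
  show "kernel D E2 ext_proj \<subseteq> \<gamma>3"
  proof
    fix z assume "z \<in> kernel D E2 ext_proj"
    then have z: "z \<in> \<gamma>2" "ext_proj z = \<one>\<^bsub>E2\<^esub>" by (auto simp: kernel_def)
    have one: "[] \<in> \<gamma>2" using subgroup.one_closed[OF subgroup_\<gamma>2] by simp
    have "ext_proj z = ext_proj []" using z ext_proj.hom_one by simp
    then have "magnus a b z = 0" if "a \<noteq> b" for a b
      using ext_proj_eq_imp_magnus[OF that z(1) one] by simp
    then show "z \<in> \<gamma>3" by (rule magnus_zero_imp_\<gamma>3[OF z(1)])
  qed
  show "\<gamma>3 \<subseteq> kernel D E2 ext_proj"
    unfolding comm_subgroup_def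
  proof (rule F.generate_subgroup_incl)
    show "subgroup (kernel D E2 ext_proj) F"
      by (rule F.incl_subgroup[OF subgroup_\<gamma>2 ext_proj.subgroup_kernel])
    show "{comm F a b |a b. a \<in> carrier F \<and> b \<in> \<gamma>2} \<subseteq> kernel D E2 ext_proj"
    proof (clarify)
      fix z d assume z: "z \<in> carrier F" and d: "d \<in> \<gamma>2"
      have c: "comm F z d \<in> \<gamma>2" using z d \<gamma>2_carrier by (intro F.comm_in_commutator)
      have "ext_proj (comm F z d) = \<one>\<^bsub>E2\<^esub>"
        by (rule ext_proj_one[OF c]) (simp add: magnus_comm z \<gamma>2_carrier[OF d] expo_\<gamma>2[OF d])
      then show "comm F z d \<in> kernel D E2 ext_proj" using c by (simp add: kernel_def)
    qed
  qed
qed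

lemma ext_proj_surj: "ext_proj ` \<gamma>2 = carrier E2"
proof
  show "ext_proj ` \<gamma>2 \<subseteq> carrier E2" using ext_proj.hom_closed by auto
  show "carrier E2 \<subseteq> ext_proj ` \<gamma>2"
  proof
    fix u assume u: "u \<in> carrier E2"
    have H: "subgroup (ext_proj ` \<gamma>2) E2"
      using ext_proj.subgroup_img_is_subgroup[OF D.subgroup_self] by simp
    show "u \<in> ext_proj ` \<gamma>2"
    proof (rule exterior_square_induct[OF Ab_group u H])
      fix a b assume "a \<in> carrier Ab" "b \<in> carrier Ab"
      then obtain z w where zw: "z \<in> carrier F" "a = ab_class F z" "w \<in> carrier F" "b = ab_class F w"
        using F.ab_class_surj by metis
      have "wedge Ab a b = ext_proj (comm F z w)" using zw by (simp add: ext_proj_comm)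
      then show "wedge Ab a b \<in> ext_proj ` \<gamma>2" using F.comm_in_commutator zw by blast
    qed
  qed
qed

text \<open>The description in the definition determines the projection, because a homomorphism on
  the commutator subgroup is determined by its values on commutators.\<close>

lemma johnson_pi_eq: "johnson_pi n k = ext_proj"
  unfolding johnson_pi_def Let_def
proof (rule the_equality)
  show "ext_proj \<in> epi D E2 \<and> ext_proj \<in> extensional (carrier D) \<and> kernel D E2 ext_proj = \<gamma>3 \<and>
    (\<forall>z\<in>carrier F. \<forall>z'\<in>carrier F. ext_proj (comm F z z') = wedge Ab (ab_class F z) (ab_class F z'))"
    using ext_proj_hom ext_proj_surj kernel_ext_proj ext_proj_comm
    by (simp add: epi_def ext_proj_def)
  fix p assume p: "p \<in> epi D E2 \<and> p \<in> extensional (carrier D) \<and> kernel D E2 p = \<gamma>3 \<and>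
    (\<forall>z\<in>carrier F. \<forall>z'\<in>carrier F. p (comm F z z') = wedge Ab (ab_class F z) (ab_class F z'))"
  show "p = ext_proj"
  proof (rule extensionalityI[of _ "\<gamma>2"])
    show "p \<in> extensional \<gamma>2" using p by simp
    show "ext_proj \<in> extensional \<gamma>2" by (simp add: ext_proj_def)
    fix z assume z: "z \<in> \<gamma>2"
    have "p \<in> hom D E2" using p by (simp add: epi_def)
    then show "p z = ext_proj z"
      by (rule F.commutator_hom_eq[OF E2.group_axioms _ ext_proj_hom _ z]) (use p in \<open>simp add: ext_proj_comm\<close>)
  qed
qed

section \<open>Automorphisms acting trivially on the abelianization\<close>

text \<open>The class of \<open>z\<close> in the abelianization is the product of the classes of the generators, raised to the
  exponent sums.\<close>

lemma expo_zero_imp_\<gamma>2: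
  assumes z: "z \<in> carrier F" and 0: "\<And>a. a \<in> S \<Longrightarrow> expo a z = 0" shows "z \<in> \<gamma>2"
proof -
  interpret Ab: comm_group Ab by (rule Ab_comm_group)
  define q where "q w = finprod Ab (\<lambda>a. ab_class F [(a, True)] [^]\<^bsub>Ab\<^esub> expo a w) S" for w
  have cl: "(\<lambda>a. ab_class F [(a, True)] [^]\<^bsub>Ab\<^esub> (c a :: int)) \<in> S \<rightarrow> carrier Ab" for c
    by (auto simp: F.ab_class_closed)
  have q: "q \<in> hom F Ab"
  proof (rule homI)
    show "q w \<in> carrier Ab" for w unfolding q_def by (rule Ab.finprod_closed[OF cl])
    fix v w
    have "q (v \<otimes>\<^bsub>F\<^esub> w) = finprod Ab (\<lambda>a. ab_class F [(a, True)] [^]\<^bsub>Ab\<^esub> expo a v \<otimes>\<^bsub>Ab\<^esub>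
        ab_class F [(a, True)] [^]\<^bsub>Ab\<^esub> expo a w) S"
      unfolding q_def by (rule Ab.finprod_cong') (auto simp: F.ab_class_closed Ab.int_pow_mult)
    also have "\<dots> = q v \<otimes>\<^bsub>Ab\<^esub> q w"
      unfolding q_def by (rule Ab.finprod_multf[OF cl cl])
    finally show "q (v \<otimes>\<^bsub>F\<^esub> w) = q v \<otimes>\<^bsub>Ab\<^esub> q w" .
  qed
  have gen: "ab_class F [(a, True)] = q [(a, True)]" if a: "a \<in> S" for a
  proof -
    have "q [(a, True)] = finprod Ab (\<lambda>b. ab_class F [(b, True)] [^]\<^bsub>Ab\<^esub> expo b [(a, True)]) {a}"
      unfolding q_def
      by (rule Ab.finprod_mono_neutral_cong_right) (use a cl in \<open>auto simp: F.ab_class_closed\<close>)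
    also have "\<dots> = ab_class F [(a, True)]"
      using a by (subst Ab.finprod_insert) (auto simp: F.ab_class_closed letter_sign_def)
    finally show ?thesis by simp
  qed
  have "ab_class F z = q z"
    by (rule free_group_hom_eqI[OF Ab.group_axioms F.ab_class_hom q gen z])
  also have "\<dots> = \<one>\<^bsub>Ab\<^esub>"
    unfolding q_def by (rule Ab.finprod_one_eqI) (simp add: 0)
  also have "\<dots> = \<gamma>2" by (simp add: abelianization_def)
  finally have "\<gamma>2 #>\<^bsub>F\<^esub> z = \<gamma>2" by (simp add: ab_class_def)
  then show ?thesis using F.rcos_self[OF z subgroup_\<gamma>2] by simp
qed

text \<open>The image of a coset under \<open>f\<close> is the coset of the image; so \<open>f\<close> acts trivially precisely if
  it moves every element within its coset.\<close>

lemma IA_iff: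
  "f \<in> IA n k \<longleftrightarrow> f \<in> auto F \<and> (\<forall>z\<in>carrier F. reduce (f z @ winv z) \<in> \<gamma>2)"
proof (cases "f \<in> auto F")
  case True
  note f = True
  have eq: "reduce (f z @ winv z) = f z \<otimes>\<^bsub>F\<^esub> inv\<^bsub>F\<^esub> z" if "z \<in> carrier F" for z
    using that by (simp add: inv_free_group)
  have "f \<in> IA n k \<longleftrightarrow> ab_action n k f = (\<lambda>x\<in>carrier Ab. x)"
    unfolding IA_def kernel_def one_AutoGroup using f by (simp add: carrier_AA)
  also have "\<dots> \<longleftrightarrow> (\<forall>C\<in>carrier Ab. f ` C = C)"
    unfolding ab_action_def by (auto simp: fun_eq_iff restrict_def)
  also have "\<dots> \<longleftrightarrow> (\<forall>z\<in>carrier F. f ` (\<gamma>2 #>\<^bsub>F\<^esub> z) = \<gamma>2 #>\<^bsub>F\<^esub> z)"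
    by (auto simp: abelianization_def carrier_FactGroup)
  also have "\<dots> \<longleftrightarrow> (\<forall>z\<in>carrier F. reduce (f z @ winv z) \<in> \<gamma>2)"
  proof
    assume L: "\<forall>z\<in>carrier F. f ` (\<gamma>2 #>\<^bsub>F\<^esub> z) = \<gamma>2 #>\<^bsub>F\<^esub> z"
    show "\<forall>z\<in>carrier F. reduce (f z @ winv z) \<in> \<gamma>2"
    proof
      fix z assume z: "z \<in> carrier F"
      have "f z \<in> \<gamma>2 #>\<^bsub>F\<^esub> z" using L z F.rcos_self[OF z subgroup_\<gamma>2] by blast
      then have "\<gamma>2 #>\<^bsub>F\<^esub> z = \<gamma>2 #>\<^bsub>F\<^esub> f z" by (rule F.repr_independence[OF _ z subgroup_\<gamma>2])
      then show "reduce (f z @ winv z) \<in> \<gamma>2"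
        unfolding eq[OF z] using z auto_closed[OF f z] by (intro F.rcos_eqD[OF subgroup_\<gamma>2]) simp_all
    qed
  next
    assume R: "\<forall>z\<in>carrier F. reduce (f z @ winv z) \<in> \<gamma>2"
    have coset: "\<gamma>2 #>\<^bsub>F\<^esub> f z = \<gamma>2 #>\<^bsub>F\<^esub> z" if z: "z \<in> carrier F" for z
      using R z auto_closed[OF f z] by (intro F.rcos_eqI[OF subgroup_\<gamma>2]) (simp_all add: inv_free_group)
    show "\<forall>z\<in>carrier F. f ` (\<gamma>2 #>\<^bsub>F\<^esub> z) = \<gamma>2 #>\<^bsub>F\<^esub> z"
    proof (intro ballI equalityI subsetI)
      fix z w assume z: "z \<in> carrier F" and "w \<in> f ` (\<gamma>2 #>\<^bsub>F\<^esub> z)"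
      then obtain v where v: "v \<in> \<gamma>2 #>\<^bsub>F\<^esub> z" "w = f v" by blast
      have vc: "v \<in> carrier F" using F.r_coset_subset_G[OF _ z] subgroup.subset[OF subgroup_\<gamma>2] v(1) by blast
      have "w \<in> \<gamma>2 #>\<^bsub>F\<^esub> f v" unfolding v(2) by (rule F.rcos_self[OF auto_closed[OF f vc] subgroup_\<gamma>2])
      then show "w \<in> \<gamma>2 #>\<^bsub>F\<^esub> z" using coset[OF vc] F.repr_independence[OF v(1) z subgroup_\<gamma>2] by simp
    next
      fix z w assume z: "z \<in> carrier F" and w: "w \<in> \<gamma>2 #>\<^bsub>F\<^esub> z"
      have wc: "w \<in> carrier F" using F.r_coset_subset_G[OF _ z] subgroup.subset[OF subgroup_\<gamma>2] w by blast
      obtain v where v: "v \<in> carrier F" "f v = w" using auto_surj[OF f wc] by blast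
      have "\<gamma>2 #>\<^bsub>F\<^esub> v = \<gamma>2 #>\<^bsub>F\<^esub> z"
        using coset[OF v(1)] F.repr_independence[OF w z subgroup_\<gamma>2] v(2) by simp
      then have "v \<in> \<gamma>2 #>\<^bsub>F\<^esub> z" using F.rcos_self[OF v(1) subgroup_\<gamma>2] by simp
      then show "w \<in> f ` (\<gamma>2 #>\<^bsub>F\<^esub> z)" using v(2) by blast
    qed
  qed
  finally show ?thesis using f by simp
next
  case False
  then show ?thesis by (auto simp: IA_def kernel_def carrier_AA)
qed

lemma IA_expo: "f \<in> IA n k \<Longrightarrow> z \<in> carrier F \<Longrightarrow> expo a (f z) = expo a z"
  unfolding IA_iff using expo_\<gamma>2[of "reduce (f z @ winv z)" a] by auto

lemma IA_I:
  assumes f: "f \<in> auto F" and gen: "\<And>a b. a \<in> S \<Longrightarrow> expo b (f [(a, True)]) = expo b [(a, True)]"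
  shows "f \<in> IA n k"
proof -
  have "expo b (f z) = expo b z" if "z \<in> carrier F" for b z
  proof (rule free_group_hom_eqI[OF group_integer_group _ expo_hom _ that])
    show "(\<lambda>z. expo b (f z)) \<in> hom F integer_group"
      by (rule homI) (use auto_mult[OF f] in simp_all)
  qed (rule gen)
  then have "reduce (f z @ winv z) \<in> \<gamma>2" if "z \<in> carrier F" for z
    using that reduce_append_closed[OF auto_closed[OF f that], of "winv z"]
    by (intro expo_zero_imp_\<gamma>2) auto
  then show ?thesis using f unfolding IA_iff by blast
qed

lemma subgroup_IA: "subgroup (IA n k) (\<AA> S)"
proof (rule A.subgroupI)
  show "IA n k \<subseteq> carrier (\<AA> S)" by (auto simp: IA_iff carrier_AA)
  have "\<one>\<^bsub>\<AA> S\<^esub> \<in> IA n k"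
    using A.one_closed by (intro IA_I) (auto simp: carrier_AA one_AutoGroup)
  then show "IA n k \<noteq> {}" by blast
next
  fix f assume f: "f \<in> IA n k"
  then have fa: "f \<in> auto F" by (simp add: IA_iff)
  let ?h = "inv\<^bsub>\<AA> S\<^esub> f"
  note ha = auto_inv_closed[OF fa] and fh = auto_inv_right[OF fa]
  show "?h \<in> IA n k"
  proof (rule IA_I[OF ha])
    fix a b assume "a \<in> S"
    then have z: "[(a, True)] \<in> carrier F" by simp
    have "expo b (f (?h [(a, True)])) = expo b (?h [(a, True)])"
      by (rule IA_expo[OF f auto_closed[OF ha z]])
    then show "expo b (?h [(a, True)]) = expo b [(a, True)]" by (simp only: fh[OF z])
  qed
next
  fix f g assume f: "f \<in> IA n k" and g: "g \<in> IA n k"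
  then have fa: "f \<in> auto F" "g \<in> auto F" by (auto simp: IA_iff)
  show "f \<bullet> g \<in> IA n k"
  proof (rule IA_I)
    show "f \<bullet> g \<in> auto F" using A.m_closed[of f g] fa by (simp add: carrier_AA)
    fix a b assume "a \<in> S"
    then have z: "[(a, True)] \<in> carrier F" by simp
    have "expo b ((f \<bullet> g) [(a, True)]) = expo b (g [(a, True)])"
      unfolding mult_AutoGroup_apply[OF fa z] by (rule IA_expo[OF f auto_closed[OF fa(2) z]])
    then show "expo b ((f \<bullet> g) [(a, True)]) = expo b [(a, True)]"
      using IA_expo[OF g z] by simp
  qed
qed

section \<open>The Johnson homomorphism\<close>

abbreviation "HomG \<equiv> Hom_group Ab E2"

text \<open>Expanding \<open>f (z w) (z w)\<inverse>\<close> gives the product of the displacements of \<open>w\<close> and \<open>z\<close> up to a commutator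
  of \<open>f z\<close> with an element of the commutator subgroup, which the projection kills.\<close>

lemma displacement_hom:
  assumes f: "f \<in> IA n k" shows "(\<lambda>z. ext_proj (f z \<otimes>\<^bsub>F\<^esub> inv\<^bsub>F\<^esub> z)) \<in> hom F E2"
proof (rule homI)
  have fa: "f \<in> auto F" using f by (simp add: IA_iff)
  have d: "f z \<otimes>\<^bsub>F\<^esub> inv\<^bsub>F\<^esub> z \<in> \<gamma>2" if "z \<in> carrier F" for z
    using f that by (simp add: IA_iff inv_free_group)
  show "ext_proj (f z \<otimes>\<^bsub>F\<^esub> inv\<^bsub>F\<^esub> z) \<in> carrier E2" if "z \<in> carrier F" for z
    using d[OF that] ext_proj.hom_closed by simp
  fix z w assume z: "z \<in> carrier F" and w: "w \<in> carrier F"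
  let ?dz = "f z \<otimes>\<^bsub>F\<^esub> inv\<^bsub>F\<^esub> z" and ?dw = "f w \<otimes>\<^bsub>F\<^esub> inv\<^bsub>F\<^esub> w"
  note c = auto_closed[OF fa z] auto_closed[OF fa w] \<gamma>2_carrier[OF d[OF w]]
  have fzw: "f (z \<otimes>\<^bsub>F\<^esub> w) = f z \<otimes>\<^bsub>F\<^esub> f w" using auto_mult[OF fa z w] by simp
  have inv: "inv\<^bsub>F\<^esub> x \<otimes>\<^bsub>F\<^esub> (x \<otimes>\<^bsub>F\<^esub> y) = y" "x \<otimes>\<^bsub>F\<^esub> (inv\<^bsub>F\<^esub> x \<otimes>\<^bsub>F\<^esub> y) = y"
    if "x \<in> carrier F" "y \<in> carrier F" for x y
    using that by (simp_all add: F.m_assoc[symmetric] del: mult_free_group one_free_group)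
  have "f (z \<otimes>\<^bsub>F\<^esub> w) \<otimes>\<^bsub>F\<^esub> inv\<^bsub>F\<^esub> (z \<otimes>\<^bsub>F\<^esub> w) = comm F (f z) ?dw \<otimes>\<^bsub>F\<^esub> ?dw \<otimes>\<^bsub>F\<^esub> ?dz"
    unfolding fzw comm_def using z w c
    by (simp add: F.inv_mult_group F.m_assoc inv del: mult_free_group one_free_group)
  moreover have k: "comm F (f z) ?dw \<in> \<gamma>2" using F.comm_in_commutator c by blast
  moreover have "ext_proj (comm F (f z) ?dw) = \<one>\<^bsub>E2\<^esub>"
    using comm_\<gamma>3[OF c(1) d[OF w]] kernel_ext_proj by (auto simp: kernel_def)
  moreover have mult: "ext_proj (x \<otimes>\<^bsub>F\<^esub> y) = ext_proj x \<otimes>\<^bsub>E2\<^esub> ext_proj y" if "x \<in> \<gamma>2" "y \<in> \<gamma>2" for x y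
    using ext_proj.hom_mult[of x y] that by simp
  ultimately have "ext_proj (f (z \<otimes>\<^bsub>F\<^esub> w) \<otimes>\<^bsub>F\<^esub> inv\<^bsub>F\<^esub> (z \<otimes>\<^bsub>F\<^esub> w)) = ext_proj ?dw \<otimes>\<^bsub>E2\<^esub> ext_proj ?dz"
    using d[OF z] d[OF w] subgroup.m_closed[OF subgroup_\<gamma>2] ext_proj.hom_closed[of ?dw]
    by (simp del: mult_free_group one_free_group)
  also have "\<dots> = ext_proj ?dz \<otimes>\<^bsub>E2\<^esub> ext_proj ?dw"
    using d[OF z] d[OF w] ext_proj.hom_closed by (intro E2.m_comm) simp_all
  finally show "ext_proj (f (z \<otimes>\<^bsub>F\<^esub> w) \<otimes>\<^bsub>F\<^esub> inv\<^bsub>F\<^esub> (z \<otimes>\<^bsub>F\<^esub> w)) = ext_proj ?dz \<otimes>\<^bsub>E2\<^esub> ext_proj ?dw" .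
qed

lemma johnson_hom_spec:
  assumes f: "f \<in> IA n k"
  shows "johnson_hom n k f \<in> carrier HomG"
    and "\<And>z. z \<in> carrier F \<Longrightarrow> johnson_hom n k f (ab_class F z) = ext_proj (f z \<otimes>\<^bsub>F\<^esub> inv\<^bsub>F\<^esub> z)"
proof -
  let ?d = "\<lambda>z. ext_proj (f z \<otimes>\<^bsub>F\<^esub> inv\<^bsub>F\<^esub> z)"
  interpret d: group_hom F E2 ?d
    by (intro group_hom.intro group_hom_axioms.intro F.group_axioms E2.group_axioms displacement_hom[OF f])
  have "\<gamma>2 \<subseteq> kernel F E2 ?d"
    using F.hom_commutator_one[OF E2_comm_group displacement_hom[OF f]] \<gamma>2_carrier
    by (auto simp: kernel_def simp del: mult_free_group)
  then obtain g where g: "g \<in> hom Ab E2" "\<And>z. z \<in> carrier F \<Longrightarrow> g (\<gamma>2 #>\<^bsub>F\<^esub> z) = ?d z"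
    using d.FactGroup_universal_kernel[OF F.commutator_normal] unfolding abelianization_def by blast
  define t where "t = restrict g (carrier Ab)"
  interpret Ab: group Ab by (rule Ab_group)
  have t1: "t \<in> carrier HomG" using g(1) by (auto simp: Hom_group_def t_def hom_def Pi_iff)
  have t2: "t (ab_class F z) = ?d z" if "z \<in> carrier F" for z
    using g(2)[OF that] F.ab_class_closed[OF that] by (simp add: t_def ab_class_def)
  have "johnson_hom n k f = t"
    unfolding johnson_hom_def johnson_pi_eq
  proof (rule the_equality)
    show "t \<in> carrier HomG \<and> (\<forall>z\<in>carrier F. t (ab_class F z) = ?d z)" using t1 t2 by blast
    fix u assume u: "u \<in> carrier HomG \<and> (\<forall>z\<in>carrier F. u (ab_class F z) = ?d z)"
    show "u = t"
    proof (rule extensionalityI[of _ "carrier Ab"])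
      show "u \<in> extensional (carrier Ab)" "t \<in> extensional (carrier Ab)"
        using u t1 by (auto simp: Hom_group_def)
      fix C assume "C \<in> carrier Ab"
      then obtain z where "z \<in> carrier F" "C = ab_class F z" using F.ab_class_surj by blast
      then show "u C = t C" using u t2 by simp
    qed
  qed
  then show "johnson_hom n k f \<in> carrier HomG"
    and "\<And>z. z \<in> carrier F \<Longrightarrow> johnson_hom n k f (ab_class F z) = ?d z"
    using t1 t2 by auto
qed

text \<open>Because \<open>f (g z) z\<inverse>\<close> is the product of \<open>f (g z) (g z)\<inverse>\<close> and \<open>g z z\<inverse>\<close>, and \<open>g z\<close> has the same class
  as \<open>z\<close>.\<close>

lemma johnson_hom_mult:
  assumes f: "f \<in> IA n k" and g: "g \<in> IA n k"
  shows "johnson_hom n k (f \<bullet> g) = johnson_hom n k f \<otimes>\<^bsub>HomG\<^esub> johnson_hom n k g"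
proof -
  interpret H: comm_group HomG by (rule Hom_group_comm_group[OF Ab_group E2_comm_group])
  have fg: "f \<bullet> g \<in> IA n k" by (rule subgroup.m_closed[OF subgroup_IA f g])
  have fa: "f \<in> auto F" "g \<in> auto F" using f g by (auto simp: IA_iff)
  show ?thesis
  proof (rule extensionalityI[of _ "carrier Ab"])
    show "johnson_hom n k (f \<bullet> g) \<in> extensional (carrier Ab)"
      using johnson_hom_spec(1)[OF fg] by (simp add: Hom_group_def)
    show "johnson_hom n k f \<otimes>\<^bsub>HomG\<^esub> johnson_hom n k g \<in> extensional (carrier Ab)"
      by (simp add: Hom_group_def)
    fix C assume C: "C \<in> carrier Ab"
    then obtain z where z: "z \<in> carrier F" "C = ab_class F z" using F.ab_class_surj by blast
    have gz: "g z \<in> carrier F" using auto_closed[OF fa(2) z(1)] .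
    have dg: "g z \<otimes>\<^bsub>F\<^esub> inv\<^bsub>F\<^esub> z \<in> \<gamma>2" using g z by (simp add: IA_iff inv_free_group)
    have df: "f (g z) \<otimes>\<^bsub>F\<^esub> inv\<^bsub>F\<^esub> (g z) \<in> \<gamma>2" using f gz by (simp add: IA_iff inv_free_group)
    have cl: "ab_class F (g z) = ab_class F z" using F.ab_class_eq_iff[OF gz z(1)] dg by simp
    have inv: "inv\<^bsub>F\<^esub> (g z) \<otimes>\<^bsub>F\<^esub> (g z \<otimes>\<^bsub>F\<^esub> inv\<^bsub>F\<^esub> z) = inv\<^bsub>F\<^esub> z"
      using gz z(1) by (simp add: F.m_assoc[symmetric] del: mult_free_group one_free_group)
    have split: "f (g z) \<otimes>\<^bsub>F\<^esub> inv\<^bsub>F\<^esub> z = (f (g z) \<otimes>\<^bsub>F\<^esub> inv\<^bsub>F\<^esub> (g z)) \<otimes>\<^bsub>F\<^esub> (g z \<otimes>\<^bsub>F\<^esub> inv\<^bsub>F\<^esub> z)"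
      using gz z(1) auto_closed[OF fa(1) gz]
      by (simp add: F.m_assoc inv del: mult_free_group one_free_group)
    have "johnson_hom n k (f \<bullet> g) C = ext_proj (f (g z) \<otimes>\<^bsub>F\<^esub> inv\<^bsub>F\<^esub> z)"
      unfolding z(2) johnson_hom_spec(2)[OF fg z(1)] mult_AutoGroup_apply[OF fa z(1)] ..
    also have "\<dots> = ext_proj (f (g z) \<otimes>\<^bsub>F\<^esub> inv\<^bsub>F\<^esub> (g z)) \<otimes>\<^bsub>E2\<^esub> ext_proj (g z \<otimes>\<^bsub>F\<^esub> inv\<^bsub>F\<^esub> z)"
      unfolding split using ext_proj.hom_mult[of "f (g z) \<otimes>\<^bsub>F\<^esub> inv\<^bsub>F\<^esub> (g z)" "g z \<otimes>\<^bsub>F\<^esub> inv\<^bsub>F\<^esub> z"] df dg by simp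
    also have "\<dots> = johnson_hom n k f C \<otimes>\<^bsub>E2\<^esub> johnson_hom n k g C"
      using johnson_hom_spec(2)[OF f gz] johnson_hom_spec(2)[OF g z(1)] cl z(2) by simp
    finally show "johnson_hom n k (f \<bullet> g) C = (johnson_hom n k f \<otimes>\<^bsub>HomG\<^esub> johnson_hom n k g) C"
      using C by (simp add: Hom_group_def)
  qed
qed

lemma johnson_hom_eq_imp_magnus:
  assumes f: "f \<in> IA n k" and g: "g \<in> IA n k" and eq: "johnson_hom n k f = johnson_hom n k g"
    and t: "t \<in> carrier F" and ab: "a \<noteq> b"
  shows "magnus a b (reduce (f t @ winv t)) = magnus a b (reduce (g t @ winv t))"
proof (rule ext_proj_eq_imp_magnus[OF ab])
  show "reduce (f t @ winv t) \<in> \<gamma>2" "reduce (g t @ winv t) \<in> \<gamma>2" using f g t by (auto simp: IA_iff)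
  show "ext_proj (reduce (f t @ winv t)) = ext_proj (reduce (g t @ winv t))"
    using johnson_hom_spec(2)[OF f t] johnson_hom_spec(2)[OF g t] eq t by (simp add: inv_free_group)
qed

end

section \<open>Recognizing free abelian quotients\<close>

lemma (in group) commutes_with_generate:
  assumes T: "T \<subseteq> carrier G" and x: "x \<in> carrier G"
    and comm: "\<And>t. t \<in> T \<Longrightarrow> x \<otimes> t = t \<otimes> x" and y: "y \<in> generate G T"
  shows "x \<otimes> y = y \<otimes> x"
  using y
proof (induction y rule: generate.induct)
  case (inv h)
  have h: "h \<in> carrier G" using inv T by blast
  have "x \<otimes> inv h = inv h \<otimes> (h \<otimes> x) \<otimes> inv h" using h x by (simp add: m_assoc[symmetric])
  also have "\<dots> = inv h \<otimes> (x \<otimes> h) \<otimes> inv h" using comm[OF inv] by simp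
  also have "\<dots> = inv h \<otimes> x" using h x by (simp add: m_assoc)
  finally show ?case .
next
  case (eng h1 h2)
  have h: "h1 \<in> carrier G" "h2 \<in> carrier G" using eng T generate_in_carrier by auto
  have "x \<otimes> (h1 \<otimes> h2) = h1 \<otimes> (x \<otimes> h2)" using eng(3) h x by (simp add: m_assoc[symmetric])
  also have "\<dots> = h1 \<otimes> h2 \<otimes> x" using eng(4) h x by (simp add: m_assoc)
  finally show ?case .
qed (use x comm in auto)

lemma (in group) comm_group_of_commuting_generators:
  assumes T: "T \<subseteq> carrier G" and gen: "generate G T = carrier G"
    and comm: "\<And>s t. s \<in> T \<Longrightarrow> t \<in> T \<Longrightarrow> s \<otimes> t = t \<otimes> s"
  shows "comm_group G"
proof (rule group_comm_groupI)
  fix x y assume x: "x \<in> carrier G" and y: "y \<in> carrier G"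
  have *: "s \<otimes> x = x \<otimes> s" if "s \<in> T" for s
    by (rule commutes_with_generate[OF T]) (use that T comm gen x in auto)
  show "x \<otimes> y = y \<otimes> x"
  proof (rule commutes_with_generate[OF T x])
    show "x \<otimes> s = s \<otimes> x" if "s \<in> T" for s using *[OF that] by (rule sym)
    show "y \<in> generate G T" using y gen by simp
  qed
qed

text \<open>If elements \<open>t i\<close> generate a group modulo \<open>N\<close> and commute modulo \<open>N\<close>, then the quotient is abelian and
  receives a surjection from a free abelian group. A dual family of integer-valued homomorphisms
  that vanish on \<open>N\<close> reads off the coefficients of a preimage, which gives injectivity. The second
  conclusion says that these homomorphisms separate elements modulo \<open>N\<close>. It is applied twice: to
  the kernel \<open>K\<close> modulo \<open>L\<close>, and to \<open>J\<close> modulo its commutator subgroup.\<close>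

lemma (in group) free_abelian_quotient:
  fixes t :: "'i \<Rightarrow> 'a" and c :: "'i \<Rightarrow> 'a \<Rightarrow> int"
  assumes N: "N \<lhd> G" and t: "t ` I \<subseteq> carrier G" and gen: "carrier G \<subseteq> generate G (t ` I \<union> N)"
    and comm: "\<And>i j. i \<in> I \<Longrightarrow> j \<in> I \<Longrightarrow> t i \<otimes> t j \<otimes> inv (t j \<otimes> t i) \<in> N"
    and c_hom: "\<And>i. i \<in> I \<Longrightarrow> c i \<in> hom G integer_group"
    and c_N: "\<And>i x. i \<in> I \<Longrightarrow> x \<in> N \<Longrightarrow> c i x = 0"
    and c_t: "\<And>i j. i \<in> I \<Longrightarrow> j \<in> I \<Longrightarrow> c i (t j) = (if i = j then 1 else 0)"
  shows "free_Abelian_group I \<cong> G Mod N"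
    and "\<And>x. x \<in> carrier G \<Longrightarrow> (\<And>i. i \<in> I \<Longrightarrow> c i x = 0) \<Longrightarrow> x \<in> N"
proof -
  interpret N: normal N G by (rule N)
  let ?Q = "G Mod N" and ?Z = "free_Abelian_group I"
  interpret Q: group ?Q by (rule N.factorgroup_is_group)
  interpret q: group_hom G ?Q "\<lambda>x. N #> x"
    by (intro group_hom.intro group_hom_axioms.intro group_axioms Q.group_axioms N.r_coset_hom_Mod)
  have TN: "t ` I \<union> N \<subseteq> carrier G" using t N.subset by blast
  have coset_N: "N #> x = N" if "x \<in> N" for x
    using that N.subset by (intro coset_join2 N.subgroup_axioms) auto
  have "generate ?Q ((\<lambda>x. N #> x) ` (t ` I \<union> N)) = (\<lambda>x. N #> x) ` generate G (t ` I \<union> N)"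
    by (rule q.generate_img[OF TN])
  also have "generate G (t ` I \<union> N) = carrier G" using gen generate_incl[OF TN] by blast
  also have "(\<lambda>x. N #> x) ` carrier G = carrier ?Q" by (simp add: carrier_FactGroup)
  finally have genQ: "generate ?Q ((\<lambda>x. N #> x) ` (t ` I \<union> N)) = carrier ?Q" .
  have subQ: "(\<lambda>x. N #> x) ` (t ` I \<union> N) \<subseteq> carrier ?Q" using TN by (auto simp: carrier_FactGroup)
  have Q: "comm_group ?Q"
  proof (rule Q.comm_group_of_commuting_generators[OF subQ genQ])
    fix u v assume "u \<in> (\<lambda>x. N #> x) ` (t ` I \<union> N)" "v \<in> (\<lambda>x. N #> x) ` (t ` I \<union> N)"
    then have "u = \<one>\<^bsub>?Q\<^esub> \<or> (\<exists>i\<in>I. u = N #> t i)" "v = \<one>\<^bsub>?Q\<^esub> \<or> (\<exists>i\<in>I. v = N #> t i)" "u \<in> carrier ?Q" "v \<in> carrier ?Q"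
      using coset_N subQ by auto
    moreover have "(N #> t i) \<otimes>\<^bsub>?Q\<^esub> (N #> t j) = (N #> t j) \<otimes>\<^bsub>?Q\<^esub> (N #> t i)" if "i \<in> I" "j \<in> I" for i j
    proof -
      have ij: "t i \<in> carrier G" "t j \<in> carrier G" using t that by auto
      have "N #> (t i \<otimes> t j) = N #> (t j \<otimes> t i)"
        using ij comm[OF that] by (intro rcos_eqI N.subgroup_axioms) auto
      then show ?thesis using q.hom_mult[OF ij] q.hom_mult[OF ij(2,1)] by simp
    qed
    ultimately show "u \<otimes>\<^bsub>?Q\<^esub> v = v \<otimes>\<^bsub>?Q\<^esub> u" by (auto simp del: mult_FactGroup one_FactGroup)
  qed
  have imgc: "(\<lambda>i. N #> t i) ` I \<subseteq> carrier ?Q" using t by (auto simp: carrier_FactGroup)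
  obtain \<psi> where \<psi>: "\<psi> \<in> hom ?Z ?Q" "\<And>i. i \<in> I \<Longrightarrow> \<psi> (frag_of i) = N #> t i"
    by (rule comm_group.free_Abelian_group_universal[OF Q imgc]) blast
  interpret \<psi>: group_hom ?Z ?Q \<psi>
    by (intro group_hom.intro group_hom_axioms.intro Q.group_axioms \<psi>(1)) simp
  have surj: "\<psi> ` carrier ?Z = carrier ?Q"
  proof
    show "\<psi> ` carrier ?Z \<subseteq> carrier ?Q" using \<psi>.hom_closed by auto
    have H: "subgroup (\<psi> ` carrier ?Z) ?Q"
      by (rule \<psi>.subgroup_img_is_subgroup[OF \<psi>.G.subgroup_self])
    have "(\<lambda>x. N #> x) ` (t ` I \<union> N) \<subseteq> \<psi> ` carrier ?Z"
    proof (rule image_subsetI)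
      fix x assume "x \<in> t ` I \<union> N"
      then show "N #> x \<in> \<psi> ` carrier ?Z"
      proof
        assume "x \<in> t ` I"
        then obtain i where i: "i \<in> I" "x = t i" by blast
        then have "N #> x = \<psi> (frag_of i)" using \<psi>(2) by simp
        moreover have "frag_of i \<in> carrier ?Z" using i by simp
        ultimately show ?thesis by (rule image_eqI)
      next
        assume "x \<in> N"
        then show ?thesis using coset_N subgroup.one_closed[OF H] by simp
      qed
    qed
    then show "carrier ?Q \<subseteq> \<psi> ` carrier ?Z"
      unfolding genQ[symmetric] by (rule Q.generate_subgroup_incl[OF _ H])
  qed
  have coord: "\<exists>cb. cb \<in> hom ?Q integer_group \<and> (\<forall>x\<in>carrier G. cb (N #> x) = c i x)" if i: "i \<in> I" for i
  proof -
    interpret ci: group_hom G integer_group "c i"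
      by (intro group_hom.intro group_hom_axioms.intro group_axioms c_hom[OF i]) simp
    have "N \<subseteq> kernel G integer_group (c i)" using c_N[OF i] N.subset by (auto simp: kernel_def)
    then show ?thesis using ci.FactGroup_universal_kernel[OF N] by metis
  qed
  have lookup: "c i x = poly_mapping.lookup v i"
    if i: "i \<in> I" and v: "v \<in> carrier ?Z" and x: "x \<in> carrier G" "N #> x = \<psi> v" for i v x
  proof -
    obtain cb where cb: "cb \<in> hom ?Q integer_group" "\<And>x. x \<in> carrier G \<Longrightarrow> cb (N #> x) = c i x"
      using coord[OF i] by blast
    have "cb (\<psi> v) = poly_mapping.lookup v i"
    proof (rule free_Abelian_group_hom_eqI[OF group_integer_group _ _ _ v])
      show "(\<lambda>v. cb (\<psi> v)) \<in> hom ?Z integer_group"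
        using Group.hom_compose[OF \<psi>(1) cb(1)] by (simp add: comp_def)
      show "(\<lambda>v. poly_mapping.lookup v i) \<in> hom ?Z integer_group"
        by (rule homI) (simp_all add: lookup_add)
      show "cb (\<psi> (frag_of j)) = poly_mapping.lookup (frag_of j) i" if "j \<in> I" for j
        using cb(2)[of "t j"] t \<psi>(2)[OF that] c_t[OF i that] that by auto
    qed
    then show ?thesis using cb(2)[OF x(1)] x(2) by simp
  qed
  show "x \<in> N" if x: "x \<in> carrier G" and 0: "\<And>i. i \<in> I \<Longrightarrow> c i x = 0" for x
  proof -
    have "N #> x \<in> carrier ?Q" using x by (auto simp: carrier_FactGroup)
    then obtain v where v: "v \<in> carrier ?Z" "N #> x = \<psi> v" using surj by (metis imageE)
    have "poly_mapping.lookup v i = 0" for i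
    proof (cases "i \<in> I")
      case True
      then show ?thesis using lookup[OF True v(1) x v(2)] 0 by simp
    next
      case False
      then have "i \<notin> Poly_Mapping.keys v" using v(1) by auto
      then show ?thesis by (simp add: in_keys_iff)
    qed
    then have "v = 0" by (intro poly_mapping_eqI) simp
    then have "N #> x = N" using v(2) \<psi>.hom_one by simp
    then show ?thesis using rcos_self[OF x N.subgroup_axioms] by simp
  qed
  have "inj_on \<psi> (carrier ?Z)"
  proof (rule inj_onI)
    fix v w assume v: "v \<in> carrier ?Z" and w: "w \<in> carrier ?Z" and eq: "\<psi> v = \<psi> w"
    obtain x where x: "x \<in> carrier G" "\<psi> v = N #> x"
      using \<psi>.hom_closed[OF v] by (auto simp: carrier_FactGroup)
    have "poly_mapping.lookup v i = poly_mapping.lookup w i" for i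
    proof (cases "i \<in> I")
      case True
      then show ?thesis using lookup[OF True v x(1)] lookup[OF True w x(1)] x(2) eq by simp
    next
      case False
      then have "i \<notin> Poly_Mapping.keys v" "i \<notin> Poly_Mapping.keys w" using v w by auto
      then show ?thesis by (simp add: in_keys_iff)
    qed
    then show "v = w" by (intro poly_mapping_eqI)
  qed
  then have "\<psi> \<in> iso ?Z ?Q" using \<psi>(1) surj by (simp add: iso_def bij_betw_def)
  then show "?Z \<cong> ?Q" by (rule is_isoI)
qed

section \<open>Multiplication by a commutator\<close>

text \<open>The automorphism \<open>x\<^sub>i \<mapsto> x\<^sub>i [u, v]\<close>.\<close>

definition comm_mult :: "gen set \<Rightarrow> nat \<Rightarrow> gen \<times> bool \<Rightarrow> gen \<times> bool \<Rightarrow> gen word \<Rightarrow> gen word" where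
  "comm_mult S i u v = replace_gen S (GX i) [(GX i, True), u, v, flip u, flip v]"

lemma subst_comm_mult:
  assumes "fst u \<noteq> GX i" "fst v \<noteq> GX i"
  shows "subst (gen_word(GX i := [(GX i, True), u, v, flip u, flip v])) [(GX i, True), v, u, flip v, flip u]
    = [(GX i, True)]"
proof -
  obtain a d b e where uv: "u = (a, d)" "v = (b, e)" by (cases u; cases v) auto
  show ?thesis
    by (cases "a = b"; cases d; cases e) (use assms in \<open>simp_all add: uv word_simps\<close>)
qed

lemma realizes_comm_mult:
  assumes "GX i \<in> S" "fst u \<in> S" "fst v \<in> S" "fst u \<noteq> GX i" "fst v \<noteq> GX i"
  shows "realizes S (comm_mult S i u v) (gen_word(GX i := [(GX i, True), u, v, flip u, flip v]))"
proof -
  have "replace_gen S (GX i) [(GX i, True), u, v, flip u, flip v] \<in> auto (free_group S)"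
    by (rule replace_gen_auto[where w' = "[(GX i, True), v, u, flip v, flip u]"])
       (use assms subst_comm_mult in simp_all)
  then show ?thesis unfolding realizes_def comm_mult_def by (simp add: replace_gen_def)
qed

lemmas realizes_comm_intros = realizes_intros realizes_comm_mult

lemma inv_comm_mult:
  assumes "GX i \<in> S" "fst u \<in> S" "fst v \<in> S" "fst u \<noteq> GX i" "fst v \<noteq> GX i"
  shows "inv\<^bsub>\<AA> S\<^esub> (comm_mult S i u v) = comm_mult S i v u"
proof (rule inv_AutoGroup_eq[OF realizes_comm_mult realizes_comm_mult])
  fix a assume "a \<in> S"
  show "subst (gen_word(GX i := [(GX i, True), v, u, flip v, flip u]))
      ((gen_word(GX i := [(GX i, True), u, v, flip u, flip v])) a) = [(a, True)]"
    using subst_comm_mult[of v i u] assms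
    by (cases "a = GX i") (simp_all add: gen_word_def reduce_reduced)
qed (use assms in simp_all)

text \<open>The identities whose names begin with \<open>R_\<close> describe how \<open>right_mult S a (GY q, e)\<close>, the map \<open>x\<^sub>a \<mapsto> x\<^sub>a y\<^sub>q\<^sup>e\<close>, passes
  automorphisms that act trivially on the abelianization. The factors arising on its left act trivially
  as well, and each is either known to lie in the subgroup \<open>L\<close> defined below or occurs as a conjugator
  together with its inverse.\<close>

locale comm_identities =
  fixes n k :: nat and S
  defines "S \<equiv> gens n k"
begin

abbreviation mult (infixl "\<star>" 70) where "u \<star> v \<equiv> u \<otimes>\<^bsub>\<AA> S\<^esub> v"

lemma S_iff: "GX i \<in> S \<longleftrightarrow> i < n" "GY j \<in> S \<longleftrightarrow> j < k"
  by (simp_all add: S_def)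

text \<open>Commutators of inverse letters are conjugate to inverses of commutators of letters, as in
  \<open>[u, v\<inverse>] = v\<inverse> [v, u] v\<close>; on the level of automorphisms the conjugation is realized by a
  partial conjugation.\<close>

lemma comm_mult_conj_yy:
  assumes "i < n" "j < k" "l < k" "j \<noteq> l"
  shows "comm_mult S i (GY j, d) (GY l, e) \<star> part_conj S (GY j) (GY l, e)
    = part_conj S (GY j) (GY l, e) \<star> comm_mult S i (GY l, \<not> e) (GY j, d)"
  by (rule realizes_eq, (rule realizes_comm_intros | (use assms in \<open>simp add: S_iff\<close>; fail))+)
     (use assms in \<open>auto simp: word_simps\<close>)

lemma comm_mult_conj_xy:
  assumes "i < n" "h < n" "j < k" "h \<noteq> i"
  shows "comm_mult S i (GY j, e) (GX h, True) \<star> part_conj S (GX h) (GY j, e)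
    = part_conj S (GX h) (GY j, e) \<star> comm_mult S i (GX h, True) (GY j, \<not> e)"
  by (rule realizes_eq, (rule realizes_comm_intros | (use assms in \<open>simp add: S_iff\<close>; fail))+)
     (use assms in \<open>auto simp: word_simps\<close>)

lemma R_part_conj_X:
  assumes "a < n" "j < k" "q < k"
  shows "right_mult S a (GY q, e) \<star> part_conj S (GX a) (GY j, d)
    = part_conj S (GX a) (GY j, d) \<star> comm_mult S a (GY j, d) (GY q, e) \<star> right_mult S a (GY q, e)"
  by (rule realizes_eq, (rule realizes_comm_intros | (use assms in \<open>simp add: S_iff\<close>; fail))+)
     (use assms in \<open>auto simp: word_simps\<close>)

lemma R_part_conj_Y_same:
  assumes "a < n" "q < k" "fst v \<in> S" "fst v \<noteq> GX a" "fst v \<noteq> GY q"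
  shows "right_mult S a (GY q, e) \<star> part_conj S (GY q) v
    = comm_mult S a (GY q, e) v \<star> part_conj S (GY q) v \<star> right_mult S a (GY q, e)"
  by (cases v, rule realizes_eq, (rule realizes_comm_intros | (use assms in \<open>simp add: S_iff\<close>; fail))+)
     (use assms in \<open>auto simp: word_simps\<close>)

lemma R_part_conj_Y_same_X:
  assumes "a < n" "q < k"
  shows "right_mult S a (GY q, e) \<star> part_conj S (GY q) (GX a, True)
    = part_conj S (GY q) (GX a, True) \<star> part_conj S (GX a) (GY q, e) \<star> right_mult S a (GY q, e)"
  by (rule realizes_eq, (rule realizes_comm_intros | (use assms in \<open>simp add: S_iff\<close>; fail))+)
     (use assms in \<open>auto simp: word_simps\<close>)

lemma R_part_conj_Y_X:
  assumes "a < n" "q < k" "j < k" "j \<noteq> q"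
  shows "right_mult S a (GY q, e) \<star> part_conj S (GY j) (GX a, True)
    = part_conj S (GY j) (GY q, e) \<star> part_conj S (GY j) (GX a, True) \<star> right_mult S a (GY q, e)"
  by (rule realizes_eq, (rule realizes_comm_intros | (use assms in \<open>simp add: S_iff\<close>; fail))+)
     (use assms in \<open>auto simp: word_simps\<close>)

lemma R_comm_mult_conj_both:
  assumes "a < n" "q < k" "fst u \<in> S" "fst v \<in> S" "fst u \<noteq> GX a" "fst v \<noteq> GX a" "fst u \<noteq> GY q" "fst v \<noteq> GY q"
    "fst u \<noteq> fst v"
  shows "right_mult S a (GY q, e) \<star> comm_mult S a u v
    = (part_conj S (fst u) (GY q, e) \<star> part_conj S (fst v) (GY q, e)) \<star> comm_mult S a u v \<star>
      (part_conj S (fst v) (GY q, \<not> e) \<star> part_conj S (fst u) (GY q, \<not> e)) \<star> right_mult S a (GY q, e)"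
  by (cases u, cases v, rule realizes_eq, (rule realizes_comm_intros | (use assms in \<open>simp add: S_iff\<close>; fail))+)
     (use assms in \<open>auto simp: word_simps\<close>)

lemma R_comm_mult_conj_fst:
  assumes "a < n" "q < k" "fst u \<in> S" "fst u \<noteq> GX a" "fst u \<noteq> GY q"
  shows "right_mult S a (GY q, e) \<star> comm_mult S a u (GY q, d)
    = part_conj S (fst u) (GY q, e) \<star> comm_mult S a u (GY q, d) \<star> part_conj S (fst u) (GY q, \<not> e)
      \<star> right_mult S a (GY q, e)"
  by (cases u, rule realizes_eq, (rule realizes_comm_intros | (use assms in \<open>simp add: S_iff\<close>; fail))+)
     (use assms in \<open>auto simp: word_simps\<close>)

lemma R_comm_mult_conj_snd:
  assumes "a < n" "q < k" "fst u \<in> S" "fst u \<noteq> GX a" "fst u \<noteq> GY q"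
  shows "right_mult S a (GY q, e) \<star> comm_mult S a (GY q, d) u
    = part_conj S (fst u) (GY q, e) \<star> comm_mult S a (GY q, d) u \<star> part_conj S (fst u) (GY q, \<not> e)
      \<star> right_mult S a (GY q, e)"
  by (cases u, rule realizes_eq, (rule realizes_comm_intros | (use assms in \<open>simp add: S_iff\<close>; fail))+)
     (use assms in \<open>auto simp: word_simps\<close>)

lemma R_comm_mult_expand:
  assumes "a < n" "i < n" "q < k" "j < k" "i \<noteq> a" "j \<noteq> q"
  shows "right_mult S a (GY q, e) \<star> comm_mult S i (GX a, True) (GY j, True)
    = (part_conj S (GY q) (GX a, True) \<star> part_conj S (GY j) (GX a, True)) \<star> comm_mult S i (GY q, e) (GY j, True) \<star>
      (part_conj S (GY j) (GX a, False) \<star> part_conj S (GY q) (GX a, False)) \<star> comm_mult S i (GX a, True) (GY j, True)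
      \<star> right_mult S a (GY q, e)"
  by (rule realizes_eq, (rule realizes_comm_intros | (use assms in \<open>simp add: S_iff\<close>; fail))+)
     (use assms in \<open>auto simp: word_simps\<close>)

lemma R_comm_mult_same:
  assumes "a < n" "i < n" "q < k" "i \<noteq> a"
  shows "right_mult S a (GY q, e) \<star> comm_mult S i (GX a, True) (GY q, True)
    = comm_mult S i (GX a, True) (GY q, True) \<star> right_mult S a (GY q, e)"
  by (rule realizes_eq, (rule realizes_comm_intros | (use assms in \<open>simp add: S_iff\<close>; fail))+)
     (use assms in \<open>auto simp: word_simps\<close>)

lemma R_comm_mult_commute:
  assumes "a < n" "i < n" "q < k" "i \<noteq> a" "fst u \<in> S" "fst v \<in> S" "fst u \<noteq> GX i" "fst v \<noteq> GX i"
    "fst u \<noteq> GX a" "fst v \<noteq> GX a"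
  shows "right_mult S a (GY q, e) \<star> comm_mult S i u v = comm_mult S i u v \<star> right_mult S a (GY q, e)"
  by (cases u, cases v, rule realizes_eq, (rule realizes_comm_intros | (use assms in \<open>simp add: S_iff\<close>; fail))+)
     (use assms in \<open>auto simp: word_simps\<close>)

text \<open>Multiplications of \<open>x\<^sub>i\<close> by different \<open>y\<close> letters commute up to multiplication by a commutator.\<close>

lemma right_mult_swap:
  assumes "i < n" "j < k" "l < k"
  shows "right_mult S i (GY j, True) \<star> right_mult S i (GY l, True)
    = comm_mult S i (GY j, True) (GY l, True) \<star> right_mult S i (GY l, True) \<star> right_mult S i (GY j, True)"
  by (rule realizes_eq, (rule realizes_comm_intros | (use assms in \<open>simp add: S_iff\<close>; fail))+)
     (use assms in \<open>auto simp: word_simps\<close>)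

end

lemma comm_mult_K_aut:
  assumes "i < n" "fst u \<in> gens n k" "fst v \<in> gens n k" "fst u \<noteq> GX i" "fst v \<noteq> GX i"
    and y: "(\<exists>j. fst u = GY j) \<or> (\<exists>j. fst v = GY j)"
  shows "comm_mult (gens n k) i u v \<in> K_aut n k"
proof (rule K_autI)
  have r: "realizes (gens n k) (comm_mult (gens n k) i u v) (gen_word(GX i := [(GX i, True), u, v, flip u, flip v]))"
    using assms by (intro realizes_comm_mult) auto
  show "comm_mult (gens n k) i u v \<in> auto (Fnk n k)" using r by (rule realizes_auto)
  show "\<exists>g\<in>carrier (Fnk n k). comm_mult (gens n k) i u v [(GY l, True)] = reduce (g @ [(GY l, True)] @ winv g)"
    if "l < k" for l
    using realizes_apply[OF r, of "GY l"] that
    by (intro bexI[of _ "[]"]) (auto simp: gen_word_def carrier_free_group)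
  show "kill_y (comm_mult (gens n k) i u v [(GX h, True)]) = [(GX h, True)]" if h: "h < n" for h
  proof (cases "h = i")
    case True
    have "kill_y (reduce [(GX i, True), u, v, flip u, flip v]) = kill_y [(GX i, True), u, v, flip u, flip v]"
      by (simp add: kill_y_eq_subst)
    also have "\<dots> = [(GX i, True)]"
      using y assms(4,5)
      by (cases "fst u"; cases "fst v"; cases u; cases v) (auto simp: kill_y_def reduce_def)
    finally show ?thesis using realizes_apply[OF r, of "GX h"] h True by simp
  next
    case False
    then show ?thesis using realizes_apply[OF r, of "GX h"] h by (auto simp: gen_word_def reduce_reduced)
  qed
qed

lemma comm_mult_self:
  assumes "i < n" "q < k"
  shows "comm_mult (gens n k) i (GY q, d) (GY q, e) = \<one>\<^bsub>\<AA> (gens n k)\<^esub>"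
proof (rule realizes_eq[OF realizes_comm_mult realizes_one])
  show "reduce ((gen_word(GX i := [(GX i, True), (GY q, d), (GY q, e), flip (GY q, d), flip (GY q, e)])) a)
      = reduce (gen_word a)" for a
    by (cases d; cases e) (auto simp: word_simps)
qed (use assms in auto)

section \<open>Automorphisms in the kernel acting trivially on the abelianization\<close>

context free_factor
begin

definition "J = K_aut n k \<inter> IA n k"

lemma subgroup_J: "subgroup J (\<AA> S)"
  unfolding J_def by (rule A.subgroups_Inter_pair[OF subgroup_K_aut subgroup_IA])

lemma K_IA_eq: "K_IA n k = (\<AA> S)\<lparr>carrier := J\<rparr>"
  by (simp add: K_IA_def J_def)

lemma carrier_K_IA: "carrier (K_IA n k) = J"
  by (simp add: K_IA_eq)

lemma group_K_IA: "group (K_IA n k)"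
  unfolding K_IA_eq by (rule A.subgroup_imp_group[OF subgroup_J])

definition "DJ = derived (\<AA> S) J"

lemma commutator_K_IA: "commutator (K_IA n k) = DJ"
  unfolding commutator_eq_derived DJ_def K_IA_eq using A.derived_consistent[OF subset_refl subgroup_J] by simp

text \<open>An element of \<open>J\<close> multiplies \<open>x\<^sub>i\<close> by a product of commutators that becomes trivial when the \<open>y\<^sub>j\<close>
  are killed, and conjugates \<open>y\<^sub>j\<close>. So the value of its Johnson homomorphism at \<open>x\<^sub>i\<close> is a combination
  of elements \<open>x\<^sub>h \<and> y\<^sub>j\<close> and \<open>y\<^sub>j \<and> y\<^sub>l\<close>, and the value at \<open>y\<^sub>j\<close> one of elements \<open>a \<and> y\<^sub>j\<close>. The triples
  \<open>(t, a, b)\<close> below stand for the coefficient of \<open>a \<and> b\<close> in the value at \<open>t\<close>.\<close>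

definition "johnson_index = {(GX i, GX h, GY j) | i h j. i < n \<and> h < n \<and> j < k}
  \<union> {(GX i, GY j, GY l) | i j l. i < n \<and> j < l \<and> l < k}
  \<union> {(GY j, GX i, GY j) | i j. i < n \<and> j < k}
  \<union> {(GY j, GY l, GY j) | j l. j < k \<and> l < k \<and> l \<noteq> j}"

text \<open>For each triple an automorphism whose Johnson homomorphism takes the value \<open>a \<and> b\<close> at \<open>t\<close>. In the first case
  the conjugating letter is inverse because \<open>y\<inverse> x y x\<inverse>\<close> projects to \<open>x \<and> y\<close> and not to its inverse.\<close>

fun johnson_gen :: "gen \<times> gen \<times> gen \<Rightarrow> gen word \<Rightarrow> gen word" where
  "johnson_gen (GX i, a, b) = (if a = GX i then part_conj S (GX i) (b, False) else comm_mult S i (a, True) (b, True))"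
| "johnson_gen (GY j, a, b) = part_conj S (GY j) (a, True)"

text \<open>The commutators are included so that conjugation by elements of \<open>J\<close> can be ignored; the aim is
  to show that \<open>L\<close> is all of \<open>J\<close>.\<close>

definition "L = generate (\<AA> S) (johnson_gen ` johnson_index \<union> DJ)"

lemma IA_of_realizes:
  assumes r: "realizes S f \<phi>" and e: "\<And>a b. a \<in> S \<Longrightarrow> expo b (\<phi> a) = expo b [(a, True)]"
  shows "f \<in> IA n k"
  by (rule IA_I[OF realizes_auto[OF r]]) (simp only: realizes_apply[OF r] expo_reduce e)

lemma part_conj_J:
  assumes "x \<in> S" "fst v \<in> S" "fst v \<noteq> x" "\<And>i. x = GX i \<Longrightarrow> \<exists>j. fst v = GY j"
  shows "part_conj S x v \<in> J"
  unfolding J_def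
proof
  show "part_conj S x v \<in> K_aut n k" using assms by (rule part_conj_K_aut)
  show "part_conj S x v \<in> IA n k"
    by (rule IA_of_realizes[OF realizes_part_conj[OF assms(1-3)]])
       (auto simp: gen_word_def letter_sign_def)
qed

lemma comm_mult_J:
  assumes "i < n" "fst u \<in> S" "fst v \<in> S" "fst u \<noteq> GX i" "fst v \<noteq> GX i"
    and y: "(\<exists>j. fst u = GY j) \<or> (\<exists>j. fst v = GY j)"
  shows "comm_mult S i u v \<in> J"
  unfolding J_def
proof
  show "comm_mult S i u v \<in> K_aut n k" using assms by (rule comm_mult_K_aut)
  have "realizes S (comm_mult S i u v) (gen_word(GX i := [(GX i, True), u, v, flip u, flip v]))"
    using assms by (intro realizes_comm_mult) auto
  then show "comm_mult S i u v \<in> IA n k"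
    by (rule IA_of_realizes) (auto simp: gen_word_def letter_sign_def)
qed

lemma johnson_index_cases:
  assumes "x \<in> johnson_index"
  obtains i j where "x = (GX i, GX i, GY j)" "i < n" "j < k" "johnson_gen x = part_conj S (GX i) (GY j, False)"
  | i h j where "x = (GX i, GX h, GY j)" "i < n" "h < n" "h \<noteq> i" "j < k"
      "johnson_gen x = comm_mult S i (GX h, True) (GY j, True)"
  | i j l where "x = (GX i, GY j, GY l)" "i < n" "j < l" "l < k"
      "johnson_gen x = comm_mult S i (GY j, True) (GY l, True)"
  | i j where "x = (GY j, GX i, GY j)" "i < n" "j < k" "johnson_gen x = part_conj S (GY j) (GX i, True)"
  | l j where "x = (GY j, GY l, GY j)" "l < k" "j < k" "l \<noteq> j" "johnson_gen x = part_conj S (GY j) (GY l, True)"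
proof -
  from assms consider
      i h j where "x = (GX i, GX h, GY j)" "i < n" "h < n" "j < k"
    | i j l where "x = (GX i, GY j, GY l)" "i < n" "j < l" "l < k"
    | i j where "x = (GY j, GX i, GY j)" "i < n" "j < k"
    | l j where "x = (GY j, GY l, GY j)" "l < k" "j < k" "l \<noteq> j"
    unfolding johnson_index_def by blast
  then show thesis
  proof cases
    case (1 i h j)
    then show thesis using that(1)[of i j] that(2)[of i h j] by (cases "h = i") simp_all
  next
    case (2 i j l)
    then show thesis using that(3)[of i j l] by simp
  next
    case (3 i j)
    then show thesis using that(4)[of j i] by simp
  next
    case (4 l j)
    then show thesis using that(5)[of j l] by simp
  qed
qed

lemma johnson_index_intros:
  "i < n \<Longrightarrow> h < n \<Longrightarrow> j < k \<Longrightarrow> (GX i, GX h, GY j) \<in> johnson_index"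
  "i < n \<Longrightarrow> j < l \<Longrightarrow> l < k \<Longrightarrow> (GX i, GY j, GY l) \<in> johnson_index"
  "i < n \<Longrightarrow> j < k \<Longrightarrow> (GY j, GX i, GY j) \<in> johnson_index"
  "j < k \<Longrightarrow> l < k \<Longrightarrow> l \<noteq> j \<Longrightarrow> (GY j, GY l, GY j) \<in> johnson_index"
  unfolding johnson_index_def by blast+

lemma johnson_gen_J: assumes "x \<in> johnson_index" shows "johnson_gen x \<in> J"
  using assms by (cases rule: johnson_index_cases) (auto intro!: part_conj_J comm_mult_J)

lemma DJ_J: "DJ \<subseteq> J"
  unfolding DJ_def by (rule A.derived_incl[OF subset_refl subgroup_J])

lemma L_gens_J: "johnson_gen ` johnson_index \<union> DJ \<subseteq> J"
  using johnson_gen_J DJ_J by blast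

lemma L_gens_carrier: "johnson_gen ` johnson_index \<union> DJ \<subseteq> carrier (\<AA> S)"
  using L_gens_J subgroup.subset[OF subgroup_J] by blast

sublocale L: subgroup L "\<AA> S"
  unfolding L_def by (rule A.generate_is_subgroup[OF L_gens_carrier])

lemma L_J: "L \<subseteq> J"
  unfolding L_def by (rule A.generate_subgroup_incl[OF L_gens_J subgroup_J])

lemma L_mult: "s \<in> L \<Longrightarrow> t \<in> L \<Longrightarrow> s \<bullet> t \<in> L"
  by (rule subgroup.m_closed[OF L.subgroup_axioms])

lemma L_inv: "s \<in> L \<Longrightarrow> inv\<^bsub>\<AA> S\<^esub> s \<in> L"
  by (rule subgroup.m_inv_closed[OF L.subgroup_axioms])

lemma johnson_gen_L: "x \<in> johnson_index \<Longrightarrow> johnson_gen x \<in> L"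
  unfolding L_def by (rule generate.incl) blast

lemma J_carrier: "c \<in> J \<Longrightarrow> c \<in> carrier (\<AA> S)"
  using subgroup.subset[OF subgroup_J] by blast

lemma L_carrier: "c \<in> L \<Longrightarrow> c \<in> carrier (\<AA> S)"
  using L_J J_carrier by blast

text \<open>\<open>c s c\<inverse>\<close> is \<open>[c, s] s\<close>. The inverse is a separate variable since in applications it is given explicitly as
  a product of generators.\<close>

lemma conj_L: assumes s: "s \<in> L" and c: "c \<in> J" and c': "c' = inv\<^bsub>\<AA> S\<^esub> c" shows "c \<bullet> s \<bullet> c' \<in> L"
proof -
  have cc: "c \<in> carrier (\<AA> S)" "s \<in> carrier (\<AA> S)" using s c J_carrier L_carrier by auto
  have "c \<bullet> s \<bullet> inv\<^bsub>\<AA> S\<^esub> c \<bullet> inv\<^bsub>\<AA> S\<^esub> s \<in> derived_set (\<AA> S) J" using s c L_J by blast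
  then have "c \<bullet> s \<bullet> inv\<^bsub>\<AA> S\<^esub> c \<bullet> inv\<^bsub>\<AA> S\<^esub> s \<in> DJ" unfolding DJ_def derived_def by (rule generate.incl)
  then have "c \<bullet> s \<bullet> inv\<^bsub>\<AA> S\<^esub> c \<bullet> inv\<^bsub>\<AA> S\<^esub> s \<in> L" unfolding L_def by (intro generate.incl) blast
  then have "(c \<bullet> s \<bullet> inv\<^bsub>\<AA> S\<^esub> c \<bullet> inv\<^bsub>\<AA> S\<^esub> s) \<bullet> s \<in> L" using s by (rule L_mult)
  then show ?thesis using cc c' by (simp add: A.m_assoc)
qed

lemma conj_L_right:
  assumes "s \<bullet> c = c \<bullet> t" "t \<in> L" "c \<in> J" "s \<in> carrier (\<AA> S)" shows "s \<in> L"
proof -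
  have cc: "c \<in> carrier (\<AA> S)" "t \<in> carrier (\<AA> S)" using assms J_carrier L_carrier by auto
  have "s = (s \<bullet> c) \<bullet> inv\<^bsub>\<AA> S\<^esub> c" using cc assms(4) by (simp add: A.m_assoc)
  also have "\<dots> = c \<bullet> t \<bullet> inv\<^bsub>\<AA> S\<^esub> c" by (simp only: assms(1))
  finally show ?thesis using conj_L[OF assms(2,3) refl] by simp
qed

lemma part_conj_X_L: assumes "i < n" "j < k" shows "part_conj S (GX i) (GY j, e) \<in> L"
proof -
  have F: "part_conj S (GX i) (GY j, False) \<in> L"
    using johnson_gen_L[OF johnson_index_intros(1)[of i i j]] assms by simp
  then have "inv\<^bsub>\<AA> S\<^esub> (part_conj S (GX i) (GY j, False)) \<in> L" by (rule L_inv)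
  then show ?thesis using F assms by (cases e) (simp_all add: inv_part_conj)
qed

lemma part_conj_Y_L: assumes "j < k" "a \<in> S" "a \<noteq> GY j" shows "part_conj S (GY j) (a, e) \<in> L"
proof -
  have T: "part_conj S (GY j) (a, True) \<in> L"
    using assms(2)
  proof (cases rule: gens_cases)
    case (X i)
    then show ?thesis using johnson_gen_L[OF johnson_index_intros(3)[of i j]] assms by simp
  next
    case (Y l)
    then show ?thesis using johnson_gen_L[OF johnson_index_intros(4)[of j l]] assms by simp
  qed
  then have "inv\<^bsub>\<AA> S\<^esub> (part_conj S (GY j) (a, True)) \<in> L" by (rule L_inv)
  then show ?thesis using T assms by (cases e) (simp_all add: inv_part_conj)
qed

interpretation I: comm_identities n k S
  by unfold_locales

lemma comm_mult_L_swap: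
  assumes "comm_mult S i u v \<in> L" "i < n" "fst u \<in> S" "fst v \<in> S" "fst u \<noteq> GX i" "fst v \<noteq> GX i"
  shows "comm_mult S i v u \<in> L"
  using L_inv[OF assms(1)] assms by (simp add: inv_comm_mult)

text \<open>Only commutators of positive letters in increasing order are among the generators. Exchanging the
  letters inverts the automorphism, and changing the sign of the second letter exchanges them up to a
  partial conjugation.\<close>

lemma comm_mult_yy_L: assumes "i < n" "j < k" "l < k" "j \<noteq> l" shows "comm_mult S i (GY j, d) (GY l, e) \<in> L"
proof -
  have TT: "comm_mult S i (GY j, True) (GY l, True) \<in> L" if "j < k" "l < k" "j \<noteq> l" for j l
  proof -
    have lt: "comm_mult S i (GY j, True) (GY l, True) \<in> L" if "j < l" "l < k" for j l
      using johnson_gen_L[OF johnson_index_intros(2)[of i j l]] that assms(1) by simp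
    show ?thesis
    proof (cases "j < l")
      case True
      then show ?thesis using lt that by blast
    next
      case False
      then have "comm_mult S i (GY l, True) (GY j, True) \<in> L" using lt[of l j] that by simp
      then show ?thesis by (rule comm_mult_L_swap) (use assms that in auto)
    qed
  qed
  have step: "comm_mult S i (GY j, d) (GY l, e) \<in> L"
    if *: "comm_mult S i (GY l, \<not> e) (GY j, d) \<in> L" and jl: "j < k" "l < k" "j \<noteq> l" for j l d e
  proof (rule conj_L_right[OF I.comm_mult_conj_yy[OF assms(1) jl] *])
    show "part_conj S (GY j) (GY l, e) \<in> J" using jl by (intro part_conj_J) auto
    have "comm_mult S i (GY j, d) (GY l, e) \<in> J" using jl assms(1) by (intro comm_mult_J) auto
    then show "comm_mult S i (GY j, d) (GY l, e) \<in> carrier (\<AA> S)" by (rule J_carrier)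
  qed
  have TF: "comm_mult S i (GY j, True) (GY l, False) \<in> L" if "j < k" "l < k" "j \<noteq> l" for j l
    using step[of l False j True] TT[of l j] that by simp
  have FT: "comm_mult S i (GY j, False) (GY l, True) \<in> L" if jl: "j < k" "l < k" "j \<noteq> l" for j l
    by (rule comm_mult_L_swap[OF TF]) (use jl assms(1) in auto)
  have FF: "comm_mult S i (GY j, False) (GY l, False) \<in> L" if "j < k" "l < k" "j \<noteq> l" for j l
    using step[of l False j False] TF[of l j] that by simp
  show ?thesis using TT TF FT FF assms by (cases d; cases e) simp_all
qed

lemma comm_mult_xy_L: assumes "i < n" "h < n" "h \<noteq> i" "j < k"
  shows "comm_mult S i (GX h, True) (GY j, True) \<in> L" "comm_mult S i (GY j, e) (GX h, True) \<in> L"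
proof -
  show T: "comm_mult S i (GX h, True) (GY j, True) \<in> L"
    using johnson_gen_L[OF johnson_index_intros(1)[of i h j]] assms by simp
  show "comm_mult S i (GY j, e) (GX h, True) \<in> L"
  proof (cases e)
    case True
    then show ?thesis using comm_mult_L_swap[OF T] assms by simp
  next
    case False
    have "comm_mult S i (GY j, False) (GX h, True) \<in> L"
    proof (rule conj_L_right[OF I.comm_mult_conj_xy[OF assms(1,2,4,3)]])
      show "comm_mult S i (GX h, True) (GY j, \<not> False) \<in> L" using T by simp
      show "part_conj S (GX h) (GY j, False) \<in> J" using assms by (intro part_conj_J) auto
      have "comm_mult S i (GY j, False) (GX h, True) \<in> J" using assms by (intro comm_mult_J) auto
      then show "comm_mult S i (GY j, False) (GX h, True) \<in> carrier (\<AA> S)" by (rule J_carrier)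
    qed
    then show ?thesis using False by simp
  qed
qed

lemma conj_by_part_conj_L:
  assumes "s \<in> L" "x \<in> S" "a \<in> S" "a \<noteq> x" "\<And>i. x = GX i \<Longrightarrow> \<exists>j. a = GY j"
  shows "part_conj S x (a, e) \<bullet> s \<bullet> part_conj S x (a, \<not> e) \<in> L"
  by (rule conj_L[OF assms(1)]) (use assms in \<open>auto intro!: part_conj_J simp: inv_part_conj\<close>)

lemma conj_by_part_conj_L2:
  assumes "s \<in> L" "x \<in> S" "a \<in> S" "a \<noteq> x" "\<And>i. x = GX i \<Longrightarrow> \<exists>j. a = GY j"
    "x' \<in> S" "a \<noteq> x'" "\<And>i. x' = GX i \<Longrightarrow> \<exists>j. a = GY j"
  shows "(part_conj S x (a, e) \<bullet> part_conj S x' (a, e)) \<bullet> s \<bullet>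
    (part_conj S x' (a, \<not> e) \<bullet> part_conj S x (a, \<not> e)) \<in> L"
proof (rule conj_L[OF assms(1)])
  have p: "part_conj S x (a, e) \<in> J" "part_conj S x' (a, e) \<in> J"
    using assms by (auto intro!: part_conj_J)
  then show "part_conj S x (a, e) \<bullet> part_conj S x' (a, e) \<in> J"
    by (rule subgroup.m_closed[OF subgroup_J])
  show "part_conj S x' (a, \<not> e) \<bullet> part_conj S x (a, \<not> e)
      = inv\<^bsub>\<AA> S\<^esub> (part_conj S x (a, e) \<bullet> part_conj S x' (a, e))"
    using p J_carrier assms by (simp add: A.inv_mult_group inv_part_conj)
qed

text \<open>An automorphism that does not involve \<open>x\<^sub>a\<close> and does not move \<open>y\<^sub>q\<close> commutes with the transvection. In the other cases the identities above express the conjugate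
  through elements of \<open>L\<close> and conjugates of such by elements of \<open>J\<close>.\<close>

lemma right_mult_push_johnson_gen:
  assumes a: "a < n" "q < k" and x: "x \<in> johnson_index"
  shows "\<exists>t\<in>L. right_mult S a (GY q, e) \<bullet> johnson_gen x = t \<bullet> right_mult S a (GY q, e)"
proof -
  let ?R = "right_mult S a (GY q, e)"
  have sL: "johnson_gen x \<in> L" using x by (rule johnson_gen_L)
  from x show ?thesis
  proof (cases rule: johnson_index_cases)
    case (1 i j)
    show ?thesis
    proof (cases "i = a")
      case True
      have "comm_mult S a (GY j, False) (GY q, e) \<in> L"
        using comm_mult_yy_L[of a j q False e] comm_mult_self[of a n q k False e] a 1 True subgroup.one_closed[OF L.subgroup_axioms]
        by (cases "j = q") auto
      then have "part_conj S (GX a) (GY j, False) \<bullet> comm_mult S a (GY j, False) (GY q, e) \<in> L"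
        using part_conj_X_L a 1 by (intro L_mult) auto
      then show ?thesis unfolding 1(4) True I.R_part_conj_X[OF a(1) 1(3) a(2)] by blast
    next
      case False
      have "?R \<bullet> johnson_gen x = johnson_gen x \<bullet> ?R"
        unfolding 1(4) by (rule right_mult_part_conj_commute) (use a 1 False in auto)
      then show ?thesis using sL by blast
    qed
  next
    case (2 i h j)
    consider "i = a" "j = q" | "i = a" "j \<noteq> q" | "h = a" "j = q" | "h = a" "j \<noteq> q" | "i \<noteq> a" "h \<noteq> a" by blast
    then show ?thesis
    proof cases
      case c: 1
      have "part_conj S (GX h) (GY q, e) \<bullet> johnson_gen x \<bullet> part_conj S (GX h) (GY q, \<not> e) \<in> L"
        using sL 2 a by (intro conj_by_part_conj_L) auto
      then show ?thesis
        using I.R_comm_mult_conj_fst[OF a, of "(GX h, True)" e True] 2 c by auto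
    next
      case c: 2
      have "(part_conj S (GX h) (GY q, e) \<bullet> part_conj S (GY j) (GY q, e)) \<bullet> johnson_gen x \<bullet>
          (part_conj S (GY j) (GY q, \<not> e) \<bullet> part_conj S (GX h) (GY q, \<not> e)) \<in> L"
        using sL 2 a c by (intro conj_by_part_conj_L2) auto
      then show ?thesis
        using I.R_comm_mult_conj_both[OF a, of "(GX h, True)" "(GY j, True)" e] 2 c by auto
    next
      case c: 3
      then show ?thesis using I.R_comm_mult_same[OF a(1) 2(2) a(2), of e] 2 sL by auto
    next
      case c: 4
      have "(part_conj S (GY q) (GX a, True) \<bullet> part_conj S (GY j) (GX a, True)) \<bullet> comm_mult S i (GY q, e) (GY j, True) \<bullet>
          (part_conj S (GY j) (GX a, \<not> True) \<bullet> part_conj S (GY q) (GX a, \<not> True)) \<in> L"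
        using comm_mult_yy_L 2 a c by (intro conj_by_part_conj_L2) auto
      from L_mult[OF this sL] have "(part_conj S (GY q) (GX a, True) \<bullet> part_conj S (GY j) (GX a, True)) \<bullet> comm_mult S i (GY q, e) (GY j, True) \<bullet>
          (part_conj S (GY j) (GX a, False) \<bullet> part_conj S (GY q) (GX a, False)) \<bullet> johnson_gen x \<in> L"
        by simp
      then show ?thesis
        using I.R_comm_mult_expand[OF a(1) 2(2) a(2) 2(5), of e] 2 c by auto
    next
      case c: 5
      have "?R \<bullet> johnson_gen x = johnson_gen x \<bullet> ?R"
        unfolding 2(6) by (rule I.R_comm_mult_commute) (use a 2 c in auto)
      then show ?thesis using sL by blast
    qed
  next
    case (3 i j l)
    consider "i = a" "j = q" | "i = a" "l = q" | "i = a" "j \<noteq> q" "l \<noteq> q" | "i \<noteq> a" by blast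
    then show ?thesis
    proof cases
      case c: 1
      have "part_conj S (GY l) (GY q, e) \<bullet> johnson_gen x \<bullet> part_conj S (GY l) (GY q, \<not> e) \<in> L"
        using sL 3 a c by (intro conj_by_part_conj_L) auto
      then show ?thesis
        using I.R_comm_mult_conj_snd[OF a, of "(GY l, True)" e True] 3 c by auto
    next
      case c: 2
      have "part_conj S (GY j) (GY q, e) \<bullet> johnson_gen x \<bullet> part_conj S (GY j) (GY q, \<not> e) \<in> L"
        using sL 3 a c by (intro conj_by_part_conj_L) auto
      then show ?thesis
        using I.R_comm_mult_conj_fst[OF a, of "(GY j, True)" e True] 3 c by auto
    next
      case c: 3
      have "(part_conj S (GY j) (GY q, e) \<bullet> part_conj S (GY l) (GY q, e)) \<bullet> johnson_gen x \<bullet>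
          (part_conj S (GY l) (GY q, \<not> e) \<bullet> part_conj S (GY j) (GY q, \<not> e)) \<in> L"
        using sL 3 a c by (intro conj_by_part_conj_L2) auto
      then show ?thesis
        using I.R_comm_mult_conj_both[OF a, of "(GY j, True)" "(GY l, True)" e] 3 c by auto
    next
      case c: 4
      have "?R \<bullet> johnson_gen x = johnson_gen x \<bullet> ?R"
        unfolding 3(5) by (rule I.R_comm_mult_commute) (use a 3 c in auto)
      then show ?thesis using sL by blast
    qed
  next
    case (4 i j)
    consider "j = q" "i = a" | "j = q" "i \<noteq> a" | "j \<noteq> q" "i = a" | "j \<noteq> q" "i \<noteq> a" by blast
    then show ?thesis
    proof cases
      case c: 1
      have "johnson_gen x \<bullet> part_conj S (GX a) (GY q, e) \<in> L" using sL part_conj_X_L a by (intro L_mult)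
      then show ?thesis using I.R_part_conj_Y_same_X[OF a, of e] 4 c by auto
    next
      case c: 2
      have "comm_mult S a (GY q, e) (GX i, True) \<bullet> johnson_gen x \<in> L" using sL comm_mult_xy_L(2) a 4 c by (intro L_mult) auto
      then show ?thesis using I.R_part_conj_Y_same[OF a, of "(GX i, True)" e] 4 c by auto
    next
      case c: 3
      have "part_conj S (GY j) (GY q, e) \<bullet> johnson_gen x \<in> L" using sL part_conj_Y_L a 4 c by (intro L_mult) auto
      then show ?thesis using I.R_part_conj_Y_X[OF a 4(3) c(1), of e] 4 c by auto
    next
      case c: 4
      have "?R \<bullet> johnson_gen x = johnson_gen x \<bullet> ?R"
        unfolding 4(4) by (rule right_mult_part_conj_commute) (use a 4 c in auto)
      then show ?thesis using sL by blast
    qed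
  next
    case (5 l j)
    show ?thesis
    proof (cases "j = q")
      case True
      have "comm_mult S a (GY q, e) (GY l, True) \<bullet> johnson_gen x \<in> L" using sL comm_mult_yy_L a 5 True by (intro L_mult) auto
      then show ?thesis using I.R_part_conj_Y_same[OF a, of "(GY l, True)" e] 5 True by auto
    next
      case False
      have "?R \<bullet> johnson_gen x = johnson_gen x \<bullet> ?R"
        unfolding 5(5) by (rule right_mult_part_conj_commute) (use a 5 False in auto)
      then show ?thesis using sL by blast
    qed
  qed
qed

text \<open>Automorphisms preserve the commutator subgroup of the free group, so conjugates of automorphisms
  acting trivially modulo it act trivially, too.\<close>

lemma J_normal: "J \<lhd> (\<AA> S)\<lparr>carrier := K_aut n k\<rparr>"
proof -
  let ?K = "(\<AA> S)\<lparr>carrier := K_aut n k\<rparr>"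
  have K: "group ?K" by (rule A.subgroup_imp_group[OF subgroup_K_aut])
  show ?thesis
  proof (rule group.normal_invI[OF K])
    show "subgroup J ?K"
      by (rule A.subgroup_incl[OF subgroup_J subgroup_K_aut]) (simp add: J_def)
    fix g h assume "g \<in> carrier ?K" and h: "h \<in> J"
    then have g: "g \<in> K_aut n k" by simp
    define g' where "g' = inv\<^bsub>\<AA> S\<^esub> g"
    have inv: "inv\<^bsub>?K\<^esub> g = g'" unfolding g'_def by (rule A.m_inv_consistent[OF subgroup_K_aut g])
    have g'K: "g' \<in> K_aut n k" unfolding g'_def by (rule subgroup.m_inv_closed[OF subgroup_K_aut g])
    have a: "g \<in> auto F" "h \<in> auto F" "g' \<in> auto F"
      using g g'K h by (auto simp: J_def K_aut_iff A_aut_def)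
    have gg': "g (g' z) = z" if "z \<in> carrier F" for z
      unfolding g'_def using a(1) that by (rule auto_inv_right)
    have gh: "g \<bullet> h \<in> auto F" using A.m_closed[of g h] a by (simp add: carrier_AA)
    have ghg: "g \<bullet> h \<bullet> g' \<in> auto F" using A.m_closed[of "g \<bullet> h" g'] gh a by (simp add: carrier_AA)
    have g2: "g d \<in> \<gamma>2" if "d \<in> \<gamma>2" for d
    proof -
      have "ab_class F \<circ> g \<in> hom F Ab"
        using F.ab_class_hom auto_hom[OF a(1)] by (auto simp: hom_def Pi_iff simp del: mult_free_group)
      then have "(ab_class F \<circ> g) d = \<one>\<^bsub>Ab\<^esub>" by (rule F.hom_commutator_one[OF Ab_comm_group _ that])
      then have "\<gamma>2 #>\<^bsub>F\<^esub> g d = \<gamma>2" by (simp add: ab_class_def abelianization_def)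
      then show ?thesis
        using F.rcos_self[OF auto_closed[OF a(1) \<gamma>2_carrier[OF that]] subgroup_\<gamma>2] by simp
    qed
    have "reduce ((g \<bullet> h \<bullet> g') z @ winv z) \<in> \<gamma>2" if z: "z \<in> carrier F" for z
    proof -
      have w: "g' z \<in> carrier F" by (rule auto_closed[OF a(3) z])
      have hw: "h (g' z) \<in> carrier F" by (rule auto_closed[OF a(2) w])
      have d: "reduce (h (g' z) @ winv (g' z)) \<in> \<gamma>2" using h w by (auto simp: J_def IA_iff)
      have "(g \<bullet> h \<bullet> g') z = g (h (g' z))"
        using mult_AutoGroup_apply[OF gh a(3) z] mult_AutoGroup_apply[OF a(1,2) w] by simp
      moreover have "g (reduce (h (g' z) @ winv (g' z))) = reduce (g (h (g' z)) @ winv z)"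
        using auto_mult[OF a(1) hw, of "winv (g' z)"] auto_winv[OF a(1) w] w gg'[OF z] by simp
      ultimately show ?thesis using g2[OF d] by simp
    qed
    then have "g \<bullet> h \<bullet> g' \<in> IA n k" using ghg unfolding IA_iff by blast
    moreover have "g \<bullet> h \<bullet> g' \<in> K_aut n k"
      using g g'K h subgroup.m_closed[OF subgroup_K_aut] unfolding J_def by blast
    ultimately show "g \<otimes>\<^bsub>?K\<^esub> h \<otimes>\<^bsub>?K\<^esub> inv\<^bsub>?K\<^esub> g \<in> J" unfolding inv by (simp add: J_def)
  qed
qed

lemma DJ_normal: "DJ \<lhd> (\<AA> S)\<lparr>carrier := K_aut n k\<rparr>"
proof -
  have JK: "J \<subseteq> K_aut n k" by (simp add: J_def)
  have "derived ((\<AA> S)\<lparr>carrier := K_aut n k\<rparr>) J = DJ"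
    unfolding DJ_def by (rule A.derived_consistent[OF JK subgroup_K_aut])
  then show ?thesis
    using group.derived_is_normal[OF A.subgroup_imp_group[OF subgroup_K_aut] J_normal] by simp
qed

abbreviation "pushes_L \<equiv> A.pushing L"

lemma L_pushes_L: "g \<in> L \<Longrightarrow> g \<in> pushes_L"
  using A.subgroup_pushing_self[OF L.subgroup_axioms] by blast

text \<open>For the commutators of \<open>J\<close> no computation is needed, since the derived subgroup of a normal
  subgroup is normal.\<close>

lemma right_mult_pushes_L: assumes "a < n" "q < k" shows "right_mult S a (GY q, e) \<in> pushes_L"
proof -
  let ?R = "right_mult S a (GY q, e)"
  have RK: "?R \<in> K_aut n k" using assms by (rule right_mult_K_aut)
  have R: "?R \<in> carrier (\<AA> S)" using RK subgroup.subset[OF subgroup_K_aut] by blast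
  have "\<exists>t\<in>L. ?R \<bullet> s = t \<bullet> ?R" if "s \<in> johnson_gen ` johnson_index \<union> DJ" for s
    using that
  proof
    assume "s \<in> johnson_gen ` johnson_index"
    then show ?thesis using right_mult_push_johnson_gen[OF assms] by blast
  next
    assume s: "s \<in> DJ"
    then have sc: "s \<in> carrier (\<AA> S)" using L_gens_carrier by blast
    have "?R \<bullet> s \<bullet> inv\<^bsub>\<AA> S\<^esub> ?R \<in> DJ"
      using normal.inv_op_closed2[OF DJ_normal, of ?R s] RK s A.m_inv_consistent[OF subgroup_K_aut RK] by simp
    then have "?R \<bullet> s \<bullet> inv\<^bsub>\<AA> S\<^esub> ?R \<in> L" unfolding L_def by (intro generate.incl) blast
    moreover have "?R \<bullet> s = (?R \<bullet> s \<bullet> inv\<^bsub>\<AA> S\<^esub> ?R) \<bullet> ?R" using R sc by (simp add: A.m_assoc)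
    ultimately show ?thesis by blast
  qed
  then show ?thesis using A.pushing_generateI[OF R L_gens_carrier] unfolding L_def by blast
qed

lemma K_generators_pushes_L: assumes "s \<in> K_generators n k" shows "s \<in> pushes_L"
  using assms
proof (cases rule: K_generators_cases)
  case (1 i j e)
  then show ?thesis using right_mult_pushes_L by simp
next
  case (2 i j e)
  then show ?thesis using L_pushes_L[OF part_conj_X_L] by simp
next
  case (3 i j e)
  then show ?thesis using L_pushes_L[OF part_conj_Y_L, of j "GX i" e] by simp
next
  case (4 l j e)
  then show ?thesis using L_pushes_L[OF part_conj_Y_L, of j "GY l" e] by simp
qed

lemma K_generators_inv: assumes "s \<in> K_generators n k" shows "inv\<^bsub>\<AA> S\<^esub> s \<in> K_generators n k"
  using assms
proof (cases rule: K_generators_cases)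
  case (1 i j e)
  then have "inv\<^bsub>\<AA> S\<^esub> s = right_mult S i (GY j, \<not> e)" by (simp add: inv_right_mult)
  then show ?thesis using 1 unfolding K_generators_def by blast
next
  case (2 i j e)
  then have "inv\<^bsub>\<AA> S\<^esub> s = part_conj S (GX i) (GY j, \<not> e)" by (simp add: inv_part_conj)
  then show ?thesis using 2 unfolding K_generators_def by blast
next
  case (3 i j e)
  then have "inv\<^bsub>\<AA> S\<^esub> s = part_conj S (GY j) (GX i, \<not> e)" by (simp add: inv_part_conj)
  moreover have "part_conj S (GY j) (GX i, \<not> e) \<in> K_generators n k"
    unfolding K_generators_def using 3 by (intro UnI2 CollectI exI[of _ j] exI[of _ "(GX i, \<not> e)"]) simp
  ultimately show ?thesis by simp
next
  case (4 l j e)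
  then have "inv\<^bsub>\<AA> S\<^esub> s = part_conj S (GY j) (GY l, \<not> e)" by (simp add: inv_part_conj)
  moreover have "part_conj S (GY j) (GY l, \<not> e) \<in> K_generators n k"
    unfolding K_generators_def using 4 by (intro UnI2 CollectI exI[of _ j] exI[of _ "(GY l, \<not> e)"]) simp
  ultimately show ?thesis by simp
qed

lemma K_aut_pushes_L: assumes "g \<in> K_aut n k" shows "g \<in> pushes_L"
  using assms unfolding K_aut_eq K0_def
proof (induction g rule: generate.induct)
  case one
  show ?case by (rule L_pushes_L[OF subgroup.one_closed[OF L.subgroup_axioms]])
next
  case (incl h)
  then show ?case by (rule K_generators_pushes_L)
next
  case (inv h)
  then show ?case by (intro K_generators_pushes_L K_generators_inv)
next
  case (eng h1 h2)
  then show ?case by (intro A.pushing_mult[OF L.subgroup_axioms])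
qed

text \<open>Among the generators of \<open>K\<close> the partial conjugations lie in \<open>L\<close>, so only the transvections
  \<open>x\<^sub>a \<mapsto> x\<^sub>a y\<^sub>q\<close> have to be considered.\<close>

lemma L_normal: "L \<lhd> (\<AA> S)\<lparr>carrier := K_aut n k\<rparr>"
proof (rule group.normal_invI[OF A.subgroup_imp_group[OF subgroup_K_aut]])
  show "subgroup L ((\<AA> S)\<lparr>carrier := K_aut n k\<rparr>)"
    using L_J by (intro A.subgroup_incl[OF L.subgroup_axioms subgroup_K_aut]) (auto simp: J_def)
  fix g h assume "g \<in> carrier ((\<AA> S)\<lparr>carrier := K_aut n k\<rparr>)" and h: "h \<in> L"
  then have g: "g \<in> K_aut n k" by simp
  then have gc: "g \<in> carrier (\<AA> S)" using subgroup.subset[OF subgroup_K_aut] by blast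
  obtain t where t: "t \<in> L" "g \<bullet> h = t \<bullet> g" using K_aut_pushes_L[OF g] h unfolding A.pushing_def by blast
  have "g \<bullet> h \<bullet> inv\<^bsub>\<AA> S\<^esub> g = t" unfolding t(2) using gc L_carrier[OF t(1)] by (simp add: A.m_assoc)
  then show "g \<otimes>\<^bsub>(\<AA> S)\<lparr>carrier := K_aut n k\<rparr>\<^esub> h \<otimes>\<^bsub>(\<AA> S)\<lparr>carrier := K_aut n k\<rparr>\<^esub>
      inv\<^bsub>(\<AA> S)\<lparr>carrier := K_aut n k\<rparr>\<^esub> g \<in> L"
    using t(1) A.m_inv_consistent[OF subgroup_K_aut g] by simp
qed

text \<open>The matrix entries of the action on the abelianization: the coefficient of \<open>y\<^sub>j\<close> in the image of
  \<open>x\<^sub>i\<close>. They are additive on \<open>K\<close>, whose elements act by unipotent block matrices.\<close>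

definition "y_coeff = (\<lambda>(i, j) f. expo (GY j) (f [(GX i, True)]))"

lemma expo_kill_y: "expo (GX h) (kill_y w) = expo (GX h) w"
  unfolding kill_y_def by (induction w) auto

lemma K_aut_expo:
  assumes f: "f \<in> K_aut n k" and z: "z \<in> carrier F"
  shows "expo (GY j) (f z) = expo (GY j) z + (\<Sum>h<n. expo (GX h) z * y_coeff (h, j) f)"
proof -
  have fa: "f \<in> auto F" using f by (simp add: K_aut_iff A_aut_def)
  show ?thesis
  proof (rule free_group_hom_eqI[OF group_integer_group _ _ _ z])
    show "(\<lambda>z. expo (GY j) (f z)) \<in> hom F integer_group"
      by (rule homI) (use auto_mult[OF fa] in simp_all)
    show "(\<lambda>z. expo (GY j) z + (\<Sum>h<n. expo (GX h) z * y_coeff (h, j) f)) \<in> hom F integer_group"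
      by (rule homI) (simp_all add: algebra_simps sum.distrib)
    fix a assume "a \<in> S"
    then show "expo (GY j) (f [(a, True)]) = expo (GY j) [(a, True)]
        + (\<Sum>h<n. expo (GX h) [(a, True)] * y_coeff (h, j) f)"
    proof (cases rule: gens_cases)
      case (X i)
      have "(\<Sum>h<n. expo (GX h) [(GX i, True)] * y_coeff (h, j) f) = (\<Sum>h<n. if h = i then y_coeff (h, j) f else 0)"
        by (rule sum.cong) (auto simp: letter_sign_def)
      then show ?thesis using X by (simp add: y_coeff_def)
    next
      case (Y l)
      then obtain g where "f [(GY l, True)] = reduce (g @ [(GY l, True)] @ winv g)"
        using f unfolding K_aut_iff A_aut_iff by blast
      then show ?thesis using Y by simp
    qed
  qed
qed

lemma y_coeff_mult:
  assumes f: "f \<in> K_aut n k" and g: "g \<in> K_aut n k" and i: "i < n"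
  shows "y_coeff (i, j) (f \<bullet> g) = y_coeff (i, j) f + y_coeff (i, j) g"
proof -
  have fa: "f \<in> auto F" "g \<in> auto F" using f g by (auto simp: K_aut_iff A_aut_def)
  have z: "[(GX i, True)] \<in> carrier F" using i by simp
  have "expo (GX h) (g [(GX i, True)]) = (if h = i then 1 else 0)" for h
  proof -
    have "expo (GX h) (g [(GX i, True)]) = expo (GX h) (kill_y (g [(GX i, True)]))" by (simp add: expo_kill_y)
    also have "\<dots> = expo (GX h) (kill_y [(GX i, True)])" using g z unfolding K_aut_iff by simp
    finally show ?thesis by (simp add: letter_sign_def)
  qed
  then have "(\<Sum>h<n. expo (GX h) (g [(GX i, True)]) * y_coeff (h, j) f) = (\<Sum>h<n. if h = i then y_coeff (h, j) f else 0)"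
    by (intro sum.cong) auto
  then have "expo (GY j) (f (g [(GX i, True)])) = expo (GY j) (g [(GX i, True)]) + y_coeff (i, j) f"
    using K_aut_expo[OF f auto_closed[OF fa(2) z], of j] i by simp
  then show ?thesis using mult_AutoGroup_apply[OF fa z] by (simp add: y_coeff_def)
qed

text \<open>The quotient of \<open>K\<close> by \<open>L\<close> is generated by the commuting classes of the maps \<open>x\<^sub>i \<mapsto> x\<^sub>i y\<^sub>j\<close>, to which the
  coefficients \<open>y_coeff\<close> are dual. As these coefficients vanish on \<open>J\<close>, its elements lie in \<open>L\<close>.\<close>

theorem J_eq_L: "J = L"
proof
  show "L \<subseteq> J" by (rule L_J)
  show "J \<subseteq> L"
  proof
    fix f assume f: "f \<in> J"
    let ?K = "(\<AA> S)\<lparr>carrier := K_aut n k\<rparr>"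
    let ?I = "{..<n} \<times> {..<k}"
    let ?t = "\<lambda>(i, j). right_mult S i (GY j, True)"
    have K: "group ?K" by (rule A.subgroup_imp_group[OF subgroup_K_aut])
    have LK: "L \<subseteq> K_aut n k" using L_J by (auto simp: J_def)
    have tK: "?t ` ?I \<subseteq> K_aut n k" by (auto intro: right_mult_K_aut)
    show "f \<in> L"
    proof (rule group.free_abelian_quotient(2)[OF K L_normal, where t = ?t and I = ?I and c = y_coeff])
      show "?t ` ?I \<subseteq> carrier ?K" using tK by simp
      have tL: "?t ` ?I \<union> L \<subseteq> K_aut n k" using tK LK by blast
      have sub: "subgroup (generate (\<AA> S) (?t ` ?I \<union> L)) (\<AA> S)"
        using tL subgroup.subset[OF subgroup_K_aut] by (intro A.generate_is_subgroup) blast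
      have "K_generators n k \<subseteq> generate (\<AA> S) (?t ` ?I \<union> L)"
      proof
        fix s assume "s \<in> K_generators n k"
        then show "s \<in> generate (\<AA> S) (?t ` ?I \<union> L)"
        proof (cases rule: K_generators_cases)
          case (1 i j e)
          then have "(i, j) \<in> ?I" by simp
          then have T: "right_mult S i (GY j, True) \<in> ?t ` ?I" by (rule rev_image_eqI) simp
          have "inv\<^bsub>\<AA> S\<^esub> (right_mult S i (GY j, True)) \<in> generate (\<AA> S) (?t ` ?I \<union> L)"
            using T by (intro generate.inv) blast
          moreover have "right_mult S i (GY j, True) \<in> generate (\<AA> S) (?t ` ?I \<union> L)"
            using T by (intro generate.incl) blast
          ultimately show ?thesis using 1 by (cases e) (simp_all add: inv_right_mult)
        next
          case (2 i j e)
          then show ?thesis using part_conj_X_L[of i j e] by (intro generate.incl) simp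
        next
          case (3 i j e)
          then show ?thesis using part_conj_Y_L[of j "GX i" e] by (intro generate.incl) simp
        next
          case (4 l j e)
          then show ?thesis using part_conj_Y_L[of j "GY l" e] by (intro generate.incl) simp
        qed
      qed
      then have "K_aut n k \<subseteq> generate (\<AA> S) (?t ` ?I \<union> L)"
        unfolding K_aut_eq K0_def by (rule A.generate_subgroup_incl[OF _ sub])
      then show "carrier ?K \<subseteq> generate ?K (?t ` ?I \<union> L)"
        using A.generate_consistent[OF tL subgroup_K_aut] by simp
      show "?t u \<otimes>\<^bsub>?K\<^esub> ?t v \<otimes>\<^bsub>?K\<^esub> inv\<^bsub>?K\<^esub> (?t v \<otimes>\<^bsub>?K\<^esub> ?t u) \<in> L" if uv: "u \<in> ?I" "v \<in> ?I" for u v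
      proof -
        obtain i j h l where u: "u = (i, j)" and v: "v = (h, l)" by (cases u; cases v) auto
        have lt: "i < n" "j < k" "h < n" "l < k" using uv u v by auto
        have tu: "?t u \<in> K_aut n k" "?t v \<in> K_aut n k" using tK uv by blast+
        have vu: "?t v \<bullet> ?t u \<in> K_aut n k" by (rule subgroup.m_closed[OF subgroup_K_aut tu(2,1)])
        have c: "?t v \<bullet> ?t u \<in> carrier (\<AA> S)" using vu subgroup.subset[OF subgroup_K_aut] by blast
        have "\<exists>m\<in>L. ?t u \<bullet> ?t v = m \<bullet> (?t v \<bullet> ?t u)"
        proof (cases "i = h \<and> j \<noteq> l")
          case True
          have cm: "comm_mult S i (GY j, True) (GY l, True) \<in> L" using comm_mult_yy_L lt True by blast
          have "?t u \<bullet> ?t v = comm_mult S i (GY j, True) (GY l, True) \<bullet> (?t v \<bullet> ?t u)"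
            using I.right_mult_swap[of i j l] lt True u v tu subgroup.subset[OF subgroup_K_aut] L_carrier[OF cm]
            by (simp add: A.m_assoc subset_iff)
          then show ?thesis using cm by blast
        next
          case False
          have "?t u \<bullet> ?t v = ?t v \<bullet> ?t u"
          proof (cases "i = h")
            case True
            then show ?thesis using False u v by simp
          next
            case False
            then show ?thesis using u v lt by simp (rule right_mult_commute; simp)
          qed
          then have "?t u \<bullet> ?t v = \<one>\<^bsub>\<AA> S\<^esub> \<bullet> (?t v \<bullet> ?t u)" using c by simp
          then show ?thesis using subgroup.one_closed[OF L.subgroup_axioms] by blast
        qed
        then obtain m where m: "m \<in> L" "?t u \<bullet> ?t v = m \<bullet> (?t v \<bullet> ?t u)" by blast
        have "?t u \<bullet> ?t v \<bullet> inv\<^bsub>\<AA> S\<^esub> (?t v \<bullet> ?t u) = m"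
          unfolding m(2) using c L_carrier[OF m(1)] by (simp add: A.m_assoc)
        then show ?thesis using m(1) A.m_inv_consistent[OF subgroup_K_aut vu] by simp
      qed
      show "y_coeff u \<in> hom ?K integer_group" if "u \<in> ?I" for u
        using that y_coeff_mult by (cases u) (auto intro!: homI)
      show "y_coeff u x = 0" if "u \<in> ?I" "x \<in> L" for u x
        using that L_J IA_expo[of x "[(GX (fst u), True)]" "GY (snd u)"]
        by (auto simp: y_coeff_def J_def split: prod.splits)
      show "y_coeff u (?t v) = (if u = v then 1 else 0)" if "u \<in> ?I" "v \<in> ?I" for u v
        using that realizes_apply[OF realizes_right_mult, of "fst v" S "(GY (snd v), True)" "GX (fst u)"]
        by (cases u; cases v) (auto simp: y_coeff_def gen_word_def letter_sign_def)
      show "f \<in> carrier ?K" using f by (simp add: J_def)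
      show "y_coeff u f = 0" if "u \<in> ?I" for u
        using that f IA_expo[of f "[(GX (fst u), True)]" "GY (snd u)"]
        by (auto simp: y_coeff_def J_def split: prod.splits)
    qed
  qed
qed

end

section \<open>Counting the generators\<close>

lemma card_less_pairs: "card {(j, l). j < l \<and> l < (k::nat)} = k choose 2"
proof (induction k)
  case (Suc k)
  have eq: "{(j, l). j < l \<and> l < Suc k} = {(j, l). j < l \<and> l < k} \<union> (\<lambda>j. (j, k)) ` {..<k}"
    by (auto simp: less_Suc_eq)
  have "finite {(j, l). j < l \<and> l < k}"
    by (rule finite_subset[of _ "{..<k} \<times> {..<k}"]) auto
  then have "card {(j, l). j < l \<and> l < Suc k} = card {(j, l). j < l \<and> l < k} + card ((\<lambda>j. (j, k)) ` {..<k})"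
    unfolding eq by (intro card_Un_disjoint) auto
  also have "card ((\<lambda>j. (j, k)) ` {..<k}) = k" by (subst card_image) (auto simp: inj_on_def)
  finally show ?case using Suc by (simp add: numeral_2_eq_2)
qed (simp add: numeral_2_eq_2)

lemma finite_less_pairs: "finite {(j, l). j < l \<and> l < (k::nat)}"
  by (rule finite_subset[of _ "{..<k} \<times> {..<k}"]) auto

lemma card_neq_pairs: "card {(j, l). j < k \<and> l < (k::nat) \<and> l \<noteq> j} = k * (k - 1)"
proof -
  have "{(j, l). j < k \<and> l < k \<and> l \<noteq> j} = {..<k} \<times> {..<k} - (\<lambda>j. (j, j)) ` {..<k}" by auto
  moreover have "card ({..<k} \<times> {..<k} - (\<lambda>j. (j, j)) ` {..<k}) = card ({..<k} \<times> {..<k}) - card ((\<lambda>j. (j, j)) ` {..<k})"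
    by (rule card_Diff_subset) auto
  moreover have "card ((\<lambda>j. (j, j)) ` {..<k}) = k" by (subst card_image) (auto simp: inj_on_def)
  ultimately show ?thesis by (simp add: diff_mult_distrib2)
qed

context free_factor
begin

text \<open>The coefficient of \<open>a \<and> b\<close> in the value of the Johnson homomorphism at \<open>t\<close>, read off from the
  displacement of \<open>t\<close>.\<close>

definition johnson_coeff :: "gen \<times> gen \<times> gen \<Rightarrow> (gen word \<Rightarrow> gen word) \<Rightarrow> int" where
  "johnson_coeff = (\<lambda>(t, a, b) f. magnus a b (reduce (f [(t, True)] @ winv [(t, True)])))"

lemma johnson_index_gens: assumes "(t, a, b) \<in> johnson_index" shows "t \<in> S" "a \<noteq> b"
  using assms by (auto simp: johnson_index_def)

text \<open>Additivity is inherited from the Johnson homomorphism, since the coefficient is a functional of its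
  value.\<close>

lemma johnson_coeff_mult:
  assumes f: "f \<in> IA n k" and g: "g \<in> IA n k" and x: "x \<in> johnson_index"
  shows "johnson_coeff x (f \<bullet> g) = johnson_coeff x f + johnson_coeff x g"
proof -
  obtain t a b where x': "x = (t, a, b)" by (cases x) auto
  have t: "[(t, True)] \<in> carrier F" and ab: "a \<noteq> b" using johnson_index_gens x x' by auto
  obtain h where h: "h \<in> hom E2 integer_group" "\<And>z. z \<in> \<gamma>2 \<Longrightarrow> h (ext_proj z) = magnus a b z"
    using ext_coordinate[OF ab] by blast
  have c: "johnson_coeff x f = h (johnson_hom n k f (ab_class F [(t, True)]))" if "f \<in> IA n k" for f
  proof -
    have d: "reduce (f [(t, True)] @ winv [(t, True)]) \<in> \<gamma>2" using that t unfolding IA_iff by blast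
    have "johnson_coeff x f = h (ext_proj (reduce (f [(t, True)] @ winv [(t, True)])))"
      unfolding h(2)[OF d] by (simp add: johnson_coeff_def x')
    then show ?thesis using johnson_hom_spec(2)[OF that t] t by (simp add: inv_free_group)
  qed
  have fg: "f \<bullet> g \<in> IA n k" by (rule subgroup.m_closed[OF subgroup_IA f g])
  have cl: "ab_class F [(t, True)] \<in> carrier Ab" using t by (rule F.ab_class_closed)
  have E: "johnson_hom n k f (ab_class F [(t, True)]) \<in> carrier E2" if "f \<in> IA n k" for f
    using johnson_hom_spec(1)[OF that] cl by (auto simp: Hom_group_def hom_def)
  have "johnson_hom n k (f \<bullet> g) (ab_class F [(t, True)])
      = johnson_hom n k f (ab_class F [(t, True)]) \<otimes>\<^bsub>E2\<^esub> johnson_hom n k g (ab_class F [(t, True)])"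
    unfolding johnson_hom_mult[OF f g] using cl by (simp add: Hom_group_def)
  then show ?thesis
    unfolding c[OF fg] c[OF f] c[OF g] using hom_mult[OF h(1) E[OF f] E[OF g]] by simp
qed

lemma johnson_coeff_gen:
  assumes x: "x \<in> johnson_index" and y: "y \<in> johnson_index"
  shows "johnson_coeff x (johnson_gen y) = (if x = y then 1 else 0)"
proof -
  obtain t a b where x': "x = (t, a, b)" by (cases x) auto
  have t: "t \<in> S" and ab: "a \<noteq> b" using johnson_index_gens x x' by auto
  have red: "johnson_coeff x (johnson_gen y) = magnus a b (\<phi> t @ [(t, False)])" if "realizes S (johnson_gen y) \<phi>" for \<phi>
    unfolding johnson_coeff_def x' using realizes_apply[OF that t] by (simp add: magnus_reduce[OF ab] magnus_append)
  from y show ?thesis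
  proof (cases rule: johnson_index_cases)
    case (1 i j)
    have "realizes S (johnson_gen y) (gen_word(GX i := [(GY j, False), (GX i, True), flip (GY j, False)]))"
      unfolding 1(4) using 1 by (intro realizes_part_conj) auto
    from red[OF this] show ?thesis
      using x x' 1(1-3) unfolding johnson_index_def by (auto simp: gen_word_def letter_sign_def)
  next
    case (2 i h j)
    have "realizes S (johnson_gen y) (gen_word(GX i := [(GX i, True), (GX h, True), (GY j, True), flip (GX h, True), flip (GY j, True)]))"
      unfolding 2(6) using 2 by (intro realizes_comm_mult) auto
    from red[OF this] show ?thesis
      using x x' 2(1-5) unfolding johnson_index_def by (auto simp: gen_word_def letter_sign_def)
  next
    case (3 i j l)
    have "realizes S (johnson_gen y) (gen_word(GX i := [(GX i, True), (GY j, True), (GY l, True), flip (GY j, True), flip (GY l, True)]))"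
      unfolding 3(5) using 3 by (intro realizes_comm_mult) auto
    from red[OF this] show ?thesis
      using x x' 3(1-4) unfolding johnson_index_def by (auto simp: gen_word_def letter_sign_def)
  next
    case (4 i j)
    have "realizes S (johnson_gen y) (gen_word(GY j := [(GX i, True), (GY j, True), flip (GX i, True)]))"
      unfolding 4(4) using 4 by (intro realizes_part_conj) auto
    from red[OF this] show ?thesis
      using x x' 4(1-3) unfolding johnson_index_def by (auto simp: gen_word_def letter_sign_def)
  next
    case (5 l j)
    have "realizes S (johnson_gen y) (gen_word(GY j := [(GY l, True), (GY j, True), flip (GY l, True)]))"
      unfolding 5(5) using 5 by (intro realizes_part_conj) auto
    from red[OF this] show ?thesis
      using x x' 5(1-4) unfolding johnson_index_def by (auto simp: gen_word_def letter_sign_def)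
  qed
qed

text \<open>The generators of \<open>L\<close> and the Johnson coefficients are dual families, and \<open>J\<close> is \<open>L\<close>.\<close>

lemma K_IA_quotient:
  shows "free_Abelian_group johnson_index \<cong> abelianization (K_IA n k)"
    and "\<And>f. f \<in> J \<Longrightarrow> (\<And>x. x \<in> johnson_index \<Longrightarrow> johnson_coeff x f = 0) \<Longrightarrow> f \<in> commutator (K_IA n k)"
proof -
  interpret G: group "K_IA n k" by (rule group_K_IA)
  have c: "johnson_gen ` johnson_index \<subseteq> carrier (K_IA n k)" using johnson_gen_J by (auto simp: carrier_K_IA)
  have gen: "carrier (K_IA n k) \<subseteq> generate (K_IA n k) (johnson_gen ` johnson_index \<union> commutator (K_IA n k))"
    unfolding carrier_K_IA commutator_K_IA unfolding K_IA_eq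
    using A.generate_consistent[OF L_gens_J subgroup_J] J_eq_L by (simp add: L_def)
  have comm: "johnson_gen x \<otimes>\<^bsub>K_IA n k\<^esub> johnson_gen y \<otimes>\<^bsub>K_IA n k\<^esub> inv\<^bsub>K_IA n k\<^esub> (johnson_gen y \<otimes>\<^bsub>K_IA n k\<^esub> johnson_gen x) \<in> commutator (K_IA n k)"
    if "x \<in> johnson_index" "y \<in> johnson_index" for x y
  proof -
    have xy: "johnson_gen x \<in> carrier (K_IA n k)" "johnson_gen y \<in> carrier (K_IA n k)" using c that by auto
    then have "johnson_gen x \<otimes>\<^bsub>K_IA n k\<^esub> johnson_gen y \<otimes>\<^bsub>K_IA n k\<^esub> inv\<^bsub>K_IA n k\<^esub> (johnson_gen y \<otimes>\<^bsub>K_IA n k\<^esub> johnson_gen x)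
        = comm (K_IA n k) (johnson_gen x) (johnson_gen y)"
      by (simp add: comm_def G.inv_mult_group G.m_assoc)
    then show ?thesis using G.comm_in_commutator[OF xy] by simp
  qed
  have hom: "johnson_coeff x \<in> hom (K_IA n k) integer_group" if "x \<in> johnson_index" for x
    using johnson_coeff_mult[OF _ _ that] by (intro homI) (auto simp: K_IA_eq J_def)
  have zero: "johnson_coeff x f = 0" if "x \<in> johnson_index" "f \<in> commutator (K_IA n k)" for x f
    using G.hom_commutator_one[OF abelian_integer_group hom[OF that(1)] that(2)] by simp
  note q = G.free_abelian_quotient[OF G.commutator_normal c gen comm hom zero johnson_coeff_gen]
  show "free_Abelian_group johnson_index \<cong> abelianization (K_IA n k)"
    unfolding abelianization_def by (rule q(1))
  show "f \<in> commutator (K_IA n k)" if "f \<in> J" "\<And>x. x \<in> johnson_index \<Longrightarrow> johnson_coeff x f = 0" for f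
    using q(2) that by (simp add: carrier_K_IA)
qed

text \<open>The term \<open>n (n - 1) k\<close> of the formula counts the commutators with \<open>h \<noteq> i\<close>; the triples with \<open>h = i\<close>
  account for one of the two summands \<open>n k\<close>.\<close>

lemma card_johnson_index: "finite johnson_index" "card johnson_index = n * (n - 1) * k + n * (k choose 2) + 2 * n * k + k * (k - 1)"
proof -
  let ?A = "(\<lambda>(i, h, j). (GX i, GX h, GY j)) ` ({..<n} \<times> {..<n} \<times> {..<k})"
  let ?B = "(\<lambda>(i, j, l). (GX i, GY j, GY l)) ` ({..<n} \<times> {(j, l). j < l \<and> l < k})"
  let ?C = "(\<lambda>(i, j). (GY j, GX i, GY j)) ` ({..<n} \<times> {..<k})"
  let ?D = "(\<lambda>(j, l). (GY j, GY l, GY j)) ` {(j, l). j < k \<and> l < k \<and> l \<noteq> j}"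
  have eq: "johnson_index = ?A \<union> ?B \<union> ?C \<union> ?D"
    unfolding johnson_index_def by (auto simp: image_iff)
  have finD: "finite {(j, l). j < k \<and> l < k \<and> l \<noteq> j}"
    by (rule finite_subset[of _ "{..<k} \<times> {..<k}"]) auto
  have fin: "finite ?A" "finite ?B" "finite ?C" "finite ?D"
    using finite_less_pairs[of k] finD by auto
  show "finite johnson_index" unfolding eq using fin by blast
  have cards: "card ?A = n * (n * k)" "card ?B = n * (k choose 2)" "card ?C = n * k" "card ?D = k * (k - 1)"
  proof -
    show "card ?A = n * (n * k)" by (subst card_image) (auto simp: inj_on_def)
    show "card ?B = n * (k choose 2)"
      by (subst card_image) (auto simp: inj_on_def card_less_pairs card_cartesian_product)
    show "card ?C = n * k" by (subst card_image) (auto simp: inj_on_def)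
    show "card ?D = k * (k - 1)" by (subst card_image) (auto simp: inj_on_def card_neq_pairs)
  qed
  have "card johnson_index = card ?A + card ?B + card ?C + card ?D"
  proof -
    have d1: "?A \<inter> ?B = {}" and d2: "(?A \<union> ?B) \<inter> ?C = {}" and d3: "(?A \<union> ?B \<union> ?C) \<inter> ?D = {}" by auto
    have "card (?A \<union> ?B \<union> ?C \<union> ?D) = card (?A \<union> ?B \<union> ?C) + card ?D"
      by (rule card_Un_disjoint[OF _ fin(4) d3]) (use fin in blast)
    moreover have "card (?A \<union> ?B \<union> ?C) = card (?A \<union> ?B) + card ?C"
      by (rule card_Un_disjoint[OF _ fin(3) d2]) (use fin in blast)
    moreover have "card (?A \<union> ?B) = card ?A + card ?B"
      by (rule card_Un_disjoint[OF fin(1,2) d1])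
    ultimately show ?thesis unfolding eq by linarith
  qed
  also have "\<dots> = n * (n - 1) * k + n * (k choose 2) + 2 * n * k + k * (k - 1)"
  proof -
    have "n * (n * k) + n * k = n * (n - 1) * k + 2 * n * k" by (cases n) (simp_all add: algebra_simps)
    then show ?thesis unfolding cards by linarith
  qed
  finally show "card johnson_index = n * (n - 1) * k + n * (k choose 2) + 2 * n * k + k * (k - 1)" .
qed

end

section \<open>First homology and abelianization\<close>

lemma free_Abelian_group_iso_card:
  assumes "finite A" shows "free_Abelian_group A \<cong> free_Abelian_group {..<card A}"
proof -
  have "A \<approx> {..<card A}" using eqpoll_iff_card[OF assms finite_lessThan, of "card A"] by simp
  then show ?thesis by (simp add: isomorphic_free_Abelian_groups)
qed

lemma (in group) bar_boundary_subgroup: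
  "subgroup (bar_d2 G ` carrier (free_Abelian_group (carrier G \<times> carrier G))) (free_Abelian_group (carrier G))"
  "bar_d2 G \<in> hom (free_Abelian_group (carrier G \<times> carrier G)) (free_Abelian_group (carrier G))"
proof -
  let ?Z = "free_Abelian_group (carrier G)" and ?Z2 = "free_Abelian_group (carrier G \<times> carrier G)"
  have cell: "Poly_Mapping.keys (frag_of h - frag_of (g \<otimes> h) + frag_of g) \<subseteq> carrier G"
    if "g \<in> carrier G" "h \<in> carrier G" for g h
    using that keys_add[of "frag_of h - frag_of (g \<otimes> h)" "frag_of g"] keys_diff[of "frag_of h" "frag_of (g \<otimes> h)"]
    by fastforce
  show hom: "bar_d2 G \<in> hom ?Z2 ?Z"
  proof (rule homI)
    fix x assume "x \<in> carrier ?Z2"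
    then have x: "Poly_Mapping.keys x \<subseteq> carrier G \<times> carrier G" by simp
    show "bar_d2 G x \<in> carrier ?Z"
    proof -
      have "Poly_Mapping.keys (bar_d2 G x) \<subseteq> (\<Union>p\<in>Poly_Mapping.keys x.
          Poly_Mapping.keys (case p of (g, h) \<Rightarrow> frag_of h - frag_of (g \<otimes> h) + frag_of g))"
        unfolding bar_d2_def by (rule keys_frag_extend)
      also have "\<dots> \<subseteq> carrier G" using x cell by (intro UN_least) (auto split: prod.splits dest!: cell[THEN subsetD])
      finally show ?thesis by simp
    qed
  qed (simp add: bar_d2_def frag_extend_add)
  interpret d: group_hom ?Z2 ?Z "bar_d2 G"
    by (intro group_hom.intro group_hom_axioms.intro hom) simp_all
  show "subgroup (bar_d2 G ` carrier ?Z2) ?Z" by (rule d.subgroup_img_is_subgroup[OF d.G.subgroup_self])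
qed

text \<open>The first boundary map is zero, so every chain is a cycle. Modulo boundaries the chains \<open>[g]\<close> are
  multiplicative in \<open>g\<close>, so \<open>g \<mapsto> [g]\<close> factors through the abelianization, and this is inverse to the
  map that sends \<open>[g]\<close> to the class of \<open>g\<close>.\<close>

theorem (in group) group_H1_iso_abelianization: "group_H1 G \<cong> abelianization G"
proof -
  let ?Z = "free_Abelian_group (carrier G)" and ?Z2 = "free_Abelian_group (carrier G \<times> carrier G)"
  define Bd where "Bd = bar_d2 G ` carrier ?Z2"
  have sub: "subgroup Bd ?Z" unfolding Bd_def by (rule bar_boundary_subgroup(1))
  have "bar_d1 x = 0" for x :: "'a \<Rightarrow>\<^sub>0 int"
    unfolding bar_d1_def by (rule frag_extend_eq_0) simp
  then have "kernel ?Z (free_Abelian_group {()}) bar_d1 = carrier ?Z" by (auto simp: kernel_def)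
  then have H1: "group_H1 G = ?Z Mod Bd" unfolding group_H1_def Bd_def by simp
  interpret Ab: comm_group "abelianization G" by (rule abelianization_comm_group)
  obtain \<psi> where \<psi>: "\<psi> \<in> hom ?Z (abelianization G)" "\<And>g. g \<in> carrier G \<Longrightarrow> \<psi> (frag_of g) = ab_class G g"
    by (rule Ab.free_Abelian_group_universal[of "ab_class G" "carrier G"])
       (auto simp: ab_class_closed)
  interpret \<psi>: group_hom ?Z "abelianization G" \<psi>
    by (intro group_hom.intro group_hom_axioms.intro \<psi>(1) Ab.group_axioms) simp
  have surj: "\<psi> ` carrier ?Z = carrier (abelianization G)"
  proof
    show "\<psi> ` carrier ?Z \<subseteq> carrier (abelianization G)" using \<psi>.hom_closed by auto
    show "carrier (abelianization G) \<subseteq> \<psi> ` carrier ?Z"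
    proof
      fix C assume "C \<in> carrier (abelianization G)"
      then obtain g where g: "g \<in> carrier G" "C = ab_class G g" using ab_class_surj by blast
      then have "C = \<psi> (frag_of g)" by (simp add: \<psi>(2))
      moreover have "frag_of g \<in> carrier ?Z" using g by simp
      ultimately show "C \<in> \<psi> ` carrier ?Z" by (rule image_eqI)
    qed
  qed
  have boundary: "frag_of h - frag_of (g \<otimes> h) + frag_of g \<in> Bd" if "g \<in> carrier G" "h \<in> carrier G" for g h
  proof -
    have "bar_d2 G (frag_of (g, h)) = frag_of h - frag_of (g \<otimes> h) + frag_of g" by (simp add: bar_d2_def)
    moreover have "frag_of (g, h) \<in> carrier ?Z2" using that by simp
    ultimately show ?thesis unfolding Bd_def by (metis image_eqI)
  qed
  have normal: "Bd \<lhd> ?Z" by (rule comm_group.subgroup_imp_normal[OF abelian_free_Abelian_group sub])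
  have HQ: "comm_group (?Z Mod Bd)" by (rule comm_group.abelian_FactGroup[OF abelian_free_Abelian_group sub])
  have add: "x + y \<in> Bd" "- x \<in> Bd" if "x \<in> Bd" "y \<in> Bd" for x y
    using subgroup.m_closed[OF sub that] subgroup.m_inv_closed[OF sub that(1)] subgroup.mem_carrier[OF sub that(1)]
    by simp_all
  have eqI: "Bd #>\<^bsub>?Z\<^esub> x = Bd #>\<^bsub>?Z\<^esub> y" if "x \<in> carrier ?Z" "y \<in> carrier ?Z" "x - y \<in> Bd" for x y
    using that by (intro group.rcos_eqI[OF group_free_Abelian_group sub]) simp_all
  have frag_hom: "(\<lambda>g. Bd #>\<^bsub>?Z\<^esub> frag_of g) \<in> hom G (?Z Mod Bd)"
  proof (rule homI)
    fix g h assume gh: "g \<in> carrier G" "h \<in> carrier G"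
    show "Bd #>\<^bsub>?Z\<^esub> frag_of g \<in> carrier (?Z Mod Bd)" using gh(1) by (auto simp: carrier_FactGroup)
    have "Bd #>\<^bsub>?Z\<^esub> frag_of (g \<otimes> h) = Bd #>\<^bsub>?Z\<^esub> (frag_of g + frag_of h)"
    proof (rule eqI)
      have "- (frag_of h - frag_of (g \<otimes> h) + frag_of g) \<in> Bd" using boundary[OF gh] add(2) by blast
      then show "frag_of (g \<otimes> h) - (frag_of g + frag_of h) \<in> Bd" by (simp add: algebra_simps)
      show "frag_of g + frag_of h \<in> carrier ?Z" using gh keys_add[of "frag_of g" "frag_of h"] by auto
    qed (use gh in simp)
    also have "\<dots> = (Bd #>\<^bsub>?Z\<^esub> frag_of g) \<otimes>\<^bsub>?Z Mod Bd\<^esub> (Bd #>\<^bsub>?Z\<^esub> frag_of h)"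
      using normal.rcos_sum[OF normal, of "frag_of g" "frag_of h"] gh by simp
    finally show "Bd #>\<^bsub>?Z\<^esub> frag_of (g \<otimes> h) = (Bd #>\<^bsub>?Z\<^esub> frag_of g) \<otimes>\<^bsub>?Z Mod Bd\<^esub> (Bd #>\<^bsub>?Z\<^esub> frag_of h)" .
  qed
  interpret fr: group_hom G "?Z Mod Bd" "\<lambda>g. Bd #>\<^bsub>?Z\<^esub> frag_of g"
    using frag_hom HQ by (intro group_hom.intro group_hom_axioms.intro group_axioms) (simp_all add: comm_group_def)
  have "commutator G \<subseteq> kernel G (?Z Mod Bd) (\<lambda>g. Bd #>\<^bsub>?Z\<^esub> frag_of g)"
    using hom_commutator_one[OF HQ frag_hom] subgroup.mem_carrier[OF normal_imp_subgroup[OF commutator_normal]]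
    by (auto simp: kernel_def)
  then obtain \<theta> where \<theta>: "\<theta> \<in> hom (abelianization G) (?Z Mod Bd)"
    "\<And>g. g \<in> carrier G \<Longrightarrow> \<theta> (ab_class G g) = Bd #>\<^bsub>?Z\<^esub> frag_of g"
    using fr.FactGroup_universal_kernel[OF commutator_normal] unfolding abelianization_def ab_class_def by blast
  have \<theta>\<psi>: "\<theta> (\<psi> x) = Bd #>\<^bsub>?Z\<^esub> x" if "x \<in> carrier ?Z" for x
  proof (rule free_Abelian_group_hom_eqI[OF fr.H.group_axioms _ _ _ that])
    show "(\<lambda>x. \<theta> (\<psi> x)) \<in> hom ?Z (?Z Mod Bd)"
      using Group.hom_compose[OF \<psi>(1) \<theta>(1)] by (simp only: comp_def)
    show "(\<lambda>x. Bd #>\<^bsub>?Z\<^esub> x) \<in> hom ?Z (?Z Mod Bd)" by (rule normal.r_coset_hom_Mod[OF normal])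
    show "\<theta> (\<psi> (frag_of g)) = Bd #>\<^bsub>?Z\<^esub> frag_of g" if "g \<in> carrier G" for g
      using \<psi>(2)[OF that] \<theta>(2)[OF that] by simp
  qed
  have kernel: "kernel ?Z (abelianization G) \<psi> = Bd"
  proof
    have cell: "\<psi> (frag_of h - frag_of (g \<otimes> h) + frag_of g) = \<one>\<^bsub>abelianization G\<^esub>" if gh: "g \<in> carrier G" "h \<in> carrier G" for g h
    proof -
      let ?u = "frag_of h :: 'a \<Rightarrow>\<^sub>0 int" and ?v = "frag_of (g \<otimes> h) :: 'a \<Rightarrow>\<^sub>0 int" and ?w = "frag_of g :: 'a \<Rightarrow>\<^sub>0 int"
      have c: "?u \<in> carrier ?Z" "?v \<in> carrier ?Z" "?w \<in> carrier ?Z" using gh by simp_all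
      have cl: "ab_class G g \<in> carrier (abelianization G)" "ab_class G h \<in> carrier (abelianization G)"
        using gh ab_class_closed by auto
      have "\<psi> (?u \<otimes>\<^bsub>?Z\<^esub> inv\<^bsub>?Z\<^esub> ?v \<otimes>\<^bsub>?Z\<^esub> ?w) = \<psi> ?u \<otimes>\<^bsub>abelianization G\<^esub> inv\<^bsub>abelianization G\<^esub> (\<psi> ?v) \<otimes>\<^bsub>abelianization G\<^esub> \<psi> ?w"
        using c by (simp only: \<psi>.hom_mult \<psi>.hom_inv \<psi>.G.inv_closed \<psi>.G.m_closed)
      also have "\<dots> = \<one>\<^bsub>abelianization G\<^esub>"
      proof -
        have v: "\<psi> ?v = \<psi> ?w \<otimes>\<^bsub>abelianization G\<^esub> \<psi> ?u" using gh by (simp add: \<psi>(2) ab_class_mult)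
        have uw: "\<psi> ?u \<in> carrier (abelianization G)" "\<psi> ?w \<in> carrier (abelianization G)"
          using gh cl by (simp_all add: \<psi>(2))
        have "\<psi> ?u \<otimes>\<^bsub>abelianization G\<^esub> inv\<^bsub>abelianization G\<^esub> (\<psi> ?v) \<otimes>\<^bsub>abelianization G\<^esub> \<psi> ?w
          = (\<psi> ?w \<otimes>\<^bsub>abelianization G\<^esub> \<psi> ?u) \<otimes>\<^bsub>abelianization G\<^esub> inv\<^bsub>abelianization G\<^esub> (\<psi> ?v)"
          using uw unfolding v by (simp only: Ab.m_ac Ab.m_closed Ab.inv_closed)
        then show ?thesis using uw unfolding v by simp
      qed
      finally show ?thesis using c by simp
    qed
    have "\<psi> (bar_d2 G x) = \<one>\<^bsub>abelianization G\<^esub>" if "x \<in> carrier ?Z2" for x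
    proof (rule free_Abelian_group_hom_eqI[OF Ab.group_axioms _ _ _ that])
      show "(\<lambda>x. \<psi> (bar_d2 G x)) \<in> hom ?Z2 (abelianization G)"
        using Group.hom_compose[OF bar_boundary_subgroup(2) \<psi>(1)] by (simp only: comp_def)
      show "(\<lambda>x. \<one>\<^bsub>abelianization G\<^esub>) \<in> hom ?Z2 (abelianization G)" by (rule homI) simp_all
      show "\<psi> (bar_d2 G (frag_of p)) = \<one>\<^bsub>abelianization G\<^esub>" if "p \<in> carrier G \<times> carrier G" for p
        using cell that by (cases p) (simp add: bar_d2_def)
    qed
    then show "Bd \<subseteq> kernel ?Z (abelianization G) \<psi>"
      using hom_in_carrier[OF bar_boundary_subgroup(2)] unfolding Bd_def kernel_def by blast
    show "kernel ?Z (abelianization G) \<psi> \<subseteq> Bd"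
    proof
      fix x assume "x \<in> kernel ?Z (abelianization G) \<psi>"
      then have x: "x \<in> carrier ?Z" "\<psi> x = \<one>\<^bsub>abelianization G\<^esub>" by (auto simp: kernel_def)
      have "Bd #>\<^bsub>?Z\<^esub> x = \<one>\<^bsub>?Z Mod Bd\<^esub>"
        using \<theta>\<psi>[OF x(1)] x(2) hom_one[OF \<theta>(1) Ab.group_axioms fr.H.group_axioms] by simp
      then show "x \<in> Bd" using group.rcos_self[OF group_free_Abelian_group x(1) sub] by simp
    qed
  qed
  show ?thesis unfolding H1 kernel[symmetric] using \<psi>.FactGroup_iso[OF surj] .
qed

section \<open>Homology of the kernel and the Johnson homomorphism\<close>

context free_factor
begin

abbreviation "johnson \<equiv> johnson_hom n k"

lemma HomG_comm_group: "comm_group HomG"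
  by (rule Hom_group_comm_group[OF Ab_group E2_comm_group])

lemma johnson_hom_K_IA: "johnson \<in> hom (K_IA n k) HomG"
  by (rule homI) (auto simp: K_IA_eq J_def johnson_hom_spec(1) johnson_hom_mult)

text \<open>If the Johnson homomorphism vanishes on an element, so do its Johnson coefficients, and the element
  is a product of commutators.\<close>

lemma johnson_abelianization:
  "\<exists>\<phi> \<in> iso (abelianization (K_IA n k)) (johnson_image n k).
     \<forall>f \<in> carrier (K_IA n k). \<phi> (ab_class (K_IA n k) f) = johnson f"
proof -
  interpret G: group "K_IA n k" by (rule group_K_IA)
  interpret H: comm_group HomG by (rule HomG_comm_group)
  interpret j: group_hom "K_IA n k" HomG johnson
    by (intro group_hom.intro group_hom_axioms.intro G.group_axioms H.group_axioms johnson_hom_K_IA)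
  have one: "johnson f = \<one>\<^bsub>HomG\<^esub>" if "f \<in> commutator (K_IA n k)" for f
    by (rule G.hom_commutator_one[OF HomG_comm_group johnson_hom_K_IA that])
  have comm_sub: "commutator (K_IA n k) \<subseteq> carrier (K_IA n k)"
    using normal_imp_subgroup[OF G.commutator_normal] subgroup.subset by blast
  have "commutator (K_IA n k) \<subseteq> kernel (K_IA n k) HomG johnson"
    using one comm_sub by (auto simp: kernel_def)
  then obtain \<phi> where \<phi>: "\<phi> \<in> hom (abelianization (K_IA n k)) HomG"
    "\<And>f. f \<in> carrier (K_IA n k) \<Longrightarrow> \<phi> (ab_class (K_IA n k) f) = johnson f"
    using j.FactGroup_universal_kernel[OF G.commutator_normal]
    unfolding abelianization_def ab_class_def by blast
  have image: "\<phi> ` carrier (abelianization (K_IA n k)) = johnson ` carrier (K_IA n k)"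
  proof
    show "\<phi> ` carrier (abelianization (K_IA n k)) \<subseteq> johnson ` carrier (K_IA n k)"
      using G.ab_class_surj \<phi>(2) by fastforce
    show "johnson ` carrier (K_IA n k) \<subseteq> \<phi> ` carrier (abelianization (K_IA n k))"
      using G.ab_class_closed by (auto simp: \<phi>(2)[symmetric])
  qed
  have inj: "inj_on \<phi> (carrier (abelianization (K_IA n k)))"
  proof (rule inj_onI)
    fix C C' assume "C \<in> carrier (abelianization (K_IA n k))" "C' \<in> carrier (abelianization (K_IA n k))"
      and eq: "\<phi> C = \<phi> C'"
    then obtain f g where fg: "f \<in> carrier (K_IA n k)" "C = ab_class (K_IA n k) f"
      "g \<in> carrier (K_IA n k)" "C' = ab_class (K_IA n k) g"
      using G.ab_class_surj by metis
    let ?h = "f \<otimes>\<^bsub>K_IA n k\<^esub> inv\<^bsub>K_IA n k\<^esub> g"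
    have "?h \<in> carrier (K_IA n k)" using fg by simp
    then have hJ: "?h \<in> J" by (simp only: carrier_K_IA)
    have "johnson f = johnson g" using eq fg \<phi>(2) by simp
    then have "johnson ?h = \<one>\<^bsub>HomG\<^esub>" using fg j.hom_closed[of g] by simp
    also have "\<dots> = johnson \<one>\<^bsub>\<AA> S\<^esub>"
      using j.hom_one by (simp add: K_IA_eq)
    finally have jh: "johnson ?h = johnson \<one>\<^bsub>\<AA> S\<^esub>" .
    have "johnson_coeff x ?h = 0" if x: "x \<in> johnson_index" for x
    proof -
      obtain t a b where x': "x = (t, a, b)" by (cases x) auto
      have t: "[(t, True)] \<in> carrier F" and ab: "a \<noteq> b" using johnson_index_gens x x' by auto
      have "?h \<in> IA n k" using hJ by (simp add: J_def)
      then have "johnson_coeff x ?h = johnson_coeff x \<one>\<^bsub>\<AA> S\<^esub>"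
        unfolding johnson_coeff_def x'
        using johnson_hom_eq_imp_magnus[OF _ subgroup.one_closed[OF subgroup_IA] jh t ab] by simp
      also have "\<dots> = 0"
        unfolding johnson_coeff_def x' using t by (simp add: one_AutoGroup reduce_def)
      finally show ?thesis .
    qed
    then have "?h \<in> commutator (K_IA n k)" using K_IA_quotient(2)[OF hJ] by blast
    then show "C = C'" using G.ab_class_eq_iff fg by blast
  qed
  have "\<phi> \<in> hom (abelianization (K_IA n k)) (johnson_image n k)"
    using \<phi>(1) image unfolding johnson_image_def by (auto simp: hom_def Pi_iff)
  then have "\<phi> \<in> iso (abelianization (K_IA n k)) (johnson_image n k)"
    using inj image by (simp add: iso_def bij_betw_def johnson_image_def)
  then show ?thesis using \<phi>(2) by blast
qed

lemma H1_free_abelian: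
  "group_H1 (K_IA n k) \<cong>
     free_Abelian_group {..<n * (n - 1) * k + n * (k choose 2) + 2 * n * k + k * (k - 1)}"
proof -
  interpret G: group "K_IA n k" by (rule group_K_IA)
  have "group_H1 (K_IA n k) \<cong> abelianization (K_IA n k)" by (rule G.group_H1_iso_abelianization)
  also have "abelianization (K_IA n k) \<cong> free_Abelian_group johnson_index"
    by (rule group.iso_sym[OF group_free_Abelian_group K_IA_quotient(1)])
  also have "free_Abelian_group johnson_index \<cong> free_Abelian_group {..<card johnson_index}"
    by (rule free_Abelian_group_iso_card[OF card_johnson_index(1)])
  finally show ?thesis unfolding card_johnson_index(2) .
qed

end

theorem theorem3:
  fixes n k :: nat
  shows "group_H1 (K_IA n k) \<cong>
           free_Abelian_group {..<n * (n - 1) * k + n * (k choose 2) + 2 * n * k + k * (k - 1)}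
    \<and> (\<exists>\<phi> \<in> iso (abelianization (K_IA n k)) (johnson_image n k).
          \<forall>f \<in> carrier (K_IA n k). \<phi> (ab_class (K_IA n k) f) = johnson_hom n k f)"
  using free_factor.H1_free_abelian free_factor.johnson_abelianization by blast

end
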